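(* Let $k$ be an arbitrary field and let $G$ be a torsion soluble group. (a) If $G$ is abelian, then $G$ has a faithful irreducible representation over $k$ if and only if $\mathrm{char}(k)\notin\Pi(G)$ and $G$ is locally cyclic. (b) If $G$ is nonabelian, then $G$ has a faithful irreducible representation over $k$ if and only if $G$ has a maximal abelian normal subgroup $A$ such that $\mathrm{char}(k)\notin\Pi(A)$ and there is a subgroup $C$ of $A$ such that $A/C$ is locally cyclic and $\mathrm{core}_G(C)=1$.
   Context: Groups may be infinite and representations may be infinite dimensional; a representation of $G$ over $k$ corresponds to a left $kG$-module, where $kG$ is the group algebra. It is faithful if only the identity of $G$ acts trivially, and irreducible if the module is nonzero and has no submodules other than $0$ and itself. A maximal abelian normal subgroup of $G$ is a maximal element (under inclusion) of the set of subgroups of $G$ that are both abelian and normal in $G$. A group is locally cyclic if every finitely generated subgroup of it is cyclic. For a subgroup $C$ of $G$, $\mathrm{core}_G(C)$ is the largest normal subgroup of $G$ contained in $C$, i.e. $\bigcap_{g\in G} gCg^{-1}$. For a group $H$, $\Pi(H)$ is the set of all primes $p$ such that $a^p=1$ for some $a\in H$, $a\neq 1$. *)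

theory Defs
  imports
    "HOL-Algebra.Group_Action"
    "HOL-Algebra.Solvable_Groups"
    "HOL-Algebra.Elementary_Groups"
    "HOL-Algebra.Module"
    "HOL-Computational_Algebra.Primes"
begin

section \<open>Groups\<close>

definition torsion_group :: "('g, 'n) monoid_scheme \<Rightarrow> bool" where
  "torsion_group G \<longleftrightarrow>
     (\<forall>x \<in> carrier G. \<exists>n::nat. 0 < n \<and> x [^]\<^bsub>G\<^esub> n = \<one>\<^bsub>G\<^esub>)"

definition locally_cyclic :: "('g, 'n) monoid_scheme \<Rightarrow> bool" where
  "locally_cyclic G \<longleftrightarrow>
     (\<forall>S. finite S \<and> S \<subseteq> carrier G \<longrightarrow> cyclic_group (subgroup_generated G S))"

definition abelian_normal_subgroup :: "('g, 'n) monoid_scheme \<Rightarrow> 'g set \<Rightarrow> bool" where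
  "abelian_normal_subgroup G A \<longleftrightarrow> A \<lhd> G \<and> comm_group (G\<lparr>carrier := A\<rparr>)"

definition maximal_abelian_normal_subgroup :: "('g, 'n) monoid_scheme \<Rightarrow> 'g set \<Rightarrow> bool" where
  "maximal_abelian_normal_subgroup G A \<longleftrightarrow>
     abelian_normal_subgroup G A \<and>
     (\<forall>B. abelian_normal_subgroup G B \<and> A \<subseteq> B \<longrightarrow> B = A)"

definition normal_core :: "('g, 'n) monoid_scheme \<Rightarrow> 'g set \<Rightarrow> 'g set" where
  "normal_core G C = (\<Inter>g \<in> carrier G. g <#\<^bsub>G\<^esub> C #>\<^bsub>G\<^esub> inv\<^bsub>G\<^esub> g)"

definition torsion_primes :: "('g, 'n) monoid_scheme \<Rightarrow> nat set" where
  "torsion_primes H =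
     {p. Factorial_Ring.prime p \<and>
         (\<exists>a \<in> carrier H. a \<noteq> \<one>\<^bsub>H\<^esub> \<and> a [^]\<^bsub>H\<^esub> p = \<one>\<^bsub>H\<^esub>)}"

text \<open>The characteristic, with the usual convention that it is 0 when no positive multiple of
  the unit vanishes.\<close>

definition ring_characteristic :: "('k, 'm) ring_scheme \<Rightarrow> nat" where
  "ring_characteristic R =
     (if \<exists>n::nat. 0 < n \<and> [n] \<cdot>\<^bsub>R\<^esub> \<one>\<^bsub>R\<^esub> = \<zero>\<^bsub>R\<^esub>
      then LEAST n. 0 < n \<and> [n] \<cdot>\<^bsub>R\<^esub> \<one>\<^bsub>R\<^esub> = \<zero>\<^bsub>R\<^esub>
      else 0)"

section \<open>Representations\<close>

text \<open>A representation of \<open>G\<close> over \<open>k\<close>, that is, a left \<open>kG\<close>-module: a vector space of arbitrary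
  dimension on which \<open>G\<close> acts by linear automorphisms. The ring multiplication and unit that
  the record type \<^typ>\<open>('k, 'v) module\<close> inherits play no role for \<open>V\<close>.\<close>

locale group_representation =
  field k + module k V + group_action G "carrier V" \<rho>
  for k :: "('k, 'm) ring_scheme" and G :: "('g, 'n) monoid_scheme"
    and V :: "('k, 'v, 'l) module_scheme" and \<rho> :: "'g \<Rightarrow> 'v \<Rightarrow> 'v" +
  assumes act_add: "\<lbrakk>g \<in> carrier G; v \<in> carrier V; w \<in> carrier V\<rbrakk>
      \<Longrightarrow> \<rho> g (v \<oplus>\<^bsub>V\<^esub> w) = \<rho> g v \<oplus>\<^bsub>V\<^esub> \<rho> g w"
    and act_smult: "\<lbrakk>g \<in> carrier G; c \<in> carrier k; v \<in> carrier V\<rbrakk>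
      \<Longrightarrow> \<rho> g (c \<odot>\<^bsub>V\<^esub> v) = c \<odot>\<^bsub>V\<^esub> \<rho> g v"

text \<open>The \<open>kG\<close>-submodules are the \<open>k\<close>-subspaces stable under \<open>G\<close>.\<close>

definition subrepresentation ::
  "'v set \<Rightarrow> ('k, 'm) ring_scheme \<Rightarrow> ('g, 'n) monoid_scheme
    \<Rightarrow> ('k, 'v, 'l) module_scheme \<Rightarrow> ('g \<Rightarrow> 'v \<Rightarrow> 'v) \<Rightarrow> bool" where
  "subrepresentation W k G V \<rho> \<longleftrightarrow>
     submodule W k V \<and> (\<forall>g \<in> carrier G. \<forall>w \<in> W. \<rho> g w \<in> W)"

definition irreducible_representation ::
  "('k, 'm) ring_scheme \<Rightarrow> ('g, 'n) monoid_scheme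
    \<Rightarrow> ('k, 'v, 'l) module_scheme \<Rightarrow> ('g \<Rightarrow> 'v \<Rightarrow> 'v) \<Rightarrow> bool" where
  "irreducible_representation k G V \<rho> \<longleftrightarrow>
     group_representation k G V \<rho> \<and> carrier V \<noteq> {\<zero>\<^bsub>V\<^esub>} \<and>
     (\<forall>W. subrepresentation W k G V \<rho> \<longrightarrow> W = {\<zero>\<^bsub>V\<^esub>} \<or> W = carrier V)"

definition faithful_representation ::
  "('k, 'm) ring_scheme \<Rightarrow> ('g, 'n) monoid_scheme
    \<Rightarrow> ('k, 'v, 'l) module_scheme \<Rightarrow> ('g \<Rightarrow> 'v \<Rightarrow> 'v) \<Rightarrow> bool" where
  "faithful_representation k G V \<rho> \<longleftrightarrow>
     group_representation k G V \<rho> \<and>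
     (\<forall>g \<in> carrier G. (\<forall>v \<in> carrier V. \<rho> g v = v) \<longrightarrow> g = \<one>\<^bsub>G\<^esub>)"

text \<open>HOL cannot quantify existentially over the type of vectors, so the vectors are taken in
  \<^typ>\<open>'g \<Rightarrow> 'k\<close>; the carrier and the operations are otherwise arbitrary. This loses no
  generality: the theorem
  \<open>has_faithful_irreducible_representationI\<close> below shows that a faithful irreducible representation
  with vectors in any type whatsoever gives one of this form, since an irreducible \<open>kG\<close>-module
  is a quotient of \<open>kG\<close>.\<close>

definition has_faithful_irreducible_representation ::
  "('k, 'm) ring_scheme \<Rightarrow> ('g, 'n) monoid_scheme \<Rightarrow> bool" where
  "has_faithful_irreducible_representation k G \<longleftrightarrow>
     (\<exists>(V :: ('k, 'g \<Rightarrow> 'k) module) \<rho>.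
        irreducible_representation k G V \<rho> \<and> faithful_representation k G V \<rho>)"


subsection \<open>Independence of the type of vectors\<close>

context group_representation
begin

lemma act_closed: "g \<in> carrier G \<Longrightarrow> v \<in> carrier V \<Longrightarrow> \<rho> g v \<in> carrier V"
  using element_image by blast

lemma act_mult: "\<lbrakk>g \<in> carrier G; h \<in> carrier G; v \<in> carrier V\<rbrakk>
    \<Longrightarrow> \<rho> (g \<otimes>\<^bsub>G\<^esub> h) v = \<rho> g (\<rho> h v)"
  using composition_rule by blast

lemma act_one: "v \<in> carrier V \<Longrightarrow> \<rho> \<one>\<^bsub>G\<^esub> v = v"
  using id_eq_one by (metis restrict_apply')

lemma group_G: "group G"
  using group_hom group_hom.axioms(1) by blast

lemma act_finsum:
  assumes "finite A" "f \<in> A \<rightarrow> carrier V" "h \<in> carrier G"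
  shows "\<rho> h (finsum V f A) = finsum V (\<lambda>a. \<rho> h (f a)) A"
  using assms(1,2)
proof (induction A)
  case empty
  have "\<rho> h \<zero>\<^bsub>V\<^esub> \<oplus>\<^bsub>V\<^esub> \<rho> h \<zero>\<^bsub>V\<^esub> = \<rho> h \<zero>\<^bsub>V\<^esub>"
    using act_add[OF assms(3), of "\<zero>\<^bsub>V\<^esub>" "\<zero>\<^bsub>V\<^esub>"] by simp
  then have "\<rho> h \<zero>\<^bsub>V\<^esub> = \<zero>\<^bsub>V\<^esub>"
    using act_closed[OF assms(3), of "\<zero>\<^bsub>V\<^esub>"] by (metis M.add.l_cancel_one M.zero_closed)
  then show ?case by simp
next
  case (insert x F)
  then have f: "f \<in> F \<rightarrow> carrier V" "f x \<in> carrier V" by auto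
  have f': "(\<lambda>a. \<rho> h (f a)) \<in> F \<rightarrow> carrier V"
    using f(1) act_closed[OF assms(3)] by auto
  have "\<rho> h (finsum V f (insert x F)) = \<rho> h (f x \<oplus>\<^bsub>V\<^esub> finsum V f F)"
    using insert f by (simp add: M.finsum_insert)
  also have "\<dots> = \<rho> h (f x) \<oplus>\<^bsub>V\<^esub> finsum V (\<lambda>a. \<rho> h (f a)) F"
    using act_add[OF assms(3) f(2) M.finsum_closed[OF f(1)]] insert.IH[OF f(1)] by simp
  also have "\<dots> = finsum V (\<lambda>a. \<rho> h (f a)) (insert x F)"
    using insert f' f(2) act_closed[OF assms(3)] by (simp add: M.finsum_insert)
  finally show ?case .
qed

definition comb :: "'v \<Rightarrow> ('g \<Rightarrow> 'k) \<Rightarrow> 'v" where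
  "comb v f = finsum V (\<lambda>g. f g \<odot>\<^bsub>V\<^esub> \<rho> g v) {g \<in> carrier G. f g \<noteq> \<zero>\<^bsub>k\<^esub>}"

definition coeffs :: "('g \<Rightarrow> 'k) set" where
  "coeffs = {f. range f \<subseteq> carrier k \<and> finite {g \<in> carrier G. f g \<noteq> \<zero>\<^bsub>k\<^esub>}}"

lemma comb_eq:
  assumes "v \<in> carrier V" "range f \<subseteq> carrier k" "finite A" "A \<subseteq> carrier G"
    "{g \<in> carrier G. f g \<noteq> \<zero>\<^bsub>k\<^esub>} \<subseteq> A"
  shows "comb v f = finsum V (\<lambda>g. f g \<odot>\<^bsub>V\<^esub> \<rho> g v) A"
  unfolding comb_def
proof (rule M.add.finprod_mono_neutral_cong_left)
  show "finite A" by fact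
  show "{g \<in> carrier G. f g \<noteq> \<zero>\<^bsub>k\<^esub>} \<subseteq> A" by fact
  show "f i \<odot>\<^bsub>V\<^esub> \<rho> i v = \<zero>\<^bsub>V\<^esub>" if "i \<in> A - {g \<in> carrier G. f g \<noteq> \<zero>\<^bsub>k\<^esub>}" for i
  proof -
    have "i \<in> carrier G" "f i = \<zero>\<^bsub>k\<^esub>" using that assms by auto
    then show ?thesis using act_closed assms(1) by simp
  qed
  show "(\<lambda>g. f g \<odot>\<^bsub>V\<^esub> \<rho> g v) \<in> A \<rightarrow> carrier V"
    using assms act_closed by (auto intro!: smult_closed)
qed simp

lemma comb_subrep:
  assumes v: "v \<in> carrier V"
  shows "subrepresentation (comb v ` coeffs) k G V \<rho>"
proof -
  have clos: "(\<lambda>g. f g \<odot>\<^bsub>V\<^esub> \<rho> g v) \<in> A \<rightarrow> carrier V"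
    if "range f \<subseteq> carrier k" "A \<subseteq> carrier G" for f A
    using that v act_closed by (auto intro!: smult_closed)
  have sm: "c \<odot>\<^bsub>V\<^esub> comb v f \<in> comb v ` coeffs" if c: "c \<in> carrier k" and f: "f \<in> coeffs" for c f
  proof -
    let ?A = "{g \<in> carrier G. f g \<noteq> \<zero>\<^bsub>k\<^esub>}"
    let ?f = "\<lambda>g. c \<otimes>\<^bsub>k\<^esub> f g"
    have f1: "range f \<subseteq> carrier k" and f2: "finite ?A" using f by (auto simp: coeffs_def)
    have fk: "f g \<in> carrier k" for g using f1 by auto
    have g1: "range ?f \<subseteq> carrier k" using f1 c by auto
    have g2: "{g \<in> carrier G. ?f g \<noteq> \<zero>\<^bsub>k\<^esub>} \<subseteq> ?A" using c by auto
    have "comb v ?f = finsum V (\<lambda>g. ?f g \<odot>\<^bsub>V\<^esub> \<rho> g v) ?A"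
      by (rule comb_eq[OF v g1 f2 _ g2]) auto
    also have "\<dots> = finsum V (\<lambda>g. c \<odot>\<^bsub>V\<^esub> (f g \<odot>\<^bsub>V\<^esub> \<rho> g v)) ?A"
      by (rule M.finsum_cong') (use fk c v act_closed in \<open>auto intro!: smult_closed smult_assoc1\<close>)
    also have "\<dots> = c \<odot>\<^bsub>V\<^esub> comb v f"
      unfolding comb_def by (rule finsum_smult_ldistr[symmetric, OF f2 c clos[OF f1]]) auto
    finally have "c \<odot>\<^bsub>V\<^esub> comb v f = comb v ?f" by simp
    moreover have "?f \<in> coeffs"
      unfolding coeffs_def using g1 finite_subset[OF g2 f2] by simp
    ultimately show ?thesis by blast
  qed
  have cc: "comb v f \<in> carrier V" if "f \<in> coeffs" for f
    unfolding comb_def using that by (intro M.finsum_closed clos) (auto simp: coeffs_def)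
  have "submodule (comb v ` coeffs) k V"
  proof (rule submoduleI)
    show "comb v ` coeffs \<subseteq> carrier V" using cc by auto
    have "(\<lambda>_. \<zero>\<^bsub>k\<^esub>) \<in> coeffs" by (auto simp: coeffs_def)
    moreover have "comb v (\<lambda>_. \<zero>\<^bsub>k\<^esub>) = \<zero>\<^bsub>V\<^esub>" by (simp add: comb_def)
    ultimately show "\<zero>\<^bsub>V\<^esub> \<in> comb v ` coeffs" by (metis imageI)
    show "\<ominus>\<^bsub>V\<^esub> a \<in> comb v ` coeffs" if a: "a \<in> comb v ` coeffs" for a
    proof -
      have "a \<in> carrier V" using a cc by auto
      then have "\<ominus>\<^bsub>V\<^esub> a = (\<ominus>\<^bsub>k\<^esub> \<one>\<^bsub>k\<^esub>) \<odot>\<^bsub>V\<^esub> a"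
        by (simp add: smult_l_minus)
      then show ?thesis using a sm by auto
    qed
    show "a \<oplus>\<^bsub>V\<^esub> b \<in> comb v ` coeffs"
      if ab: "a \<in> comb v ` coeffs" "b \<in> comb v ` coeffs" for a b
    proof -
      obtain f h where f: "f \<in> coeffs" "a = comb v f" and h: "h \<in> coeffs" "b = comb v h"
        using ab by blast
      let ?A = "{g \<in> carrier G. f g \<noteq> \<zero>\<^bsub>k\<^esub>} \<union> {g \<in> carrier G. h g \<noteq> \<zero>\<^bsub>k\<^esub>}"
      let ?s = "\<lambda>g. f g \<oplus>\<^bsub>k\<^esub> h g"
      have f1: "range f \<subseteq> carrier k" and h1: "range h \<subseteq> carrier k" and A: "finite ?A"
        using f h by (auto simp: coeffs_def)
      have s1: "range ?s \<subseteq> carrier k" using f1 h1 by auto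
      have s2: "{g \<in> carrier G. ?s g \<noteq> \<zero>\<^bsub>k\<^esub>} \<subseteq> ?A" by auto
      have "comb v ?s = finsum V (\<lambda>g. ?s g \<odot>\<^bsub>V\<^esub> \<rho> g v) ?A"
        by (rule comb_eq[OF v s1 A _ s2]) auto
      also have "\<dots> = finsum V (\<lambda>g. f g \<odot>\<^bsub>V\<^esub> \<rho> g v \<oplus>\<^bsub>V\<^esub> h g \<odot>\<^bsub>V\<^esub> \<rho> g v) ?A"
      proof (rule M.finsum_cong')
        show "(\<lambda>g. f g \<odot>\<^bsub>V\<^esub> \<rho> g v \<oplus>\<^bsub>V\<^esub> h g \<odot>\<^bsub>V\<^esub> \<rho> g v) \<in> ?A \<rightarrow> carrier V"
          using f1 h1 v act_closed by (auto intro!: M.a_closed smult_closed)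
        show "?s g \<odot>\<^bsub>V\<^esub> \<rho> g v = f g \<odot>\<^bsub>V\<^esub> \<rho> g v \<oplus>\<^bsub>V\<^esub> h g \<odot>\<^bsub>V\<^esub> \<rho> g v" if "g \<in> ?A" for g
          using f1 h1 v act_closed that by (intro smult_l_distr) auto
      qed simp
      also have "\<dots> = finsum V (\<lambda>g. f g \<odot>\<^bsub>V\<^esub> \<rho> g v) ?A \<oplus>\<^bsub>V\<^esub> finsum V (\<lambda>g. h g \<odot>\<^bsub>V\<^esub> \<rho> g v) ?A"
        by (intro M.finsum_addf clos f1 h1) auto
      also have "\<dots> = a \<oplus>\<^bsub>V\<^esub> b"
        unfolding f(2) h(2)
        by (intro arg_cong2[where f = "add V"]; rule comb_eq[symmetric]) (use v f1 h1 A in auto)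
      finally have "a \<oplus>\<^bsub>V\<^esub> b = comb v ?s" by simp
      moreover have "?s \<in> coeffs"
        unfolding coeffs_def using s1 finite_subset[OF s2 A] by simp
      ultimately show ?thesis by blast
    qed
    show "a \<odot>\<^bsub>V\<^esub> x \<in> comb v ` coeffs" if "a \<in> carrier k" "x \<in> comb v ` coeffs" for a x
      using that sm by blast
  qed
  moreover have "\<rho> h (comb v f) \<in> comb v ` coeffs" if h: "h \<in> carrier G" and f: "f \<in> coeffs" for h f
  proof -
    interpret G: group G by (rule group_G)
    let ?A = "{g \<in> carrier G. f g \<noteq> \<zero>\<^bsub>k\<^esub>}"
    let ?f = "\<lambda>g. f (inv\<^bsub>G\<^esub> h \<otimes>\<^bsub>G\<^esub> g)"
    let ?m = "\<lambda>g. h \<otimes>\<^bsub>G\<^esub> g"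
    have f1: "range f \<subseteq> carrier k" and A: "finite ?A" using f by (auto simp: coeffs_def)
    have g1: "range ?f \<subseteq> carrier k" using f1 by auto
    have canc: "inv\<^bsub>G\<^esub> h \<otimes>\<^bsub>G\<^esub> (h \<otimes>\<^bsub>G\<^esub> g) = g" if "g \<in> carrier G" for g
      using h that by (simp add: G.m_assoc[symmetric])
    have canc': "h \<otimes>\<^bsub>G\<^esub> (inv\<^bsub>G\<^esub> h \<otimes>\<^bsub>G\<^esub> g) = g" if "g \<in> carrier G" for g
      using h that by (simp add: G.m_assoc[symmetric])
    have g2: "{g \<in> carrier G. ?f g \<noteq> \<zero>\<^bsub>k\<^esub>} \<subseteq> ?m ` ?A"
    proof
      fix g assume g: "g \<in> {g \<in> carrier G. ?f g \<noteq> \<zero>\<^bsub>k\<^esub>}"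
      then have "inv\<^bsub>G\<^esub> h \<otimes>\<^bsub>G\<^esub> g \<in> ?A" using h by auto
      moreover have "g = ?m (inv\<^bsub>G\<^esub> h \<otimes>\<^bsub>G\<^esub> g)" using canc' g by simp
      ultimately show "g \<in> ?m ` ?A" by blast
    qed
    have inj: "inj_on ?m ?A" using h by (auto intro!: inj_onI)
    have "\<rho> h (comb v f) = finsum V (\<lambda>g. \<rho> h (f g \<odot>\<^bsub>V\<^esub> \<rho> g v)) ?A"
      unfolding comb_def by (rule act_finsum[OF A clos[OF f1] h]) auto
    also have "\<dots> = finsum V (\<lambda>g. ?f (?m g) \<odot>\<^bsub>V\<^esub> \<rho> (?m g) v) ?A"
    proof (rule M.finsum_cong')
      show "(\<lambda>g. ?f (?m g) \<odot>\<^bsub>V\<^esub> \<rho> (?m g) v) \<in> ?A \<rightarrow> carrier V"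
        using f1 v act_closed h by (auto intro!: smult_closed)
      show "\<rho> h (f g \<odot>\<^bsub>V\<^esub> \<rho> g v) = ?f (?m g) \<odot>\<^bsub>V\<^esub> \<rho> (?m g) v" if "g \<in> ?A" for g
      proof -
        have g: "g \<in> carrier G" and fg: "f g \<in> carrier k" using that f1 by auto
        show ?thesis
          using act_smult[OF h fg act_closed[OF g v]] act_mult[OF h g v] canc[OF g] by simp
      qed
    qed simp
    also have "\<dots> = finsum V (\<lambda>g. ?f g \<odot>\<^bsub>V\<^esub> \<rho> g v) (?m ` ?A)"
      by (rule M.finsum_reindex[symmetric, OF clos[OF g1] inj]) (use h in auto)
    also have "\<dots> = comb v ?f"
      by (rule comb_eq[symmetric, OF v g1 _ _ g2]) (use A h in auto)
    finally have "\<rho> h (comb v f) = comb v ?f" .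
    moreover have "?f \<in> coeffs"
      unfolding coeffs_def using g1 finite_subset[OF g2 finite_imageI[OF A]] by simp
    ultimately show ?thesis by blast
  qed
  ultimately show ?thesis unfolding subrepresentation_def by blast
qed

lemma mem_comb:
  assumes v: "v \<in> carrier V"
  shows "v \<in> comb v ` coeffs"
proof -
  interpret G: group G by (rule group_G)
  let ?f = "\<lambda>g. if g = \<one>\<^bsub>G\<^esub> then \<one>\<^bsub>k\<^esub> else \<zero>\<^bsub>k\<^esub>"
  have sub: "{g \<in> carrier G. ?f g \<noteq> \<zero>\<^bsub>k\<^esub>} \<subseteq> {\<one>\<^bsub>G\<^esub>}" by auto
  have "comb v ?f = finsum V (\<lambda>g. ?f g \<odot>\<^bsub>V\<^esub> \<rho> g v) {\<one>\<^bsub>G\<^esub>}"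
    by (rule comb_eq[OF v _ _ _ sub]) auto
  also have "\<dots> = v" using v act_one by simp
  finally have "v = comb v ?f" by simp
  moreover have "?f \<in> coeffs"
    unfolding coeffs_def using finite_subset[OF sub] by auto
  ultimately show ?thesis by blast
qed

end

lemma transport_representation:
  fixes V :: "('k, 'v, 'l) module_scheme" and e :: "'v \<Rightarrow> 'w"
  assumes irr: "irreducible_representation k G V \<rho>" and faithful: "faithful_representation k G V \<rho>"
    and inj: "inj_on e (carrier V)"
  shows "\<exists>(V' :: ('k, 'w) module) \<rho>'.
    irreducible_representation k G V' \<rho>' \<and> faithful_representation k G V' \<rho>'"
proof -
  interpret group_representation k G V \<rho>
    using irr by (simp add: irreducible_representation_def)
  interpret G: group G by (rule group_G)
  define d where "d = inv_into (carrier V) e"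
  have de [simp]: "d (e x) = x" if "x \<in> carrier V" for x
    unfolding d_def using inj that by simp
  define V' :: "('k, 'w) module" where
    "V' = \<lparr>carrier = e ` carrier V, monoid.mult = undefined, one = undefined,
           zero = e \<zero>\<^bsub>V\<^esub>, add = (\<lambda>x y. e (d x \<oplus>\<^bsub>V\<^esub> d y)), smult = (\<lambda>c x. e (c \<odot>\<^bsub>V\<^esub> d x))\<rparr>"
  define \<rho>' where "\<rho>' g = (\<lambda>x \<in> e ` carrier V. e (\<rho> g (d x)))" for g
  have sel [simp]: "carrier V' = e ` carrier V" "\<zero>\<^bsub>V'\<^esub> = e \<zero>\<^bsub>V\<^esub>"
    "x \<oplus>\<^bsub>V'\<^esub> y = e (d x \<oplus>\<^bsub>V\<^esub> d y)" "c \<odot>\<^bsub>V'\<^esub> x = e (c \<odot>\<^bsub>V\<^esub> d x)" for x y c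
    by (simp_all add: V'_def)
  have rho [simp]: "\<rho>' g (e x) = e (\<rho> g x)" if "x \<in> carrier V" for g x
    using that by (simp add: \<rho>'_def)
  have grp: "abelian_group V'"
  proof (rule abelian_groupI)
    show "\<exists>y \<in> carrier V'. y \<oplus>\<^bsub>V'\<^esub> x = \<zero>\<^bsub>V'\<^esub>" if x: "x \<in> carrier V'" for x
    proof -
      obtain a where a: "a \<in> carrier V" "x = e a" using x by auto
      have "e (\<ominus>\<^bsub>V\<^esub> a) \<in> carrier V'" using a by simp
      moreover have "e (\<ominus>\<^bsub>V\<^esub> a) \<oplus>\<^bsub>V'\<^esub> x = \<zero>\<^bsub>V'\<^esub>" using a by (simp add: M.l_neg)
      ultimately show ?thesis by blast
    qed
  qed (auto simp: M.a_assoc intro!: M.a_comm arg_cong[where f = e])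
  have mod: "module k V'"
    by (rule moduleI[OF cring_axioms grp])
       (auto simp: smult_l_distr smult_r_distr smult_assoc1)
  have act: "group_action G (carrier V') \<rho>'"
  proof -
    have bij: "\<rho>' g \<in> Bij (carrier V')" if g: "g \<in> carrier G" for g
    proof -
      have "bij_betw (\<rho>' g) (e ` carrier V) (e ` carrier V)"
        unfolding bij_betw_def
      proof
        show "inj_on (\<rho>' g) (e ` carrier V)"
        proof (rule inj_onI)
          fix x y assume "x \<in> e ` carrier V" "y \<in> e ` carrier V" and eq: "\<rho>' g x = \<rho>' g y"
          then obtain a b where ab: "a \<in> carrier V" "b \<in> carrier V" "x = e a" "y = e b" by auto
          then have "e (\<rho> g a) = e (\<rho> g b)" using eq by simp
          then have "\<rho> g a = \<rho> g b"
            using inj ab act_closed[OF g] by (meson inj_onD)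
          then show "x = y" using inj_prop[OF g] ab by (metis inj_onD)
        qed
        have "\<rho>' g ` e ` carrier V = e ` \<rho> g ` carrier V"
          by (simp add: image_image cong: image_cong_simp)
        then show "\<rho>' g ` e ` carrier V = e ` carrier V" using surj_prop[OF g] by simp
      qed
      then show ?thesis by (simp add: Bij_def \<rho>'_def)
    qed
    have "group_hom G (BijGroup (carrier V')) \<rho>'"
    proof (rule group_hom.intro[OF group_G group_BijGroup], unfold group_hom_axioms_def, rule homI)
      show "\<rho>' g \<in> carrier (BijGroup (carrier V'))" if "g \<in> carrier G" for g
        using bij[OF that] by (simp add: BijGroup_def)
      show "\<rho>' (g \<otimes>\<^bsub>G\<^esub> h) = \<rho>' g \<otimes>\<^bsub>BijGroup (carrier V')\<^esub> \<rho>' h"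
        if g: "g \<in> carrier G" and h: "h \<in> carrier G" for g h
      proof -
        have "\<rho>' (g \<otimes>\<^bsub>G\<^esub> h) = compose (carrier V') (\<rho>' g) (\<rho>' h)"
          unfolding compose_def
        proof
          fix x
          show "\<rho>' (g \<otimes>\<^bsub>G\<^esub> h) x = (\<lambda>x \<in> carrier V'. \<rho>' g (\<rho>' h x)) x"
          proof (cases "x \<in> e ` carrier V")
            case True
            then show ?thesis using act_closed[OF h] act_mult[OF g h] by auto
          next
            case False
            then show ?thesis by (simp add: \<rho>'_def)
          qed
        qed
        then show ?thesis using bij[OF g] bij[OF h] by (simp add: BijGroup_def)
      qed
    qed
    then show ?thesis by (rule group_action.intro)
  qed
  have rep: "group_representation k G V' \<rho>'"
    unfolding group_representation_def group_representation_axioms_def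
    using field_axioms mod act by (auto simp: act_closed act_add act_smult)
  have "\<forall>W'. subrepresentation W' k G V' \<rho>' \<longrightarrow> W' = {\<zero>\<^bsub>V'\<^esub>} \<or> W' = carrier V'"
  proof (intro allI impI)
    fix W' assume W': "subrepresentation W' k G V' \<rho>'"
    interpret V': module k V' by (rule mod)
    have sm: "submodule W' k V'" and st: "\<And>g w. g \<in> carrier G \<Longrightarrow> w \<in> W' \<Longrightarrow> \<rho>' g w \<in> W'"
      using W' by (auto simp: subrepresentation_def)
    note E = V'.submoduleE[OF sm]
    define W where "W = {x \<in> carrier V. e x \<in> W'}"
    have W'eq: "W' = e ` W" unfolding W_def using E(1) by auto
    have sc: "c \<odot>\<^bsub>V\<^esub> x \<in> W" if "c \<in> carrier k" "x \<in> W" for c x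
      using E(4)[of c "e x"] that by (auto simp: W_def)
    have ad: "x \<oplus>\<^bsub>V\<^esub> y \<in> W" if "x \<in> W" "y \<in> W" for x y
      using E(5)[of "e x" "e y"] that by (auto simp: W_def)
    have neg: "\<ominus>\<^bsub>V\<^esub> x \<in> W" if "x \<in> W" for x
    proof -
      have x: "x \<in> carrier V" using that by (simp add: W_def)
      have "(\<ominus>\<^bsub>k\<^esub> \<one>\<^bsub>k\<^esub>) \<odot>\<^bsub>V\<^esub> x \<in> W" by (rule sc[OF _ that]) simp
      then show ?thesis using x by (simp add: smult_l_minus)
    qed
    have "W \<noteq> {}" using E(2) W'eq by blast
    then obtain w where w: "w \<in> W" by blast
    have z: "\<zero>\<^bsub>V\<^esub> \<in> W" using sc[OF _ w, of "\<zero>\<^bsub>k\<^esub>"] w by (simp add: W_def)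
    have "submodule W k V"
      by (rule submoduleI) (use sc ad neg z in \<open>auto simp: W_def\<close>)
    moreover have "\<forall>g \<in> carrier G. \<forall>w \<in> W. \<rho> g w \<in> W"
    proof (intro ballI)
      fix g x assume g: "g \<in> carrier G" and x: "x \<in> W"
      have xV: "x \<in> carrier V" "e x \<in> W'" using x by (auto simp: W_def)
      show "\<rho> g x \<in> W" using st[OF g xV(2)] xV act_closed[OF g] by (simp add: W_def)
    qed
    ultimately have "subrepresentation W k G V \<rho>" by (simp add: subrepresentation_def)
    then have "W = {\<zero>\<^bsub>V\<^esub>} \<or> W = carrier V"
      using irr by (simp add: irreducible_representation_def)
    then show "W' = {\<zero>\<^bsub>V'\<^esub>} \<or> W' = carrier V'" using W'eq by auto
  qed
  moreover have "carrier V' \<noteq> {\<zero>\<^bsub>V'\<^esub>}"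
  proof
    assume "carrier V' = {\<zero>\<^bsub>V'\<^esub>}"
    then have "e ` carrier V = e ` {\<zero>\<^bsub>V\<^esub>}" by simp
    then have "carrier V = {\<zero>\<^bsub>V\<^esub>}"
      using inj inj_on_image_eq_iff[OF inj, of "carrier V" "{\<zero>\<^bsub>V\<^esub>}"] by simp
    then show False using irr by (simp add: irreducible_representation_def)
  qed
  ultimately have "irreducible_representation k G V' \<rho>'"
    using rep by (simp add: irreducible_representation_def)
  moreover have "faithful_representation k G V' \<rho>'"
    unfolding faithful_representation_def
  proof (intro conjI ballI impI rep)
    fix g assume g: "g \<in> carrier G" and tr: "\<forall>v \<in> carrier V'. \<rho>' g v = v"
    have "\<rho> g v = v" if v: "v \<in> carrier V" for v
    proof -
      have "e (\<rho> g v) = e v" using tr v by auto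
      then show ?thesis using inj v act_closed[OF g v] by (meson inj_onD)
    qed
    then show "g = \<one>\<^bsub>G\<^esub>" using faithful g by (simp add: faithful_representation_def)
  qed
  ultimately show ?thesis by blast
qed

theorem has_faithful_irreducible_representationI:
  fixes k :: "('k, 'm) ring_scheme" and G :: "('g, 'n) monoid_scheme"
    and V :: "('k, 'v, 'l) module_scheme"
  assumes irr: "irreducible_representation k G V \<rho>" and faithful: "faithful_representation k G V \<rho>"
  shows "has_faithful_irreducible_representation k G"
proof -
  interpret group_representation k G V \<rho>
    using irr by (simp add: irreducible_representation_def)
  obtain v where v: "v \<in> carrier V" "v \<noteq> \<zero>\<^bsub>V\<^esub>"
    using irr M.zero_closed unfolding irreducible_representation_def by blast
  have "comb v ` coeffs \<noteq> {\<zero>\<^bsub>V\<^esub>}" using mem_comb[OF v(1)] v(2) by blast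
  then have "comb v ` coeffs = carrier V"
    using irr comb_subrep[OF v(1)] unfolding irreducible_representation_def by blast
  then have "inj_on (inv_into coeffs (comb v)) (carrier V)"
    by (intro inj_on_inv_into) simp
  from transport_representation[OF irr faithful this] show ?thesis
    unfolding has_faithful_irreducible_representation_def .
qed

end

theory Submission
  imports Defs "HOL-Algebra.Multiplicative_Group" "HOL-Algebra.SndIsomorphismGrp"
    "HOL-Number_Theory.Cong"
begin

text \<open>
For an abelian normal subgroup \<open>A\<close> of a torsion soluble group \<open>G\<close>, both directions go through
irreducible \<open>kA\<close>-modules. By Zorn's lemma every nonzero vector of a representation has nonzero
image in some irreducible subquotient (\<open>ex_irreducible_subquotient\<close>); this takes the place of an
irreducible submodule, which need not exist in infinite dimension. Write \<open>E\<^sub>x = 1 + x + \<dots> + x\<^sup>n\<^sup>-\<^sup>1\<close> for \<open>x\<close> with \<open>x\<^sup>n = 1\<close>: it kills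
\<open>(x - 1)V\<close>, its values are fixed by \<open>x\<close>, and on a vector fixed by \<open>x\<close> it is multiplication
by \<open>n\<close>.

Let \<open>V\<close> be faithful and irreducible over \<open>kG\<close>. In characteristic \<open>p\<close>, a normal elementary abelian
\<open>p\<close>-subgroup must act trivially: \<open>G\<close> is locally finite, so this reduces to a finite \<open>p\<close>-group
acting in characteristic \<open>p\<close>, which has a nonzero fixed vector
(\<open>characteristic_not_torsion_prime\<close>). Hence the order of every element of \<open>A\<close> is invertible in
\<open>k\<close>. Take \<open>v \<noteq> 0\<close>, an irreducible \<open>kA\<close>-subquotient \<open>X\<close> of \<open>V\<close> in which \<open>v\<close> survives, and the kernel
\<open>C\<close> of \<open>A\<close> on \<open>X\<close>. Since \<open>A\<close> acts on \<open>X\<close> through the multiplicative group of a field, \<open>A/C\<close> is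
locally cyclic (\<open>irreducible_abelian_cyclic_prime_layers\<close>). If the core \<open>N\<close> of \<open>C\<close> were nontrivial,
the vectors killed by a product of operators \<open>E\<^sub>x\<close> with \<open>x \<in> N\<close> would form a nonzero submodule of
\<open>V\<close>, which then contains \<open>v\<close>; but \<open>N\<close> fixes the image of \<open>v\<close> in \<open>X\<close>, so there such a product is
multiplication by a nonzero scalar (\<open>normal_subgroup_fixing_projection_trivial\<close>).

Conversely, let \<open>A\<close> be maximal and let \<open>C\<close> have trivial core, with \<open>A/C\<close> locally cyclic. For each
prime \<open>q\<close> dividing the order of an element of \<open>A/C\<close> choose \<open>b\<^sub>q\<close> of order \<open>q\<close> modulo \<open>C\<close>. The
infinite product of the factors \<open>1 - b\<^sub>q\<close> makes sense as a function on \<open>A/C\<close>; it is a function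
\<open>\<phi> \<noteq> 0\<close> on \<open>G\<close> that \<open>C\<close> fixes and every \<open>E\<close> belonging to a \<open>b\<^sub>q\<close> kills
(\<open>alternating_sum_over_prime_coset\<close>). Let \<open>X\<close> be an irreducible subquotient, over \<open>kG\<close>, of the
functions \<open>G \<rightarrow> k\<close> in which \<open>\<phi>\<close> survives, and \<open>N\<close> the kernel of \<open>G\<close> on \<open>X\<close>. An element of
\<open>A \<inter> N\<close> outside \<open>C\<close> would have a power that generates the order \<open>q\<close> subgroup of \<open>A/C\<close> for some
\<open>q\<close>; then \<open>b\<^sub>q\<close> fixes the image of \<open>\<phi>\<close>, and \<open>E\<close> acts on it as \<open>q \<noteq> 0\<close> and as \<open>0\<close>. So
\<open>A \<inter> N \<subseteq> C\<close>, hence \<open>A \<inter> N = 1\<close> as the core is trivial, and then \<open>N = 1\<close> because \<open>A\<close> is maximal and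
\<open>G\<close> soluble (\<open>normal_meets_maximal_abelian_normal\<close>).

For abelian \<open>G\<close> the only choice is \<open>A = G\<close>, every subgroup is its own core, and \<open>C = 1\<close>.
\<close>

section \<open>Locally cyclic torsion groups\<close>

text \<open>For an abelian torsion group \<open>A\<close> this says that \<open>A/C\<close> has at most one subgroup of each prime order,
which is equivalent to \<open>A/C\<close> being locally cyclic. It is phrased with elements of \<open>A\<close>, which act on
modules, instead of cosets.\<close>

definition cyclic_prime_layers :: "('g, 'n) monoid_scheme \<Rightarrow> 'g set \<Rightarrow> 'g set \<Rightarrow> bool" where
  "cyclic_prime_layers G A C \<longleftrightarrow>
     (\<forall>q::nat. Factorial_Ring.prime q \<longrightarrow>
        (\<forall>a \<in> A. \<forall>b \<in> A. a \<notin> C \<and> a [^]\<^bsub>G\<^esub> q \<in> C \<and> b [^]\<^bsub>G\<^esub> q \<in> C \<longrightarrow>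
           (\<exists>i::nat. b \<otimes>\<^bsub>G\<^esub> inv\<^bsub>G\<^esub> (a [^]\<^bsub>G\<^esub> i) \<in> C)))"

context group
begin

lemma subgroup_nat_pow_closed:
  "subgroup H G \<Longrightarrow> h \<in> H \<Longrightarrow> h [^] (n::nat) \<in> H"
  by (metis int_pow_int subgroup_int_pow_closed)

lemma conj_pow:
  assumes "g \<in> carrier G" "x \<in> carrier G"
  shows "(g \<otimes> x \<otimes> inv g) [^] (n::nat) = g \<otimes> x [^] n \<otimes> inv g"
proof (induction n)
  case (Suc n)
  have "inv g \<otimes> (g \<otimes> z) = z" if "z \<in> carrier G" for z
    using assms(1) that by (simp add: m_assoc[symmetric])
  then show ?case using Suc assms by (simp add: m_assoc)
qed (use assms in simp)

lemma mem_of_coprime_powers: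
  assumes H: "subgroup H G" and w: "w \<in> carrier G"
    and mn: "w [^] (m::nat) \<in> H" "w [^] (n::nat) \<in> H" "coprime m n"
  shows "w \<in> H"
proof -
  obtain u v where uv: "u * int m + v * int n = 1"
    using bezout_int[of "int m" "int n"] mn(3) by (auto simp: coprime_iff_gcd_eq_1)
  have "w = w [^] (u * int m + v * int n)" using w uv by simp
  also have "\<dots> = (w [^] m) [^] u \<otimes> (w [^] n) [^] v"
    using w by (simp add: int_pow_mult int_pow_pow mult.commute flip: int_pow_int)
  also have "\<dots> \<in> H"
    by (intro subgroup.m_closed[OF H] subgroup_int_pow_closed[OF H] mn)
  finally show ?thesis .
qed

text \<open>The least positive exponent \<open>k\<close> with \<open>w\<^sup>k \<in> H\<close> exceeds 1; dropping one prime factor of \<open>k\<close> gives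
the exponent \<open>m\<close>.\<close>

lemma ex_power_of_prime_order_mod:
  assumes H: "subgroup H G" and w: "w \<in> carrier G" "w \<notin> H"
    and n: "0 < n" "w [^] (n::nat) \<in> H"
  obtains q m where "Factorial_Ring.prime (q::nat)" "w [^] (m::nat) \<notin> H" "(w [^] m) [^] q \<in> H"
proof -
  define k where "k = (LEAST k. 0 < k \<and> w [^] (k::nat) \<in> H)"
  have k: "0 < k" "w [^] k \<in> H"
    unfolding k_def using LeastI[of "\<lambda>k. 0 < k \<and> w [^] (k::nat) \<in> H", OF conjI, OF n] by auto
  have least: "w [^] j \<notin> H" if "0 < j" "j < k" for j
    using not_less_Least[of j "\<lambda>k. 0 < k \<and> w [^] (k::nat) \<in> H"] that unfolding k_def by auto
  have "k \<noteq> 1" using k(2) w by auto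
  then obtain q where q: "Factorial_Ring.prime q" "q dvd k" using prime_factor_nat by blast
  then obtain m where m: "k = m * q" by (metis dvd_div_mult_self)
  have "0 < m" "m < k" using m k(1) q(1) prime_gt_1_nat[OF q(1)] by auto
  then have "w [^] m \<notin> H" using least by blast
  moreover have "(w [^] m) [^] q \<in> H" using m k(2) w by (simp add: nat_pow_pow)
  ultimately show ?thesis using that[OF q(1)] by blast
qed

end

lemma torsion_group_subset:
  assumes "torsion_group G" "A \<subseteq> carrier G"
  shows "torsion_group (G\<lparr>carrier := A\<rparr>)"
  using assms by (auto simp: torsion_group_def nat_pow_def)

lemma (in group) torsion_imp_finite_order:
  assumes "torsion_group G" "x \<in> carrier G" shows "0 < ord x"
  using assms ord_eq_0[of x] by (auto simp: torsion_group_def)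

lemma (in group) torsion_generate_singleton:
  assumes "torsion_group G" "x \<in> carrier G"
  shows "generate G {x} = range (\<lambda>n::nat. x [^] n)"
  using generate_pow_nat[of x] torsion_imp_finite_order[OF assms] assms(2) by (auto simp: image_def)

context comm_group
begin

lemma cyclic_prime_layersD:
  assumes "cyclic_prime_layers G (carrier G) {\<one>}" "Factorial_Ring.prime (q::nat)"
    "a \<in> carrier G" "b \<in> carrier G" "a [^] q = \<one>" "b [^] q = \<one>" "a \<noteq> \<one>"
  shows "\<exists>i::nat. b = a [^] i"
proof -
  obtain i :: nat where "b \<otimes> inv (a [^] i) = \<one>"
    using assms unfolding cyclic_prime_layers_def by blast
  then have "b = a [^] i" using assms(3,4) by (metis inv_equality inv_inv inv_closed nat_pow_closed)
  then show ?thesis ..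
qed

text \<open>Among the cyclic groups \<open>\<langle>z\<rangle>\<close> containing \<open>x\<close>, take one that contains a power \<open>y\<^sup>k\<close> with \<open>k > 0\<close>
least. If \<open>k\<close> had a prime factor \<open>q\<close>, then \<open>w = y\<^sup>k\<^sup>/\<^sup>q\<close> would satisfy \<open>w\<^sup>q \<in> \<langle>z\<rangle>\<close>, and it is enough to
find a cyclic group containing \<open>z\<close> and \<open>w\<close>.\<close>

lemma two_elements_in_cyclic:
  assumes tor: "torsion_group G" and lay: "cyclic_prime_layers G (carrier G) {\<one>}"
    and x: "x \<in> carrier G" and y: "y \<in> carrier G"
  shows "\<exists>z \<in> carrier G. x \<in> generate G {z} \<and> y \<in> generate G {z}"
proof -
  define P where "P z k \<longleftrightarrow> z \<in> carrier G \<and> x \<in> generate G {z} \<and> 0 < k \<and> y [^] k \<in> generate G {z}"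
    for z and k :: nat
  have "P x (ord y)"
    unfolding P_def using x y torsion_imp_finite_order[OF tor y] generate.incl[of x "{x}"]
      generate.one[of G "{x}"] by simp
  then obtain k where k: "\<exists>z. P z k" and least: "\<And>j. j < k \<Longrightarrow> \<not> (\<exists>z. P z j)"
    using exists_least_iff[of "\<lambda>k. \<exists>z. P z k"] by blast
  then obtain z where z: "z \<in> carrier G" "x \<in> generate G {z}" "0 < k" "y [^] k \<in> generate G {z}"
    unfolding P_def by blast
  let ?Z = "generate G {z}"
  have subZ: "subgroup (generate G {t}) G" if "t \<in> carrier G" for t
    using generate_is_subgroup[of "{t}"] that by simp
  have zZ: "z \<in> ?Z" by (simp add: generate.incl)
  have "k = 1"
  proof (rule ccontr)
    assume "k \<noteq> 1"
    then obtain q where q: "Factorial_Ring.prime q" "q dvd k" using prime_factor_nat by blast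
    then obtain l where l: "k = l * q" by (metis dvd_div_mult_self)
    have l0: "0 < l" "l < k" using l z(3) prime_gt_1_nat[OF q(1)] by auto
    define w where "w = y [^] l"
    have w: "w \<in> carrier G" using y by (simp add: w_def)
    have wq: "w [^] q \<in> ?Z" using z(4) l y by (simp add: w_def nat_pow_pow)
    have no: "\<not> (t \<in> carrier G \<and> z \<in> generate G {t} \<and> w \<in> generate G {t})" for t
    proof
      assume t: "t \<in> carrier G \<and> z \<in> generate G {t} \<and> w \<in> generate G {t}"
      then have "?Z \<subseteq> generate G {t}" using generate_subgroup_incl[of "{z}"] subZ by simp
      then have "P t l" using t l0(1) z(2) by (auto simp: P_def w_def)
      then show False using least[OF l0(2)] by blast
    qed
    have w_notin: "w \<notin> ?Z" using no[of z] z(1) zZ by blast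
    obtain m :: nat where m: "w [^] q = z [^] m"
      using wq torsion_generate_singleton[OF tor z(1)] by auto
    show False
    \<comment> \<open>Write \<open>w\<^sup>q = z\<^sup>m\<close>. If \<open>q\<close> does not divide \<open>m\<close>, a Bezout combination of \<open>w\<close> and \<open>z\<close> is a
      \<open>q\<close>-th root of \<open>z\<close> and generates both.\<close>
    proof (cases "q dvd m")
      case False
      then have "coprime m q" using q(1) by (metis coprime_commute prime_imp_coprime)
      then obtain u v where uv: "u * int m + v * int q = 1"
        using bezout_int[of "int m" "int q"] by (auto simp: coprime_iff_gcd_eq_1)
      define t where "t = w [^] u \<otimes> z [^] v"
      have t: "t \<in> carrier G" using w z(1) by (simp add: t_def)
      have "t [^] q = (w [^] q) [^] u \<otimes> (z [^] q) [^] v"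
        using w z(1) by (simp add: t_def int_pow_distrib int_pow_pow mult.commute flip: int_pow_int)
      also have "\<dots> = z [^] (u * int m + v * int q)"
        using m z(1) by (simp add: int_pow_mult int_pow_pow mult.commute flip: int_pow_int)
      finally have tq: "t [^] q = z" using uv z(1) by simp
      have tT: "t \<in> generate G {t}" by (simp add: generate.incl)
      have zT: "z \<in> generate G {t}"
        using subgroup_nat_pow_closed[OF subZ[OF t] tT, of "q"] tq by simp
      have wT: "w [^] q \<in> generate G {t}"
        using subgroup_nat_pow_closed[OF subZ[OF t] zT, of "m"] m by simp
      have "w [^] u = t \<otimes> inv (z [^] v)" using w z(1) t by (simp add: t_def m_assoc)
      then have wuT: "w [^] u \<in> generate G {t}"
        using subgroup.m_closed[OF subZ[OF t] tT]
          subgroup.m_inv_closed[OF subZ[OF t] subgroup_int_pow_closed[OF subZ[OF t] zT]] by simp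
      have "w = w [^] (u * int m + v * int q)" using uv w by simp
      also have "\<dots> = (w [^] u) [^] int m \<otimes> (w [^] q) [^] v"
        using w by (simp add: int_pow_mult int_pow_pow mult.commute flip: int_pow_int)
      also have "\<dots> \<in> generate G {t}"
        by (intro subgroup.m_closed[OF subZ[OF t]] subgroup_int_pow_closed[OF subZ[OF t]] wuT wT)
      finally show False using no t zT by blast
    next
      case True
      \<comment> \<open>Otherwise \<open>w\<close> may be changed by a power of \<open>z\<close> into an element \<open>s\<close> of order \<open>q\<close>. It lies in
        \<open>\<langle>z\<rangle>\<close> if \<open>q\<close> divides the order of \<open>z\<close>; if not, the orders are coprime and \<open>z s\<close> generates
        both.\<close>
      then obtain m' where m': "m = m' * q" by (metis dvd_div_mult_self)
      define s where "s = w \<otimes> inv (z [^] m')"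
      have s: "s \<in> carrier G" using w z(1) by (simp add: s_def)
      have ws: "w = s \<otimes> z [^] m'" using w z(1) by (simp add: s_def m_assoc)
      have sq: "s [^] q = \<one>"
      proof -
        have "s [^] q = w [^] q \<otimes> inv (z [^] m)"
          using w z(1) by (simp add: s_def nat_pow_distrib nat_pow_inv m' flip: nat_pow_pow)
        then show ?thesis using m z(1) by simp
      qed
      have sZ: "s \<notin> ?Z"
      proof
        assume "s \<in> ?Z"
        moreover have "z [^] m' \<in> ?Z"
          using subgroup_nat_pow_closed[OF subZ[OF z(1)] zZ, of "m'"] by simp
        ultimately show False using w_notin ws subgroup.m_closed[OF subZ[OF z(1)]] by metis
      qed
      let ?n = "ord z"
      have n: "0 < ?n" using torsion_imp_finite_order[OF tor z(1)] .
      show False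
      proof (cases "q dvd ?n")
        case True
        then obtain n' where n': "?n = n' * q" by (metis dvd_div_mult_self)
        have "0 < n'" "n' < ?n" using n n' prime_gt_1_nat[OF q(1)] by auto
        then have "z [^] n' \<noteq> \<one>" using pow_eq_id[OF z(1)] by (meson nat_dvd_not_less)
        moreover have "(z [^] n') [^] q = \<one>" using z(1) n' by (simp add: nat_pow_pow flip: n')
        ultimately obtain i :: nat where "s = (z [^] n') [^] i"
          using cyclic_prime_layersD[OF lay q(1) _ s _ sq, of "z [^] n'"] z(1) by auto
        then have "s \<in> ?Z"
          using torsion_generate_singleton[OF tor z(1)] z(1) by (auto simp: nat_pow_pow)
        then show False using sZ by blast
      next
        case False
        define t where "t = z \<otimes> s"
        have t: "t \<in> carrier G" using z(1) s by (simp add: t_def)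
        have T: "subgroup (generate G {t}) G" by (rule subZ[OF t])
        have tT: "t \<in> generate G {t}" by (simp add: generate.incl)
        have tq: "t [^] q = z [^] q" using z(1) s sq by (simp add: t_def nat_pow_distrib)
        have "z [^] q \<in> generate G {t}"
          using subgroup_nat_pow_closed[OF T tT, of "q"] tq by simp
        moreover have "z [^] ?n \<in> generate G {t}" using z(1) generate.one by simp
        moreover have "coprime q ?n" using False q(1) by (simp add: prime_imp_coprime)
        ultimately have zT: "z \<in> generate G {t}" by (rule mem_of_coprime_powers[OF T z(1)])
        have "s = inv z \<otimes> t" using z(1) s by (simp add: t_def m_assoc[symmetric])
        then have "s \<in> generate G {t}"
          using subgroup.m_closed[OF T subgroup.m_inv_closed[OF T zT] tT] by simp
        moreover have "z [^] m' \<in> generate G {t}"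
          using subgroup_nat_pow_closed[OF T zT, of "m'"] by simp
        ultimately have "w \<in> generate G {t}" using ws subgroup.m_closed[OF T] by metis
        then show False using no t zT by blast
      qed
    qed
  qed
  then show ?thesis using z y by auto
qed

lemma finite_subset_in_cyclic:
  assumes tor: "torsion_group G" and lay: "cyclic_prime_layers G (carrier G) {\<one>}"
    and "finite S" "S \<subseteq> carrier G"
  shows "\<exists>z \<in> carrier G. S \<subseteq> generate G {z}"
  using assms(3,4)
proof (induction S)
  case (insert x S)
  then obtain y where y: "y \<in> carrier G" "S \<subseteq> generate G {y}" by auto
  obtain z where z: "z \<in> carrier G" "x \<in> generate G {z}" "y \<in> generate G {z}"
    using two_elements_in_cyclic[OF tor lay, of x y] insert.prems y(1) by auto
  have "generate G {y} \<subseteq> generate G {z}"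
    using generate_subgroup_incl[of "{y}"] generate_is_subgroup[of "{z}"] z by simp
  then show ?case using y z by blast
qed auto

text \<open>In a cyclic group \<open>\<langle>z\<rangle>\<close> of finite order \<open>n\<close> divisible by \<open>q\<close>, the elements with \<open>q\<close>-th power 1 are the
powers of \<open>z\<^sup>n\<^sup>/\<^sup>q\<close>, which gives one direction. Conversely every finite subset lies in a cyclic
group, and subgroups of a cyclic group are cyclic.\<close>

lemma locally_cyclic_iff_layers:
  assumes tor: "torsion_group G"
  shows "locally_cyclic G \<longleftrightarrow> cyclic_prime_layers G (carrier G) {\<one>}"
proof
  assume lc: "locally_cyclic G"
  show "cyclic_prime_layers G (carrier G) {\<one>}"
    unfolding cyclic_prime_layers_def
  proof (intro allI ballI impI, elim conjE)
    fix q :: nat and a b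
    assume q: "Factorial_Ring.prime q" and a: "a \<in> carrier G" and b: "b \<in> carrier G"
      and a1: "a \<notin> {\<one>}" and aq: "a [^] q \<in> {\<one>}" and bq: "b [^] q \<in> {\<one>}"
    let ?K = "subgroup_generated G {a, b}"
    have "cyclic_group ?K" using lc a b by (simp add: locally_cyclic_def)
    then obtain z where z: "z \<in> carrier ?K" "carrier ?K = range (\<lambda>n::int. z [^]\<^bsub>?K\<^esub> n)"
      using group.cyclic_group[OF group_subgroup_generated] by blast
    have zG: "z \<in> carrier G" using z(1) carrier_subgroup_generated_subset by blast
    have "range (\<lambda>n::int. z [^]\<^bsub>?K\<^esub> n) = generate G {z}"
      using z(1) zG by (auto simp: generate_pow int_pow_subgroup_generated)
    then have K: "carrier ?K = range (\<lambda>n::nat. z [^] n)"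
      using z(2) torsion_generate_singleton[OF tor zG] by simp
    have "{a, b} \<subseteq> carrier ?K"
      using a b by (simp add: carrier_subgroup_generated generate.incl)
    then obtain i j :: nat where i: "a = z [^] i" and j: "b = z [^] j" using K by auto
    let ?n = "ord z"
    have n: "0 < ?n" using torsion_imp_finite_order[OF tor zG] .
    \<comment> \<open>The exponents \<open>i\<close> and \<open>j\<close> are multiples of \<open>n' = n / q\<close>, the first by a factor prime to \<open>q\<close>.\<close>
    have d: "?n dvd i * q" "?n dvd j * q" "\<not> ?n dvd i"
      using aq bq a1 i j zG pow_eq_id[OF zG] by (simp_all add: nat_pow_pow)
    have qn: "q dvd ?n"
    proof (rule ccontr)
      assume "\<not> q dvd ?n"
      then have "coprime ?n q" using q by (metis coprime_commute prime_imp_coprime)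
      then show False using d(1,3) by (simp add: coprime_dvd_mult_left_iff)
    qed
    then obtain n' where n': "?n = n' * q" by (metis dvd_div_mult_self)
    have q0: "0 < q" using q by (simp add: prime_gt_0_nat)
    obtain i' j' where i': "i = n' * i'" and j': "j = n' * j'"
      using d(1,2) n' q0 by (auto simp: dvd_def)
    have "coprime i' q"
    proof (rule ccontr)
      assume "\<not> coprime i' q"
      then have "q dvd i'" using q by (metis coprime_commute prime_imp_coprime)
      then show False using d(3) i' n' by auto
    qed
    then obtain l where l: "[i' * l = Suc 0] (mod q)" using cong_solve_coprime_nat by blast
    have "[i' * (l * j') = j'] (mod q)" using cong_scalar_right[OF l, of j'] by (simp add: mult.assoc)
    then have "[n' * (i' * (l * j')) = n' * j'] (mod (n' * q))"
      unfolding cong_def by (simp add: mult_mod_right[symmetric])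
    then have cg: "[i * (l * j') = j] (mod ?n)" using i' j' n' by (simp add: mult.assoc)
    have "z [^] (i * (l * j')) = z [^] j"
      using cg zG by (metis cong_def pow_eq_id mod_mult_div_eq nat_pow_mult nat_pow_pow nat_pow_one nat_pow_closed pow_ord_eq_1 r_one)
    then have "b = a [^] (l * j')" using i j zG by (simp add: nat_pow_pow)
    then have "b \<otimes> inv (a [^] (l * j')) \<in> {\<one>}" using b by simp
    then show "\<exists>i::nat. b \<otimes> inv (a [^] i) \<in> {\<one>}" ..
  qed
next
  assume lay: "cyclic_prime_layers G (carrier G) {\<one>}"
  show "locally_cyclic G"
    unfolding locally_cyclic_def
  proof (intro allI impI, elim conjE)
    fix S assume S: "finite S" "S \<subseteq> carrier G"
    then obtain z where z: "z \<in> carrier G" "S \<subseteq> generate G {z}"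
      using finite_subset_in_cyclic[OF tor lay] by blast
    let ?H = "generate G S"
    have H: "subgroup ?H G" by (rule generate_is_subgroup[OF S(2)])
    have HZ: "?H \<subseteq> generate G {z}"
      using generate_subgroup_incl[OF z(2)] generate_is_subgroup[of "{z}"] z(1) by simp
    define k where "k = (LEAST k. 0 < k \<and> z [^] (k::nat) \<in> ?H)"
    have ex: "0 < ord z \<and> z [^] ord z \<in> ?H"
      using z(1) torsion_imp_finite_order[OF tor z(1)] generate.one by simp
    have k: "0 < k" "z [^] k \<in> ?H"
      unfolding k_def using LeastI[of "\<lambda>k. 0 < k \<and> z [^] (k::nat) \<in> ?H", OF ex] by auto
    have least: "z [^] j \<notin> ?H" if "0 < j" "j < k" for j
      using not_less_Least[of j "\<lambda>k. 0 < k \<and> z [^] (k::nat) \<in> ?H"] that unfolding k_def by auto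
    let ?c = "z [^] k"
    have c: "?c \<in> carrier G" using z(1) by simp
    have "?H \<subseteq> generate G {?c}"
    proof
      fix h assume h: "h \<in> ?H"
      then obtain n :: nat where n: "h = z [^] n"
        using HZ torsion_generate_singleton[OF tor z(1)] by auto
      have "z [^] n = ?c [^] (n div k) \<otimes> z [^] (n mod k)"
        using z(1) by (simp add: nat_pow_pow nat_pow_mult)
      moreover have "?c [^] (n div k) \<in> ?H"
        using subgroup_nat_pow_closed[OF H k(2), of "n div k"] by simp
      ultimately have "z [^] (n mod k) \<in> ?H"
        using H h n z(1)
        by (metis inv_solve_left nat_pow_closed subgroup.m_closed subgroup.m_inv_closed)
      then have "n mod k = 0" using least[of "n mod k"] k(1) by fastforce
      then have "h = ?c [^] (n div k)" using n z(1) by (auto simp: nat_pow_pow)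
      then show "h \<in> generate G {?c}" using torsion_generate_singleton[OF tor c] by auto
    qed
    moreover have "generate G {?c} \<subseteq> ?H" using generate_subgroup_incl[OF _ H, of "{?c}"] k(2) by simp
    ultimately have "carrier (subgroup_generated G S) = carrier (subgroup_generated G {?c})"
      using S(2) c by (simp add: carrier_subgroup_generated Int_absorb1)
    then have "subgroup_generated G S = subgroup_generated G {?c}"
      by (simp add: subgroup_generated_def)
    then show "cyclic_group (subgroup_generated G S)" using cyclic_group_generated by simp
  qed
qed

end

text \<open>Applies the criterion above to the group \<open>A/C\<close>, which is again abelian and torsion.\<close>

lemma (in group) locally_cyclic_quotient_iff_layers:
  assumes tor: "torsion_group G" and A: "subgroup A G" and comm: "comm_group (G\<lparr>carrier := A\<rparr>)"
    and C: "subgroup C (G\<lparr>carrier := A\<rparr>)"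
  shows "locally_cyclic ((G\<lparr>carrier := A\<rparr>) Mod C) \<longleftrightarrow> cyclic_prime_layers G A C"
proof -
  let ?A = "G\<lparr>carrier := A\<rparr>"
  interpret A: comm_group ?A by (rule comm)
  interpret C: normal C ?A using A.subgroup_imp_normal[OF C] .
  interpret Q: comm_group "?A Mod C" by (rule A.abelian_FactGroup[OF C])
  have AG: "A \<subseteq> carrier G" using A subgroup.subset by blast
  have pow: "x [^]\<^bsub>?A\<^esub> n = x [^] n" for x and n :: nat by (simp add: nat_pow_def)
  have in_C: "C #>\<^bsub>?A\<^esub> x = C \<longleftrightarrow> x \<in> C" if "x \<in> A" for x
    using that C.rcos_const[OF A.is_group, of x] A.rcos_self[of x C] C.is_subgroup by auto
  have carrQ: "carrier (?A Mod C) = (\<lambda>x. C #>\<^bsub>?A\<^esub> x) ` A" by (simp add: carrier_FactGroup)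
  have powQ: "(C #>\<^bsub>?A\<^esub> x) [^]\<^bsub>?A Mod C\<^esub> n = C #>\<^bsub>?A\<^esub> (x [^] n)" if "x \<in> A" for x and n :: nat
    using C.FactGroup_pow[of x n] that pow by simp
  have powA: "x [^] (n::nat) \<in> A" if "x \<in> A" for x n using A.nat_pow_closed[of x n] that pow by simp
  have torQ: "torsion_group (?A Mod C)"
    unfolding torsion_group_def
  proof
    fix X assume "X \<in> carrier (?A Mod C)"
    then obtain x where x: "x \<in> A" "X = C #>\<^bsub>?A\<^esub> x" using carrQ by auto
    then obtain n :: nat where n: "0 < n" "x [^] n = \<one>"
      using tor AG by (auto simp: torsion_group_def)
    have "X [^]\<^bsub>?A Mod C\<^esub> n = C" using x n powQ in_C[of \<one>] C.one_closed A.one_closed by simp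
    then show "\<exists>n::nat. 0 < n \<and> X [^]\<^bsub>?A Mod C\<^esub> n = \<one>\<^bsub>?A Mod C\<^esub>" using n(1) by auto
  qed
  have key: "(C #>\<^bsub>?A\<^esub> b) \<otimes>\<^bsub>?A Mod C\<^esub> inv\<^bsub>?A Mod C\<^esub> (C #>\<^bsub>?A\<^esub> a [^] i)
      = C #>\<^bsub>?A\<^esub> (b \<otimes> inv (a [^] i))" if "a \<in> A" "b \<in> A" for a b and i :: nat
  proof -
    have ai: "a [^] i \<in> carrier ?A" "b \<in> carrier ?A" using that powA by auto
    have "inv\<^bsub>?A Mod C\<^esub> (C #>\<^bsub>?A\<^esub> (a [^] i)) = C #>\<^bsub>?A\<^esub> inv\<^bsub>?A\<^esub> (a [^] i)"
      using C.inv_FactGroup[of "C #>\<^bsub>?A\<^esub> (a [^] i)"] C.rcos_inv[OF ai(1)] ai carrQ by simp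
    then have "(C #>\<^bsub>?A\<^esub> b) \<otimes>\<^bsub>?A Mod C\<^esub> inv\<^bsub>?A Mod C\<^esub> (C #>\<^bsub>?A\<^esub> a [^] i)
      = C #>\<^bsub>?A\<^esub> (b \<otimes> inv\<^bsub>?A\<^esub> (a [^] i))"
      using C.rcos_sum[OF ai(2), of "inv\<^bsub>?A\<^esub> (a [^] i)"] A.inv_closed[OF ai(1)] by simp
    then show ?thesis using m_inv_consistent[OF A] ai by simp
  qed
  have closed: "b \<otimes> inv (a [^] i) \<in> A" if "a \<in> A" "b \<in> A" for a b and i :: nat
    using that A powA by (simp add: subgroup.m_closed subgroup.m_inv_closed)
  have "cyclic_prime_layers (?A Mod C) (carrier (?A Mod C)) {\<one>\<^bsub>?A Mod C\<^esub>} \<longleftrightarrow>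
      (\<forall>q::nat. Factorial_Ring.prime q \<longrightarrow> (\<forall>a \<in> A. \<forall>b \<in> A. C #>\<^bsub>?A\<^esub> a \<noteq> C \<and>
        (C #>\<^bsub>?A\<^esub> a) [^]\<^bsub>?A Mod C\<^esub> q = C \<and> (C #>\<^bsub>?A\<^esub> b) [^]\<^bsub>?A Mod C\<^esub> q = C \<longrightarrow>
        (\<exists>i::nat. (C #>\<^bsub>?A\<^esub> b) \<otimes>\<^bsub>?A Mod C\<^esub> inv\<^bsub>?A Mod C\<^esub> ((C #>\<^bsub>?A\<^esub> a) [^]\<^bsub>?A Mod C\<^esub> i) = C)))"
    unfolding cyclic_prime_layers_def carrQ one_FactGroup singleton_iff by (simp only: ball_simps)
  also have "\<dots> \<longleftrightarrow> cyclic_prime_layers G A C"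
    unfolding cyclic_prime_layers_def
    by (intro all_cong1 imp_cong ball_cong refl) (simp_all only: powQ key in_C closed powA)
  finally show ?thesis using Q.locally_cyclic_iff_layers[OF torQ] by simp
qed

section \<open>Torsion soluble groups\<close>

definition locally_finite_on :: "('g, 'n) monoid_scheme \<Rightarrow> 'g set \<Rightarrow> bool" where
  "locally_finite_on G K \<longleftrightarrow> (\<forall>S \<subseteq> K. finite S \<longrightarrow> finite (generate G S))"

context group
begin

text \<open>In a torsion group inverses are positive powers, so generating a subgroup only takes repeated
multiplication on the right.\<close>

lemma generate_subset_of_right_closed:
  assumes tor: "torsion_group G" and S: "S \<subseteq> carrier G" and Y: "Y \<subseteq> carrier G" "\<one> \<in> Y"
    and cl: "\<And>y s. y \<in> Y \<Longrightarrow> s \<in> S \<Longrightarrow> y \<otimes> s \<in> Y"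
  shows "generate G S \<subseteq> Y"
proof -
  have "y \<otimes> h \<in> Y" if "h \<in> generate G S" "y \<in> Y" for h y
    using that
  proof (induction arbitrary: y)
    case one
    then show ?case using Y by auto
  next
    case (incl h)
    then show ?case using cl by blast
  next
    case (inv h)
    then have h: "h \<in> carrier G" using S by auto
    have pow: "y \<otimes> h [^] (k::nat) \<in> Y" for k
    proof (induction k)
      case 0
      then show ?case using inv.prems Y by auto
    next
      case (Suc k)
      have "y \<otimes> h [^] Suc k = (y \<otimes> h [^] k) \<otimes> h"
        using inv.prems h Y by (simp add: m_assoc subsetD)
      then show ?case using cl[OF Suc inv.hyps] by simp
    qed
    have "h \<otimes> h [^] (ord h - 1) = \<one>"
      using h torsion_imp_finite_order[OF tor h] by (metis Suc_pred' nat_pow_Suc2 pow_ord_eq_1)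
    then have "inv h = h [^] (ord h - 1)" using h by (metis inv_equality inv_comm nat_pow_closed)
    then show ?case using pow by simp
  next
    case (eng h1 h2)
    have "h1 \<in> carrier G" "h2 \<in> carrier G" "y \<in> carrier G"
      using eng.hyps eng.prems generate_incl[OF S] Y by auto
    then have "y \<otimes> (h1 \<otimes> h2) = (y \<otimes> h1) \<otimes> h2" by (simp add: m_assoc)
    then show ?case using eng by simp
  qed
  then show ?thesis using Y generate_incl[OF S] by (metis l_one subsetD subsetI)
qed

lemma conj_by_pow_closed:
  assumes "s \<in> carrier G" "K \<subseteq> carrier G" "\<And>k. k \<in> K \<Longrightarrow> s \<otimes> k \<otimes> inv s \<in> K" "k \<in> K"
  shows "s [^] (i::nat) \<otimes> k \<otimes> inv (s [^] i) \<in> K"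
proof (induction i)
  case 0
  then show ?case using assms by (simp add: subsetD)
next
  case (Suc i)
  have "s [^] Suc i \<otimes> k \<otimes> inv (s [^] Suc i) = s \<otimes> (s [^] i \<otimes> k \<otimes> inv (s [^] i)) \<otimes> inv s"
    using assms unfolding nat_pow_Suc2[OF assms(1)] by (simp add: m_assoc inv_mult_group subsetD)
  then show ?case using assms(3)[OF Suc] by simp
qed

text \<open>Given finitely many \<open>k\<^sub>x s\<^sup>e\<close>, the finitely many conjugates of the \<open>k\<^sub>x\<close> by powers of \<open>s\<close> generate a
finite group \<open>F\<close>, and the finite set of products \<open>f s\<^sup>i\<close> with \<open>f \<in> F\<close> is closed under multiplication
by the given elements.\<close>

lemma locally_finite_on_cyclic_extension:
  assumes tor: "torsion_group G" and K: "subgroup K G" and lf: "locally_finite_on G K"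
    and s: "s \<in> carrier G" and nrm: "\<And>k. k \<in> K \<Longrightarrow> s \<otimes> k \<otimes> inv s \<in> K"
  shows "locally_finite_on G {k \<otimes> s [^] (j::nat) | k j. k \<in> K}" (is "locally_finite_on G ?L")
  unfolding locally_finite_on_def
proof (intro allI impI)
  fix S assume S: "S \<subseteq> ?L" "finite S"
  have KG: "K \<subseteq> carrier G" using K subgroup.subset by blast
  note conj = conj_by_pow_closed[OF s KG nrm]
  have "\<forall>x \<in> S. \<exists>k j. k \<in> K \<and> x = k \<otimes> s [^] (j::nat)" using S(1) by blast
  then obtain c e where ce: "\<And>x. x \<in> S \<Longrightarrow> c x \<in> K \<and> x = c x \<otimes> s [^] (e x :: nat)" by metis
  let ?n = "ord s"
  have n: "0 < ?n" by (rule torsion_imp_finite_order[OF tor s])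
  define X where "X = (\<Union>x \<in> S. (\<lambda>i. s [^] i \<otimes> c x \<otimes> inv (s [^] i)) ` {..<?n})"
  have X: "X \<subseteq> K" "finite X" using conj ce S(2) by (auto simp: X_def)
  let ?F = "generate G X"
  have F: "subgroup ?F G" "finite ?F"
    using generate_is_subgroup[of X] X KG lf unfolding locally_finite_on_def by auto
  define Y where "Y = (\<lambda>(f, i). f \<otimes> s [^] i) ` (?F \<times> {..<?n})"
  have FG: "?F \<subseteq> carrier G" using F(1) subgroup.subset by blast
  have "finite Y" using F(2) by (simp add: Y_def)
  moreover have "generate G S \<subseteq> Y"
  proof (rule generate_subset_of_right_closed[OF tor])
    show "S \<subseteq> carrier G" using S(1) KG s by auto
    show "Y \<subseteq> carrier G" using FG s by (auto simp: Y_def)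
    have "\<one> = \<one> \<otimes> s [^] (0::nat)" by simp
    then show "\<one> \<in> Y" unfolding Y_def using n generate.one[of G X] by force
    show "y \<otimes> x \<in> Y" if y: "y \<in> Y" and x: "x \<in> S" for y x
    proof -
      obtain f i where fi: "f \<in> ?F" "i < ?n" "y = f \<otimes> s [^] i" using y by (auto simp: Y_def)
      let ?d = "s [^] i \<otimes> c x \<otimes> inv (s [^] i)"
      have d: "?d \<in> ?F" using x fi(2) by (auto simp: X_def intro: generate.incl)
      have cG: "c x \<in> carrier G" using ce[OF x] KG by auto
      have fG: "f \<in> carrier G" using fi FG by auto
      have "y \<otimes> x = f \<otimes> s [^] i \<otimes> (c x \<otimes> s [^] e x)" using fi(3) ce[OF x] by simp
      also have "\<dots> = f \<otimes> ?d \<otimes> (s [^] i \<otimes> s [^] e x)"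
        using fG cG s by (simp add: m_assoc inv_solve_left)
      also have "s [^] i \<otimes> s [^] e x = s [^] ((i + e x) mod ?n)"
      proof -
        have "s [^] (i + e x) = s [^] (?n * ((i + e x) div ?n)) \<otimes> s [^] ((i + e x) mod ?n)"
          using s by (simp add: nat_pow_mult)
        then show ?thesis using s by (simp add: nat_pow_mult flip: nat_pow_pow)
      qed
      finally show ?thesis
        unfolding Y_def using subgroup.m_closed[OF F(1) fi(1) d] n by force
    qed
  qed
  ultimately show "finite (generate G S)" by (rule rev_finite_subset)
qed

lemma cyclic_extension_subgroup:
  assumes tor: "torsion_group G" and K: "subgroup K G"
    and s: "s \<in> carrier G" and nrm: "\<And>k. k \<in> K \<Longrightarrow> s \<otimes> k \<otimes> inv s \<in> K"
  shows "generate G (insert s K) \<subseteq> {k \<otimes> s [^] (j::nat) | k j. k \<in> K}" (is "_ \<subseteq> ?L")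
proof (rule generate_subset_of_right_closed[OF tor])
  have KG: "K \<subseteq> carrier G" using K subgroup.subset by blast
  show "insert s K \<subseteq> carrier G" using KG s by auto
  show "?L \<subseteq> carrier G" using KG s by auto
  have "\<one> = \<one> \<otimes> s [^] (0::nat)" by simp
  then show "\<one> \<in> ?L" using subgroup.one_closed[OF K] by blast
  fix y x assume "y \<in> ?L" and x: "x \<in> insert s K"
  then obtain k and j :: nat where kj: "k \<in> K" "y = k \<otimes> s [^] j" by auto
  have kG: "k \<in> carrier G" using kj KG by auto
  show "y \<otimes> x \<in> ?L"
  proof (cases "x = s")
    case True
    then have "y \<otimes> x = k \<otimes> s [^] Suc j" using kj kG s by (simp add: m_assoc)
    then show ?thesis using kj(1) by blast
  next
    case False
    then have xK: "x \<in> K" "x \<in> carrier G" using x KG by auto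
    have conj: "s [^] j \<otimes> x \<otimes> inv (s [^] j) \<in> K" by (rule conj_by_pow_closed[OF s KG nrm xK(1)])
    have "y \<otimes> x = (k \<otimes> (s [^] j \<otimes> x \<otimes> inv (s [^] j))) \<otimes> s [^] j"
      using kj kG s xK(2) by (simp add: m_assoc)
    then show ?thesis using subgroup.m_closed[OF K kj(1) conj] by blast
  qed
qed

lemma locally_finite_on_mono: "locally_finite_on G L \<Longrightarrow> K \<subseteq> L \<Longrightarrow> locally_finite_on G K"
  by (auto simp: locally_finite_on_def)

text \<open>Any subgroup between \<open>D'\<close> and \<open>D\<close> is normalised by \<open>D\<close>, so the elements of a finite subset of \<open>D\<close> can
be adjoined to \<open>D'\<close> one after the other as cyclic extensions.\<close>

lemma locally_finite_on_of_derived: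
  assumes tor: "torsion_group G" and D: "subgroup D G" and lf: "locally_finite_on G (derived G D)"
  shows "locally_finite_on G D"
proof -
  have DG: "D \<subseteq> carrier G" using D subgroup.subset by blast
  have ext: "\<exists>K. subgroup K G \<and> derived G D \<subseteq> K \<and> K \<subseteq> D \<and> S \<subseteq> K \<and> locally_finite_on G K"
    if "finite S" "S \<subseteq> D" for S
    using that
  proof (induction S)
    case empty
    then show ?case
      using derived_is_subgroup[OF DG] derived_incl[OF subset_refl D] lf by blast
  next
    case (insert s S)
    then obtain K where K: "subgroup K G" "derived G D \<subseteq> K" "K \<subseteq> D" "S \<subseteq> K" "locally_finite_on G K"
      by auto
    have s: "s \<in> D" "s \<in> carrier G" using insert.prems DG by auto
    have nrm: "s \<otimes> k \<otimes> inv s \<in> K" if k: "k \<in> K" for k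
    proof -
      have "s \<otimes> k \<otimes> inv s \<otimes> inv k \<in> derived G D"
        unfolding derived_def using s(1) k K(3) by (intro generate.incl) blast
      then have "s \<otimes> k \<otimes> inv s \<otimes> inv k \<otimes> k \<in> K"
        using subgroup.m_closed[OF K(1) _ k] K(2) by blast
      then show ?thesis using s k K(3) DG by (simp add: m_assoc subset_iff)
    qed
    let ?K = "generate G (insert s K)"
    have KG: "K \<subseteq> carrier G" using K(3) DG by blast
    have "subgroup ?K G" by (rule generate_is_subgroup) (use s KG in auto)
    moreover have "insert s K \<subseteq> ?K" by (auto intro: generate.incl)
    moreover have "?K \<subseteq> D" by (rule generate_subgroup_incl[OF _ D]) (use s K(3) in auto)
    moreover have "locally_finite_on G ?K"
      by (rule locally_finite_on_mono[OF locally_finite_on_cyclic_extension[OF tor K(1,5) s(2) nrm]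
            cyclic_extension_subgroup[OF tor K(1) s(2) nrm]])
    ultimately show ?case using K(2,4) by blast
  qed
  show ?thesis
    unfolding locally_finite_on_def
  proof (intro allI impI)
    fix S assume S: "S \<subseteq> D" "finite S"
    obtain K where "S \<subseteq> K" "locally_finite_on G K" using ext[OF S(2,1)] by blast
    then show "finite (generate G S)" using S(2) by (simp add: locally_finite_on_def)
  qed
qed

theorem torsion_solvable_imp_locally_finite:
  assumes tor: "torsion_group G" and sol: "solvable G"
  shows "locally_finite_on G (carrier G)"
proof -
  obtain n where n: "(derived G ^^ n) (carrier G) = {\<one>}"
    using sol solvable_iff_trivial_derived_seq by blast
  have "locally_finite_on G ((derived G ^^ (n - i)) (carrier G))" if "i \<le> n" for i
    using that
  proof (induction i)
    case 0
    have "finite (generate G S)" if "S \<subseteq> {\<one>}" for S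
      using that generate_one generate_empty by (metis finite.simps subset_singletonD)
    then show ?case by (simp add: n locally_finite_on_def)
  next
    case (Suc i)
    then have "n - i = Suc (n - Suc i)" by simp
    then have "locally_finite_on G (derived G ((derived G ^^ (n - Suc i)) (carrier G)))"
      using Suc by simp
    then show ?case
      by (rule locally_finite_on_of_derived[OF tor exp_of_derived_is_subgroup[OF subgroup_self]])
  qed
  from this[of n] show ?thesis by simp
qed

text \<open>If \<open>N \<noteq> 1\<close>, let \<open>B\<close> be the intersection of \<open>N\<close> with the last term of the derived series that it meets
nontrivially. Then \<open>B'\<close> lies in \<open>N\<close> and in the next term, so \<open>B\<close> is abelian; and \<open>[A, B] \<subseteq> A \<inter> N\<close> is
trivial. Hence \<open>A B\<close> is abelian and normal, and maximality puts \<open>B\<close> inside \<open>A \<inter> N\<close>.\<close>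

lemma normal_meets_maximal_abelian_normal:
  assumes sol: "solvable G" and A: "maximal_abelian_normal_subgroup G A"
    and N: "N \<lhd> G" and int: "A \<inter> N \<subseteq> {\<one>}"
  shows "N = {\<one>}"
proof (rule ccontr)
  assume nontriv: "N \<noteq> {\<one>}"
  have AN: "A \<lhd> G" and Ac: "comm_group (G\<lparr>carrier := A\<rparr>)"
    and max: "\<And>B. abelian_normal_subgroup G B \<Longrightarrow> A \<subseteq> B \<Longrightarrow> B = A"
    using A unfolding maximal_abelian_normal_subgroup_def abelian_normal_subgroup_def by blast+
  let ?D = "\<lambda>i. (derived G ^^ i) (carrier G)"
  have Dn: "?D i \<lhd> G" for i
    by (induction i) (simp_all add: normal_self derived_is_normal)
  obtain n where "?D n = {\<one>}" using sol solvable_iff_trivial_derived_seq by blast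
  then have ex: "\<exists>i. N \<inter> ?D i \<subseteq> {\<one>}" by blast
  define m where "m = (LEAST i. N \<inter> ?D i \<subseteq> {\<one>})"
  have m: "N \<inter> ?D m \<subseteq> {\<one>}" unfolding m_def by (rule LeastI_ex[OF ex])
  have "m \<noteq> 0"
  proof
    assume "m = 0"
    then have "N \<subseteq> {\<one>}" using m N normal_imp_subgroup subgroup.subset by fastforce
    then show False using nontriv N subgroup.one_closed[OF normal_imp_subgroup[OF N]] by blast
  qed
  then obtain l where l: "m = Suc l" using not0_implies_Suc by blast
  define B where "B = N \<inter> ?D l"
  have B_not: "\<not> B \<subseteq> {\<one>}"
    unfolding B_def using not_less_Least[of l "\<lambda>i. N \<inter> ?D i \<subseteq> {\<one>}"] l m_def by simp
  have Bn: "B \<lhd> G" unfolding B_def by (rule normal_subgroup_intersect[OF N Dn])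
  interpret A: normal A G by (rule AN)
  interpret B: normal B G by (rule Bn)
  have commB: "b \<otimes> c = c \<otimes> b" if "b \<in> B" "c \<in> B" for b c
  proof -
    have G: "b \<in> carrier G" "c \<in> carrier G" using that B.subset by auto
    have "b \<otimes> c \<otimes> inv b \<otimes> inv c \<in> ?D m"
      unfolding l using that by (auto simp: B_def derived_def intro!: generate.incl)
    moreover have "b \<otimes> c \<otimes> inv b \<otimes> inv c \<in> B" using that by simp
    ultimately have "b \<otimes> c \<otimes> inv b \<otimes> inv c = \<one>" using m by (auto simp: B_def)
    then show ?thesis using G by (metis inv_equality inv_inv inv_mult_group m_assoc m_closed inv_closed)
  qed
  have commAB: "a \<otimes> b = b \<otimes> a" if "a \<in> A" "b \<in> B" for a b
  proof -
    have G: "a \<in> carrier G" "b \<in> carrier G" using that B.subset A.subset by auto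
    have "a \<otimes> (b \<otimes> inv a \<otimes> inv b) \<in> A"
      using that G A.inv_op_closed2[of b "inv a"] by simp
    moreover have "a \<otimes> b \<otimes> inv a \<otimes> inv b \<in> B"
      using that G B.inv_op_closed2[of a b] by simp
    ultimately have "a \<otimes> b \<otimes> inv a \<otimes> inv b \<in> A \<inter> N"
      using G by (simp add: m_assoc B_def)
    then have "a \<otimes> b \<otimes> inv a \<otimes> inv b = \<one>" using int by blast
    then show ?thesis using G by (metis inv_equality inv_inv inv_mult_group m_assoc m_closed inv_closed)
  qed
  have commA: "a \<otimes> c = c \<otimes> a" if "a \<in> A" "c \<in> A" for a c
    using comm_group.axioms(1)[OF Ac] comm_monoid.m_comm that by fastforce
  let ?P = "A <#> B"
  have P: "subgroup ?P G"
    using second_isomorphism_grp.normal_set_mult_subgroup[of A G B] AN B.is_subgroup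
    by (simp add: second_isomorphism_grp_def second_isomorphism_grp_axioms_def)
  have Pn: "?P \<lhd> G"
    unfolding normal_inv_iff
  proof (intro conjI ballI P)
    fix x h assume x: "x \<in> carrier G" and "h \<in> ?P"
    then obtain a b where ab: "a \<in> A" "b \<in> B" "h = a \<otimes> b" by (auto simp: set_mult_def)
    have "x \<otimes> h \<otimes> inv x = (x \<otimes> a \<otimes> inv x) \<otimes> (x \<otimes> b \<otimes> inv x)"
      using x ab A.subset B.subset by (simp add: m_assoc inv_solve_left subset_iff)
    then show "x \<otimes> h \<otimes> inv x \<in> ?P"
      using A.inv_op_closed2[OF x ab(1)] B.inv_op_closed2[OF x ab(2)] unfolding set_mult_def by blast
  qed
  have "comm_group (G\<lparr>carrier := ?P\<rparr>)"
  proof (rule group.group_comm_groupI[OF subgroup.subgroup_is_group[OF P is_group]])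
    fix g h assume "g \<in> carrier (G\<lparr>carrier := ?P\<rparr>)" "h \<in> carrier (G\<lparr>carrier := ?P\<rparr>)"
    then obtain a b c d where *: "a \<in> A" "b \<in> B" "g = a \<otimes> b" "c \<in> A" "d \<in> B" "h = c \<otimes> d"
      by (auto simp: set_mult_def)
    have G: "a \<in> carrier G" "b \<in> carrier G" "c \<in> carrier G" "d \<in> carrier G"
      using * A.subset B.subset by auto
    have "g \<otimes> h = a \<otimes> (c \<otimes> b) \<otimes> d" using * G commAB[of c b] by (simp add: m_assoc)
    also have "\<dots> = (c \<otimes> a) \<otimes> (d \<otimes> b)"
      using * G commA[of a c] commB[of b d] by (simp add: m_assoc[symmetric]) (simp add: m_assoc)
    also have "\<dots> = c \<otimes> (d \<otimes> a) \<otimes> b" using * G commAB[of a d] by (simp add: m_assoc[symmetric]) (simp add: m_assoc)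
    also have "\<dots> = h \<otimes> g" using * G by (simp add: m_assoc)
    finally show "g \<otimes>\<^bsub>G\<lparr>carrier := ?P\<rparr>\<^esub> h = h \<otimes>\<^bsub>G\<lparr>carrier := ?P\<rparr>\<^esub> g" by simp
  qed
  then have "abelian_normal_subgroup G ?P" using Pn by (simp add: abelian_normal_subgroup_def)
  moreover have "a \<in> ?P" if "a \<in> A" for a
  proof -
    have "a = a \<otimes> \<one>" using that A.subset by auto
    then show ?thesis using that B.one_closed unfolding set_mult_def by blast
  qed
  ultimately have PA: "?P = A" by (intro max) auto
  have "B \<subseteq> ?P"
  proof
    fix b assume "b \<in> B"
    then have "b = \<one> \<otimes> b" using B.subset by auto
    then show "b \<in> ?P" using \<open>b \<in> B\<close> A.one_closed unfolding set_mult_def by blast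
  qed
  then have "B \<subseteq> A \<inter> N" using PA by (auto simp: B_def)
  then show False using int B_not by blast
qed

lemma ex_maximal_abelian_normal_subgroup: "\<exists>A. maximal_abelian_normal_subgroup G A"
proof -
  have iff: "abelian_normal_subgroup G A \<longleftrightarrow> A \<lhd> G \<and> (\<forall>x \<in> A. \<forall>y \<in> A. x \<otimes> y = y \<otimes> x)" for A
  proof
    assume "abelian_normal_subgroup G A"
    then show "A \<lhd> G \<and> (\<forall>x \<in> A. \<forall>y \<in> A. x \<otimes> y = y \<otimes> x)"
      unfolding abelian_normal_subgroup_def comm_group_def
      using comm_monoid.m_comm[of "G\<lparr>carrier := A\<rparr>"] by simp
  next
    assume A: "A \<lhd> G \<and> (\<forall>x \<in> A. \<forall>y \<in> A. x \<otimes> y = y \<otimes> x)"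
    have "group (G\<lparr>carrier := A\<rparr>)"
      using subgroup.subgroup_is_group[OF normal_imp_subgroup is_group] A by simp
    then have "comm_group (G\<lparr>carrier := A\<rparr>)" by (rule group.group_comm_groupI) (use A in auto)
    then show "abelian_normal_subgroup G A" using A by (simp add: abelian_normal_subgroup_def)
  qed
  let ?\<A> = "{A. abelian_normal_subgroup G A}"
  have "\<exists>M \<in> ?\<A>. \<forall>X \<in> ?\<A>. M \<subseteq> X \<longrightarrow> X = M"
  proof (rule subset_Zorn_nonempty)
    show "?\<A> \<noteq> {}" using one_is_normal iff by auto
    fix \<C> assume ne: "\<C> \<noteq> {}" and ch: "subset.chain ?\<A> \<C>"
    then have mem: "\<And>A. A \<in> \<C> \<Longrightarrow> A \<lhd> G \<and> (\<forall>x \<in> A. \<forall>y \<in> A. x \<otimes> y = y \<otimes> x)"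
      using iff by (auto simp: subset.chain_def)
    have sub: "subgroup A G" if "A \<in> \<C>" for A by (rule normal_imp_subgroup[OF conjunct1[OF mem[OF that]]])
    have two: "\<exists>A \<in> \<C>. x \<in> A \<and> y \<in> A" if "x \<in> \<Union>\<C>" "y \<in> \<Union>\<C>" for x y
    proof -
      obtain X Y where XY: "X \<in> \<C>" "x \<in> X" "Y \<in> \<C>" "y \<in> Y" using \<open>x \<in> \<Union>\<C>\<close> \<open>y \<in> \<Union>\<C>\<close> by blast
      then have "X \<subseteq> Y \<or> Y \<subseteq> X" using ch by (simp add: subset_chain_def)
      then show ?thesis using XY by blast
    qed
    have "subgroup (\<Union>\<C>) G"
    proof (rule subgroupI)
      show "\<Union>\<C> \<subseteq> carrier G" using subgroup.subset[OF sub] by blast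
      show "\<Union>\<C> \<noteq> {}" using ne subgroup.one_closed[OF sub] by blast
      show "inv a \<in> \<Union>\<C>" if "a \<in> \<Union>\<C>" for a using that subgroup.m_inv_closed[OF sub] by blast
      show "a \<otimes> b \<in> \<Union>\<C>" if "a \<in> \<Union>\<C>" "b \<in> \<Union>\<C>" for a b
        using two[OF that] subgroup.m_closed[OF sub] by blast
    qed
    moreover have "x \<otimes> h \<otimes> inv x \<in> \<Union>\<C>" if "x \<in> carrier G" "h \<in> \<Union>\<C>" for x h
    proof -
      obtain A where A: "A \<in> \<C>" "h \<in> A" using \<open>h \<in> \<Union>\<C>\<close> by blast
      then have "x \<otimes> h \<otimes> inv x \<in> A" using normal.inv_op_closed2[of A G x h] mem that(1) by simp
      then show ?thesis using A(1) by blast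
    qed
    ultimately have "\<Union>\<C> \<lhd> G" by (simp add: normal_inv_iff)
    moreover have "x \<otimes> y = y \<otimes> x" if "x \<in> \<Union>\<C>" "y \<in> \<Union>\<C>" for x y
      using two[OF that] mem by blast
    ultimately show "\<Union>\<C> \<in> ?\<A>" using iff by simp
  qed
  then show ?thesis unfolding maximal_abelian_normal_subgroup_def by blast
qed

lemma mem_normal_core:
  assumes C: "C \<subseteq> carrier G" and x: "x \<in> carrier G"
  shows "x \<in> normal_core G C \<longleftrightarrow> (\<forall>g \<in> carrier G. inv g \<otimes> x \<otimes> g \<in> C)"
proof -
  have "x \<in> g <# C #> inv g \<longleftrightarrow> inv g \<otimes> x \<otimes> g \<in> C" if g: "g \<in> carrier G" for g
  proof
    assume "x \<in> g <# C #> inv g"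
    then obtain c where c: "c \<in> C" "x = g \<otimes> c \<otimes> inv g" by (auto simp: l_coset_def r_coset_def)
    have "inv g \<otimes> x \<otimes> g = c" using c C g by (simp add: m_assoc inv_solve_left' subset_iff)
    then show "inv g \<otimes> x \<otimes> g \<in> C" using c by simp
  next
    assume "inv g \<otimes> x \<otimes> g \<in> C"
    moreover have "x = g \<otimes> (inv g \<otimes> x \<otimes> g) \<otimes> inv g" using x g by (simp add: m_assoc) (simp add: m_assoc[symmetric])
    ultimately show "x \<in> g <# C #> inv g" unfolding l_coset_def r_coset_def by blast
  qed
  then show ?thesis by (simp add: normal_core_def)
qed

lemma normal_core_normal:
  assumes C: "subgroup C G"
  shows "normal_core G C \<lhd> G" "normal_core G C \<subseteq> C"
proof -
  have CG: "C \<subseteq> carrier G" using C subgroup.subset by blast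
  have "\<one> <# C #> inv \<one> = C" using CG by (simp add: lcos_mult_one)
  then show sub: "normal_core G C \<subseteq> C" unfolding normal_core_def using one_closed by blast
  have mem: "x \<in> normal_core G C \<longleftrightarrow> x \<in> carrier G \<and> (\<forall>g \<in> carrier G. inv g \<otimes> x \<otimes> g \<in> C)" for x
    using mem_normal_core[OF CG, of x] sub CG by blast
  show "normal_core G C \<lhd> G"
    unfolding normal_inv_iff
  proof (intro conjI ballI)
    show "subgroup (normal_core G C) G"
    proof (rule subgroupI)
      show "normal_core G C \<subseteq> carrier G" using mem by blast
      have "\<one> \<in> normal_core G C" using mem[of \<one>] subgroup.one_closed[OF C] by simp
      then show "normal_core G C \<noteq> {}" by blast
      fix a assume a: "a \<in> normal_core G C"
      have "inv g \<otimes> inv a \<otimes> g = inv (inv g \<otimes> a \<otimes> g)" if "g \<in> carrier G" for g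
        using a mem[of a] that by (simp add: inv_mult_group m_assoc)
      then show "inv a \<in> normal_core G C"
        using a mem[of a] mem[of "inv a"] subgroup.m_inv_closed[OF C] by simp
      fix b assume b: "b \<in> normal_core G C"
      have "inv g \<otimes> (a \<otimes> b) \<otimes> g = (inv g \<otimes> a \<otimes> g) \<otimes> (inv g \<otimes> b \<otimes> g)" if "g \<in> carrier G" for g
      proof -
        have "g \<otimes> (inv g \<otimes> z) = z" if "z \<in> carrier G" for z
          using \<open>g \<in> carrier G\<close> that by (simp add: m_assoc[symmetric])
        then show ?thesis using a b mem[of a] mem[of b] that by (simp add: m_assoc)
      qed
      then show "a \<otimes> b \<in> normal_core G C"
        using a b mem[of a] mem[of b] mem[of "a \<otimes> b"] subgroup.m_closed[OF C] by simp
    qed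
    fix x h assume x: "x \<in> carrier G" and h: "h \<in> normal_core G C"
    have "inv g \<otimes> (x \<otimes> h \<otimes> inv x) \<otimes> g = inv (inv x \<otimes> g) \<otimes> h \<otimes> (inv x \<otimes> g)" if "g \<in> carrier G" for g
      using x h mem[of h] that by (simp add: inv_mult_group m_assoc)
    then show "x \<otimes> h \<otimes> inv x \<in> normal_core G C"
      using x h mem[of h] mem[of "x \<otimes> h \<otimes> inv x"] by simp
  qed
qed

end

section \<open>Irreducible subquotients\<close>

text \<open>Reduces the action by bijections required of a representation to pointwise identities.\<close>

lemma group_representationI:
  fixes k :: "('k, 'm) ring_scheme" and G :: "('g, 'n) monoid_scheme"
    and V :: "('k, 'v, 'l) module_scheme"
  assumes "field k" "Module.module k V" "group G"
    and ext: "\<And>g. g \<in> carrier G \<Longrightarrow> \<rho> g \<in> extensional (carrier V)"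
    and closed: "\<And>g v. g \<in> carrier G \<Longrightarrow> v \<in> carrier V \<Longrightarrow> \<rho> g v \<in> carrier V"
    and mult: "\<And>g h v. g \<in> carrier G \<Longrightarrow> h \<in> carrier G \<Longrightarrow> v \<in> carrier V \<Longrightarrow>
      \<rho> (g \<otimes>\<^bsub>G\<^esub> h) v = \<rho> g (\<rho> h v)"
    and one: "\<And>v. v \<in> carrier V \<Longrightarrow> \<rho> \<one>\<^bsub>G\<^esub> v = v"
    and add: "\<And>g v w. g \<in> carrier G \<Longrightarrow> v \<in> carrier V \<Longrightarrow> w \<in> carrier V \<Longrightarrow>
      \<rho> g (v \<oplus>\<^bsub>V\<^esub> w) = \<rho> g v \<oplus>\<^bsub>V\<^esub> \<rho> g w"
    and smult: "\<And>g c v. g \<in> carrier G \<Longrightarrow> c \<in> carrier k \<Longrightarrow> v \<in> carrier V \<Longrightarrow>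
      \<rho> g (c \<odot>\<^bsub>V\<^esub> v) = c \<odot>\<^bsub>V\<^esub> \<rho> g v"
  shows "group_representation k G V \<rho>"
proof -
  interpret G: group G by fact
  have inv: "\<rho> (inv\<^bsub>G\<^esub> g) (\<rho> g v) = v" "\<rho> g (\<rho> (inv\<^bsub>G\<^esub> g) v) = v"
    if "g \<in> carrier G" "v \<in> carrier V" for g v
    using that mult[of "inv\<^bsub>G\<^esub> g" g v] mult[of g "inv\<^bsub>G\<^esub> g" v] one by simp_all
  have bij: "\<rho> g \<in> Bij (carrier V)" if g: "g \<in> carrier G" for g
  proof -
    have "bij_betw (\<rho> g) (carrier V) (carrier V)"
      by (rule bij_betw_byWitness[where f' = "\<rho> (inv\<^bsub>G\<^esub> g)"])
        (use g inv[OF g] closed in auto)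
    then show ?thesis using ext[OF g] by (simp add: Bij_def)
  qed
  have "group_hom G (BijGroup (carrier V)) \<rho>"
  proof (rule group_hom.intro[OF \<open>group G\<close> group_BijGroup], unfold group_hom_axioms_def, rule homI)
    show "\<rho> g \<in> carrier (BijGroup (carrier V))" if "g \<in> carrier G" for g
      using bij[OF that] by (simp add: BijGroup_def)
    show "\<rho> (g \<otimes>\<^bsub>G\<^esub> h) = \<rho> g \<otimes>\<^bsub>BijGroup (carrier V)\<^esub> \<rho> h"
      if g: "g \<in> carrier G" and h: "h \<in> carrier G" for g h
    proof -
      have "\<rho> (g \<otimes>\<^bsub>G\<^esub> h) = compose (carrier V) (\<rho> g) (\<rho> h)"
      proof
        fix v
        show "\<rho> (g \<otimes>\<^bsub>G\<^esub> h) v = compose (carrier V) (\<rho> g) (\<rho> h) v"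
          using mult[OF g h, of v] extensional_arb[OF ext[of "g \<otimes>\<^bsub>G\<^esub> h"], of v] g h
          by (cases "v \<in> carrier V") (simp_all add: compose_def)
      qed
      then show ?thesis using bij[OF g] bij[OF h] by (simp add: BijGroup_def)
    qed
  qed
  then have "group_action G (carrier V) \<rho>" by (rule group_action.intro)
  then show ?thesis
    unfolding group_representation_def group_representation_axioms_def
    using assms(1,2) add smult by blast
qed

context group_representation
begin

lemma restrict_to_subgroup:
  assumes "subgroup H G"
  shows "group_representation k (G\<lparr>carrier := H\<rparr>) V \<rho>"
proof -
  have "H \<subseteq> carrier G" using assms subgroup.subset by blast
  then show ?thesis
    unfolding group_representation_def group_representation_axioms_def
    using induced_action[OF assms] field_axioms module_axioms act_add act_smult by auto
qed

lemma minus_eq_smult: "v \<in> carrier V \<Longrightarrow> \<ominus>\<^bsub>V\<^esub> v = (\<ominus>\<^bsub>k\<^esub> \<one>\<^bsub>k\<^esub>) \<odot>\<^bsub>V\<^esub> v"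
  by (simp add: smult_l_minus)

lemma act_zero: "g \<in> carrier G \<Longrightarrow> \<rho> g \<zero>\<^bsub>V\<^esub> = \<zero>\<^bsub>V\<^esub>"
  using act_smult[of g "\<zero>\<^bsub>k\<^esub>" "\<zero>\<^bsub>V\<^esub>"] act_closed[of g "\<zero>\<^bsub>V\<^esub>"] by simp

lemma act_minus:
  assumes "g \<in> carrier G" "v \<in> carrier V" "w \<in> carrier V"
  shows "\<rho> g (v \<ominus>\<^bsub>V\<^esub> w) = \<rho> g v \<ominus>\<^bsub>V\<^esub> \<rho> g w"
  using assms act_add[of g v "\<ominus>\<^bsub>V\<^esub> w"] act_smult[of g "\<ominus>\<^bsub>k\<^esub> \<one>\<^bsub>k\<^esub>" w] act_closed
  by (simp add: a_minus_def minus_eq_smult)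

lemma act_inv:
  assumes "g \<in> carrier G" "v \<in> carrier V"
  shows "\<rho> (inv\<^bsub>G\<^esub> g) (\<rho> g v) = v" "\<rho> g (\<rho> (inv\<^bsub>G\<^esub> g) v) = v"
proof -
  interpret G: group G by (rule group_G)
  show "\<rho> (inv\<^bsub>G\<^esub> g) (\<rho> g v) = v" "\<rho> g (\<rho> (inv\<^bsub>G\<^esub> g) v) = v"
    using assms act_mult[of "inv\<^bsub>G\<^esub> g" g v] act_mult[of g "inv\<^bsub>G\<^esub> g" v] act_one by simp_all
qed

lemma act_nat_pow_fixed:
  assumes "g \<in> carrier G" "v \<in> carrier V" "\<rho> g v = v"
  shows "\<rho> (g [^]\<^bsub>G\<^esub> (n::nat)) v = v"
proof -
  interpret G: group G by (rule group_G)
  show ?thesis using assms by (induction n) (simp_all add: act_one act_mult)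
qed

lemma subrepresentationI:
  assumes sub: "W \<subseteq> carrier V" and zero: "\<zero>\<^bsub>V\<^esub> \<in> W"
    and add: "\<And>x y. x \<in> W \<Longrightarrow> y \<in> W \<Longrightarrow> x \<oplus>\<^bsub>V\<^esub> y \<in> W"
    and smult: "\<And>c x. c \<in> carrier k \<Longrightarrow> x \<in> W \<Longrightarrow> c \<odot>\<^bsub>V\<^esub> x \<in> W"
    and act: "\<And>g x. g \<in> carrier G \<Longrightarrow> x \<in> W \<Longrightarrow> \<rho> g x \<in> W"
  shows "subrepresentation W k G V \<rho>"
proof -
  have "\<ominus>\<^bsub>V\<^esub> x \<in> W" if "x \<in> W" for x
    using smult[of "\<ominus>\<^bsub>k\<^esub> \<one>\<^bsub>k\<^esub>" x] that sub by (simp add: minus_eq_smult subsetD)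
  then have "submodule W k V" by (intro submoduleI assms)
  then show ?thesis using act by (simp add: subrepresentation_def)
qed

lemma subrepresentationE:
  assumes "subrepresentation W k G V \<rho>"
  shows "W \<subseteq> carrier V" and "\<zero>\<^bsub>V\<^esub> \<in> W"
    and "\<And>x y. x \<in> W \<Longrightarrow> y \<in> W \<Longrightarrow> x \<oplus>\<^bsub>V\<^esub> y \<in> W"
    and "\<And>x y. x \<in> W \<Longrightarrow> y \<in> W \<Longrightarrow> x \<ominus>\<^bsub>V\<^esub> y \<in> W"
    and "\<And>c x. c \<in> carrier k \<Longrightarrow> x \<in> W \<Longrightarrow> c \<odot>\<^bsub>V\<^esub> x \<in> W"
    and "\<And>g x. g \<in> carrier G \<Longrightarrow> x \<in> W \<Longrightarrow> \<rho> g x \<in> W"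
proof -
  have sm: "submodule W k V" using assms by (simp add: subrepresentation_def)
  note E = submoduleE[OF sm]
  show "W \<subseteq> carrier V" by (rule E(1))
  show "\<zero>\<^bsub>V\<^esub> \<in> W" using subgroup.one_closed[OF submodule.axioms(1)[OF sm]] by simp
  show "x \<ominus>\<^bsub>V\<^esub> y \<in> W" if "x \<in> W" "y \<in> W" for x y
    using E(5)[OF that(1) E(3)[OF that(2)]] by (simp add: a_minus_def)
qed (use submoduleE[of W] assms in \<open>auto simp: subrepresentation_def\<close>)

lemma subrepresentation_Inter:
  assumes "\<W> \<noteq> {}" "\<And>W. W \<in> \<W> \<Longrightarrow> subrepresentation W k G V \<rho>"
  shows "subrepresentation (\<Inter>\<W>) k G V \<rho>"
proof (rule subrepresentationI)
  note E = subrepresentationE[OF assms(2)]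
  show "\<Inter>\<W> \<subseteq> carrier V" using assms(1) E(1) by blast
  show "\<zero>\<^bsub>V\<^esub> \<in> \<Inter>\<W>" using E(2) by blast
  show "x \<oplus>\<^bsub>V\<^esub> y \<in> \<Inter>\<W>" if "x \<in> \<Inter>\<W>" "y \<in> \<Inter>\<W>" for x y using that E(3) by blast
  show "c \<odot>\<^bsub>V\<^esub> x \<in> \<Inter>\<W>" if "c \<in> carrier k" "x \<in> \<Inter>\<W>" for c x using that E(5) by blast
  show "\<rho> g x \<in> \<Inter>\<W>" if "g \<in> carrier G" "x \<in> \<Inter>\<W>" for g x using that E(6) by blast
qed

lemma subrepresentation_finsum:
  assumes W: "subrepresentation W k G V \<rho>" and "finite I" "\<And>i. i \<in> I \<Longrightarrow> f i \<in> W"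
  shows "finsum V f I \<in> W"
  using assms(2,3)
proof (induction I)
  case (insert i I)
  then have "f \<in> I \<rightarrow> carrier V" "f i \<in> carrier V" using subrepresentationE(1)[OF W] by auto
  then show ?case using insert subrepresentationE(3)[OF W] by simp
qed (simp add: subrepresentationE(2)[OF W])

end

text \<open>Up to isomorphism \<open>X\<close> is the quotient of \<open>U\<close> by the kernel of \<open>\<pi>\<close>; the values of \<open>\<pi>\<close> outside \<open>U\<close> are
arbitrary.\<close>

locale representation_subquotient =
  V: group_representation k G V \<rho> + X: group_representation k G X \<sigma>
  for k :: "('k, 'm) ring_scheme" and G :: "('g, 'n) monoid_scheme"
    and V :: "('k, 'v, 'l) module_scheme" and \<rho> :: "'g \<Rightarrow> 'v \<Rightarrow> 'v"
    and X :: "('k, 'w, 'r) module_scheme" and \<sigma> :: "'g \<Rightarrow> 'w \<Rightarrow> 'w" +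
  fixes U :: "'v set" and \<pi> :: "'v \<Rightarrow> 'w"
  assumes subrep: "subrepresentation U k G V \<rho>"
    and proj_onto: "\<pi> ` U = carrier X"
    and proj_add: "\<And>x y. x \<in> U \<Longrightarrow> y \<in> U \<Longrightarrow> \<pi> (x \<oplus>\<^bsub>V\<^esub> y) = \<pi> x \<oplus>\<^bsub>X\<^esub> \<pi> y"
    and proj_smult: "\<And>c x. c \<in> carrier k \<Longrightarrow> x \<in> U \<Longrightarrow> \<pi> (c \<odot>\<^bsub>V\<^esub> x) = c \<odot>\<^bsub>X\<^esub> \<pi> x"
    and proj_act: "\<And>g x. g \<in> carrier G \<Longrightarrow> x \<in> U \<Longrightarrow> \<pi> (\<rho> g x) = \<sigma> g (\<pi> x)"
begin

lemmas subrepE = V.subrepresentationE[OF subrep]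

lemma proj_closed: "x \<in> U \<Longrightarrow> \<pi> x \<in> carrier X"
  using proj_onto by blast

lemma proj_zero: "\<pi> \<zero>\<^bsub>V\<^esub> = \<zero>\<^bsub>X\<^esub>"
  using proj_smult[of "\<zero>\<^bsub>k\<^esub>" "\<zero>\<^bsub>V\<^esub>"] subrepE(2) proj_closed by simp

lemma proj_minus: "x \<in> U \<Longrightarrow> y \<in> U \<Longrightarrow> \<pi> (x \<ominus>\<^bsub>V\<^esub> y) = \<pi> x \<ominus>\<^bsub>X\<^esub> \<pi> y"
  using proj_add[of x "\<ominus>\<^bsub>V\<^esub> y"] proj_smult[of "\<ominus>\<^bsub>k\<^esub> \<one>\<^bsub>k\<^esub>" y]
    subrepE(5)[of "\<ominus>\<^bsub>k\<^esub> \<one>\<^bsub>k\<^esub>" y] subrepE(1)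
  by (simp add: a_minus_def V.minus_eq_smult X.minus_eq_smult proj_closed subsetD)

lemma proj_finsum:
  assumes "finite I" "\<And>i. i \<in> I \<Longrightarrow> f i \<in> U"
  shows "\<pi> (finsum V f I) = finsum X (\<lambda>i. \<pi> (f i)) I"
  using assms
proof (induction I)
  case (insert i I)
  have "f \<in> I \<rightarrow> carrier V" "f i \<in> carrier V" using insert subrepE(1) by auto
  moreover have "(\<lambda>i. \<pi> (f i)) \<in> I \<rightarrow> carrier X" "\<pi> (f i) \<in> carrier X"
    using insert proj_closed by auto
  moreover have "finsum V f I \<in> U"
    using V.subrepresentation_finsum[OF subrep insert.hyps(1)] insert.prems by simp
  ultimately show ?case using insert proj_add by simp
qed (simp add: proj_zero)

lemma preimage_subrepresentation:
  assumes W: "subrepresentation W k G X \<sigma>"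
  shows "subrepresentation {x \<in> U. \<pi> x \<in> W} k G V \<rho>"
proof (rule V.subrepresentationI)
  note E = X.subrepresentationE[OF W]
  show "{x \<in> U. \<pi> x \<in> W} \<subseteq> carrier V" using subrepE(1) by blast
  show "\<zero>\<^bsub>V\<^esub> \<in> {x \<in> U. \<pi> x \<in> W}" using subrepE(2) proj_zero E(2) by simp
  show "x \<oplus>\<^bsub>V\<^esub> y \<in> {x \<in> U. \<pi> x \<in> W}" if "x \<in> {x \<in> U. \<pi> x \<in> W}" "y \<in> {x \<in> U. \<pi> x \<in> W}" for x y
    using that subrepE(3) proj_add E(3) by simp
  show "c \<odot>\<^bsub>V\<^esub> x \<in> {x \<in> U. \<pi> x \<in> W}" if "c \<in> carrier k" "x \<in> {x \<in> U. \<pi> x \<in> W}" for c x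
    using that subrepE(5) proj_smult E(5) by simp
  show "\<rho> g x \<in> {x \<in> U. \<pi> x \<in> W}" if "g \<in> carrier G" "x \<in> {x \<in> U. \<pi> x \<in> W}" for g x
    using that subrepE(6) proj_act E(6) by simp
qed

lemma kernel_subrepresentation: "subrepresentation {x \<in> U. \<pi> x = \<zero>\<^bsub>X\<^esub>} k G V \<rho>"
proof -
  have "subrepresentation {\<zero>\<^bsub>X\<^esub>} k G X \<sigma>"
    by (rule X.subrepresentationI) (auto simp: X.act_zero)
  from preimage_subrepresentation[OF this] show ?thesis by simp
qed

end

context group_representation
begin

text \<open>The quotient \<open>U/J\<close> consists of cosets of \<open>J\<close>, and its operations are computed with chosen
representatives. Once \<open>\<pi>\<close> is known to respect all operations, the axioms for \<open>U/J\<close> are inherited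
from \<open>V\<close>.\<close>

lemma ex_quotient:
  assumes U: "subrepresentation U k G V \<rho>" and J: "subrepresentation J k G V \<rho>"
  shows "\<exists>(X :: ('k, 'v set) module) \<sigma> \<pi>. representation_subquotient k G V \<rho> X \<sigma> U \<pi> \<and>
    (\<forall>x \<in> U. \<pi> x = \<zero>\<^bsub>X\<^esub> \<longleftrightarrow> x \<in> J)"
proof -
  interpret G: group G by (rule group_G)
  note UE = subrepresentationE[OF U] and JE = subrepresentationE[OF J]
  have UV: "x \<in> carrier V" if "x \<in> U" for x using that UE(1) by blast
  define \<pi> where "\<pi> x = {y \<in> carrier V. y \<ominus>\<^bsub>V\<^esub> x \<in> J}" for x
  have eq: "\<pi> x = \<pi> y \<longleftrightarrow> x \<ominus>\<^bsub>V\<^esub> y \<in> J" if xy: "x \<in> carrier V" "y \<in> carrier V" for x y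
  proof
    assume "\<pi> x = \<pi> y"
    moreover have "x \<in> \<pi> x" using xy JE(2) by (simp add: \<pi>_def M.minus_eq M.r_neg)
    ultimately show "x \<ominus>\<^bsub>V\<^esub> y \<in> J" by (simp add: \<pi>_def)
  next
    assume J1: "x \<ominus>\<^bsub>V\<^esub> y \<in> J"
    have "z \<ominus>\<^bsub>V\<^esub> x \<in> J \<longleftrightarrow> z \<ominus>\<^bsub>V\<^esub> y \<in> J" if z: "z \<in> carrier V" for z
    proof
      assume "z \<ominus>\<^bsub>V\<^esub> x \<in> J"
      from JE(3)[OF this J1] show "z \<ominus>\<^bsub>V\<^esub> y \<in> J"
        using xy z by (simp add: M.minus_eq M.a_assoc M.r_neg1)
    next
      assume "z \<ominus>\<^bsub>V\<^esub> y \<in> J"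
      from JE(4)[OF this J1] have "z \<oplus>\<^bsub>V\<^esub> (\<ominus>\<^bsub>V\<^esub> y \<oplus>\<^bsub>V\<^esub> (\<ominus>\<^bsub>V\<^esub> x \<oplus>\<^bsub>V\<^esub> y)) \<in> J"
        using xy z by (simp add: M.minus_eq M.minus_add M.a_assoc)
      moreover have "\<ominus>\<^bsub>V\<^esub> y \<oplus>\<^bsub>V\<^esub> (\<ominus>\<^bsub>V\<^esub> x \<oplus>\<^bsub>V\<^esub> y) = \<ominus>\<^bsub>V\<^esub> x"
        using xy M.a_lcomm[of "\<ominus>\<^bsub>V\<^esub> y" "\<ominus>\<^bsub>V\<^esub> x" y] by (simp add: M.l_neg)
      ultimately show "z \<ominus>\<^bsub>V\<^esub> x \<in> J" by (simp add: M.minus_eq)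
    qed
    then show "\<pi> x = \<pi> y" by (auto simp: \<pi>_def)
  qed
  define d where "d X = (SOME x. x \<in> U \<and> \<pi> x = X)" for X
  have d: "d (\<pi> x) \<in> U" "\<pi> (d (\<pi> x)) = \<pi> x" if "x \<in> U" for x
    using someI[of "\<lambda>y. y \<in> U \<and> \<pi> y = \<pi> x" x] that by (simp_all add: d_def)
  have dV: "d (\<pi> x) \<in> carrier V" "d (\<pi> x) \<ominus>\<^bsub>V\<^esub> x \<in> J" if "x \<in> U" for x
    using d[OF that] UV that eq by blast+
  define X :: "('k, 'v set) module" where
    "X = \<lparr>carrier = \<pi> ` U, monoid.mult = undefined, one = undefined, zero = \<pi> \<zero>\<^bsub>V\<^esub>,
          add = (\<lambda>A B. \<pi> (d A \<oplus>\<^bsub>V\<^esub> d B)), smult = (\<lambda>c A. \<pi> (c \<odot>\<^bsub>V\<^esub> d A))\<rparr>"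
  define \<sigma> where "\<sigma> g = (\<lambda>A \<in> \<pi> ` U. \<pi> (\<rho> g (d A)))" for g
  have carr: "carrier X = \<pi> ` U" and zero: "\<zero>\<^bsub>X\<^esub> = \<pi> \<zero>\<^bsub>V\<^esub>" by (simp_all add: X_def)
  have add: "\<pi> x \<oplus>\<^bsub>X\<^esub> \<pi> y = \<pi> (x \<oplus>\<^bsub>V\<^esub> y)" if "x \<in> U" "y \<in> U" for x y
  proof -
    have "(d (\<pi> x) \<ominus>\<^bsub>V\<^esub> x) \<oplus>\<^bsub>V\<^esub> (d (\<pi> y) \<ominus>\<^bsub>V\<^esub> y) \<in> J" using dV that JE(3) by blast
    moreover have "(d (\<pi> x) \<ominus>\<^bsub>V\<^esub> x) \<oplus>\<^bsub>V\<^esub> (d (\<pi> y) \<ominus>\<^bsub>V\<^esub> y) =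
        (d (\<pi> x) \<oplus>\<^bsub>V\<^esub> d (\<pi> y)) \<ominus>\<^bsub>V\<^esub> (x \<oplus>\<^bsub>V\<^esub> y)"
      using dV that UV by (simp add: M.minus_eq M.minus_add M.a_ac)
    ultimately show ?thesis using eq that dV UV by (simp add: X_def)
  qed
  have smult: "c \<odot>\<^bsub>X\<^esub> \<pi> x = \<pi> (c \<odot>\<^bsub>V\<^esub> x)" if "c \<in> carrier k" "x \<in> U" for c x
  proof -
    have "c \<odot>\<^bsub>V\<^esub> (d (\<pi> x) \<ominus>\<^bsub>V\<^esub> x) \<in> J" using dV that JE(5) by blast
    then have "c \<odot>\<^bsub>V\<^esub> d (\<pi> x) \<ominus>\<^bsub>V\<^esub> c \<odot>\<^bsub>V\<^esub> x \<in> J"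
      using dV that UV by (simp add: M.minus_eq smult_r_distr smult_r_minus)
    then show ?thesis using eq that dV UV by (simp add: X_def)
  qed
  have act: "\<sigma> g (\<pi> x) = \<pi> (\<rho> g x)" if "g \<in> carrier G" "x \<in> U" for g x
  proof -
    have "\<rho> g (d (\<pi> x)) \<ominus>\<^bsub>V\<^esub> \<rho> g x \<in> J"
      using JE(6)[OF that(1) dV(2)[OF that(2)]] that dV UV by (simp add: act_minus)
    then show ?thesis using eq that dV UV act_closed by (simp add: \<sigma>_def)
  qed
  have grp: "abelian_group X"
  proof (rule abelian_groupI)
    fix A assume "A \<in> carrier X"
    then obtain a where a: "a \<in> U" "A = \<pi> a" by (auto simp: carr)
    have "\<ominus>\<^bsub>V\<^esub> a \<in> U" using UE(5)[of "\<ominus>\<^bsub>k\<^esub> \<one>\<^bsub>k\<^esub>" a] a UV by (simp add: minus_eq_smult)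
    then have "\<pi> (\<ominus>\<^bsub>V\<^esub> a) \<in> carrier X" "\<pi> (\<ominus>\<^bsub>V\<^esub> a) \<oplus>\<^bsub>X\<^esub> A = \<zero>\<^bsub>X\<^esub>"
      using a UV by (simp_all add: add carr zero M.l_neg)
    then show "\<exists>B \<in> carrier X. B \<oplus>\<^bsub>X\<^esub> A = \<zero>\<^bsub>X\<^esub>" by blast
  qed (auto simp: carr zero add UE UV M.a_ac)
  have mod: "Module.module k X"
    by (rule moduleI[OF cring_axioms grp])
       (auto simp: carr add smult UE UV smult_l_distr smult_r_distr smult_assoc1)
  have rep: "group_representation k G X \<sigma>"
    by (rule group_representationI[OF field_axioms mod group_G])
       (auto simp: carr add smult act UE UV act_mult act_one act_add act_smult, simp add: \<sigma>_def)
  have "representation_subquotient k G V \<rho> X \<sigma> U \<pi>"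
    by (intro representation_subquotient.intro representation_subquotient_axioms.intro
          group_representation_axioms rep U)
       (simp_all add: carr add smult act)
  moreover have "\<pi> x = \<zero>\<^bsub>X\<^esub> \<longleftrightarrow> x \<in> J" if "x \<in> U" for x
    using eq[of x "\<zero>\<^bsub>V\<^esub>"] UV[OF that] by (simp add: zero M.minus_eq minus_eq_smult)
  ultimately show ?thesis by blast
qed

text \<open>Take \<open>J\<close> maximal among the submodules that do not contain \<open>v\<close>, and \<open>U\<close> the smallest submodule that
contains \<open>J\<close> and \<open>v\<close>. A submodule strictly between them would contain \<open>v\<close>, hence \<open>U\<close>.\<close>

theorem ex_irreducible_subquotient:
  assumes v: "v \<in> carrier V" "v \<noteq> \<zero>\<^bsub>V\<^esub>"
  shows "\<exists>(X :: ('k, 'v set) module) \<sigma> U \<pi>. representation_subquotient k G V \<rho> X \<sigma> U \<pi> \<and>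
    irreducible_representation k G X \<sigma> \<and> v \<in> U \<and> \<pi> v \<noteq> \<zero>\<^bsub>X\<^esub>"
proof -
  let ?\<J> = "{J. subrepresentation J k G V \<rho> \<and> v \<notin> J}"
  have "\<exists>J \<in> ?\<J>. \<forall>W \<in> ?\<J>. J \<subseteq> W \<longrightarrow> W = J"
  proof (rule subset_Zorn_nonempty)
    have "subrepresentation {\<zero>\<^bsub>V\<^esub>} k G V \<rho>"
      by (rule subrepresentationI) (auto simp: act_zero)
    then show "?\<J> \<noteq> {}" using v by blast
    fix \<C> assume ne: "\<C> \<noteq> {}" and ch: "subset.chain ?\<J> \<C>"
    have mem: "subrepresentation W k G V \<rho>" "v \<notin> W" if "W \<in> \<C>" for W
      using that ch by (auto simp: subset_chain_def)
    note E = subrepresentationE[OF mem(1)]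
    have "subrepresentation (\<Union>\<C>) k G V \<rho>"
    proof (rule subrepresentationI)
      show "\<Union>\<C> \<subseteq> carrier V" using E(1) by blast
      show "\<zero>\<^bsub>V\<^esub> \<in> \<Union>\<C>" using ne E(2) by blast
      show "c \<odot>\<^bsub>V\<^esub> x \<in> \<Union>\<C>" if "c \<in> carrier k" "x \<in> \<Union>\<C>" for c x using that E(5) by blast
      show "\<rho> g x \<in> \<Union>\<C>" if "g \<in> carrier G" "x \<in> \<Union>\<C>" for g x using that E(6) by blast
      show "x \<oplus>\<^bsub>V\<^esub> y \<in> \<Union>\<C>" if xy: "x \<in> \<Union>\<C>" "y \<in> \<Union>\<C>" for x y
      proof -
        obtain A B where AB: "A \<in> \<C>" "x \<in> A" "B \<in> \<C>" "y \<in> B" using xy by blast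
        then have "A \<subseteq> B \<or> B \<subseteq> A" using ch by (simp add: subset_chain_def)
        then show ?thesis using AB E(3) by blast
      qed
    qed
    then show "\<Union>\<C> \<in> ?\<J>" using mem(2) by blast
  qed
  then obtain J where J: "subrepresentation J k G V \<rho>" "v \<notin> J"
    and max: "\<And>W. subrepresentation W k G V \<rho> \<Longrightarrow> v \<notin> W \<Longrightarrow> J \<subseteq> W \<Longrightarrow> W = J"
    by blast
  define U where "U = \<Inter>{W. subrepresentation W k G V \<rho> \<and> J \<subseteq> W \<and> v \<in> W}"
  have "subrepresentation (carrier V) k G V \<rho>"
    by (rule subrepresentationI) (auto simp: act_closed)
  then have ne: "{W. subrepresentation W k G V \<rho> \<and> J \<subseteq> W \<and> v \<in> W} \<noteq> {}"
    using v(1) subrepresentationE(1)[OF J(1)] by blast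
  have U: "subrepresentation U k G V \<rho>"
    unfolding U_def by (rule subrepresentation_Inter[OF ne]) blast
  have vU: "v \<in> U" "J \<subseteq> U" by (auto simp: U_def)
  obtain X :: "('k, 'v set) module" and \<sigma> \<pi> where
    sq: "representation_subquotient k G V \<rho> X \<sigma> U \<pi>" and ker: "\<And>x. x \<in> U \<Longrightarrow> \<pi> x = \<zero>\<^bsub>X\<^esub> \<longleftrightarrow> x \<in> J"
    using ex_quotient[OF U J(1)] by blast
  interpret representation_subquotient k G V \<rho> X \<sigma> U \<pi> by (rule sq)
  have pv: "\<pi> v \<noteq> \<zero>\<^bsub>X\<^esub>" using ker[OF vU(1)] J(2) by simp
  have "irreducible_representation k G X \<sigma>"
    unfolding irreducible_representation_def
  proof (intro conjI allI impI)
    show "group_representation k G X \<sigma>" by (rule X.group_representation_axioms)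
    show "carrier X \<noteq> {\<zero>\<^bsub>X\<^esub>}" using pv proj_closed[OF vU(1)] by auto
    fix W assume W: "subrepresentation W k G X \<sigma>"
    let ?P = "{x \<in> U. \<pi> x \<in> W}"
    have P: "subrepresentation ?P k G V \<rho>" by (rule preimage_subrepresentation[OF W])
    have JP: "J \<subseteq> ?P"
    proof
      fix x assume x: "x \<in> J"
      then have "x \<in> U" using vU by blast
      moreover have "\<pi> x = \<zero>\<^bsub>X\<^esub>" using ker[of x] x vU by blast
      ultimately show "x \<in> ?P" using X.subrepresentationE(2)[OF W] by simp
    qed
    have WP: "W = \<pi> ` ?P"
    proof
      show "W \<subseteq> \<pi> ` ?P"
      proof
        fix w assume w: "w \<in> W"
        then have "w \<in> \<pi> ` U" using X.subrepresentationE(1)[OF W] proj_onto by blast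
        then show "w \<in> \<pi> ` ?P" using w by blast
      qed
    qed blast
    show "W = {\<zero>\<^bsub>X\<^esub>} \<or> W = carrier X"
    proof (cases "v \<in> ?P")
      case True
      then have "U \<subseteq> ?P" unfolding U_def using P JP by (intro Inter_lower) (simp add: U_def)
      then have "?P = U" by blast
      then show ?thesis using WP proj_onto by simp
    next
      case False
      then have "?P = J" using max[OF P _ JP] by blast
      then have "W = \<pi> ` J" using WP by simp
      moreover have "\<pi> ` J = {\<zero>\<^bsub>X\<^esub>}"
        using ker vU(2) subrepresentationE(2)[OF J(1)] by (auto simp: image_iff subset_iff)
      ultimately show ?thesis by simp
    qed
  qed
  then show ?thesis using sq vU(1) pv by blast
qed

end

section \<open>Sums over the powers of a group element\<close>

lemma (in ring) nat_one_add: "[(m + n :: nat)] \<cdot> \<one> = [m] \<cdot> \<one> \<oplus> [n] \<cdot> \<one>"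
  using add.nat_pow_mult[of \<one> m n] by simp

lemma (in ring) nat_one_mult: "[(m * n :: nat)] \<cdot> \<one> = ([m] \<cdot> \<one>) \<otimes> ([n] \<cdot> \<one>)"
  by (simp add: add_pow_ldistr add.nat_pow_pow mult.commute)

lemma (in field) ring_characteristic_properties:
  assumes n: "0 < n" "[(n::nat)] \<cdot> \<one> = \<zero>"
  shows "Factorial_Ring.prime (ring_characteristic R)" "ring_characteristic R dvd n"
    "[ring_characteristic R] \<cdot> \<one> = \<zero>"
proof -
  define p where "p = (LEAST n::nat. 0 < n \<and> [n] \<cdot> \<one> = \<zero>)"
  have "\<exists>n::nat. 0 < n \<and> [n] \<cdot> \<one> = \<zero>" using n by blast
  then have char: "ring_characteristic R = p" by (simp add: ring_characteristic_def p_def)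
  have p: "0 < p" "[p] \<cdot> \<one> = \<zero>"
    unfolding p_def using LeastI[of "\<lambda>n::nat. 0 < n \<and> [n] \<cdot> \<one> = \<zero>", OF conjI, OF n] by auto
  have least: "[j] \<cdot> \<one> \<noteq> \<zero>" if "0 < j" "j < p" for j :: nat
    using not_less_Least[of j "\<lambda>n::nat. 0 < n \<and> [n] \<cdot> \<one> = \<zero>"] that unfolding p_def by auto
  have "p \<noteq> 1" using p(2) by auto
  then have p1: "1 < p" using p(1) by linarith
  have "Factorial_Ring.prime p"
    unfolding prime_nat_iff
  proof (intro conjI allI impI p1)
    fix a assume "a dvd p"
    then obtain b where ab: "p = a * b" by (auto simp: dvd_def)
    then have "[a] \<cdot> \<one> = \<zero> \<or> [b] \<cdot> \<one> = \<zero>" using p(2) nat_one_mult[of a b] ab by (simp add: integral_iff)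
    moreover have "0 < a" "0 < b" using ab p(1) by (auto intro: Nat.gr0I)
    ultimately have "\<not> a < p \<or> \<not> b < p" using least by blast
    then show "a = 1 \<or> a = p" using ab \<open>0 < a\<close> \<open>0 < b\<close> by auto
  qed
  moreover have "p dvd n"
  proof -
    have "[n] \<cdot> \<one> = [(p * (n div p) + n mod p)] \<cdot> \<one>" by simp
    also have "\<dots> = [(p * (n div p))] \<cdot> \<one> \<oplus> [(n mod p)] \<cdot> \<one>"
      by (rule add.nat_pow_mult[symmetric]) simp
    also have "\<dots> = [(n mod p)] \<cdot> \<one>" unfolding nat_one_mult p(2) by simp
    finally have "[(n mod p)] \<cdot> \<one> = \<zero>" using n(2) by simp
    then show ?thesis using least[of "n mod p"] p(1) by fastforce
  qed
  ultimately show "Factorial_Ring.prime (ring_characteristic R)" "ring_characteristic R dvd n"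
    "[ring_characteristic R] \<cdot> \<one> = \<zero>"
    using char p(2) by simp_all
qed

text \<open>Otherwise the characteristic is a prime dividing the order of \<open>x\<close>, and a power of \<open>x\<close> has that prime
as its order.\<close>

lemma (in group) order_nonzero_in_field:
  assumes k: "field k" and tor: "torsion_group G" and A: "subgroup A G"
    and char: "ring_characteristic k \<notin> torsion_primes (G\<lparr>carrier := A\<rparr>)" and x: "x \<in> A"
  shows "[ord x] \<cdot>\<^bsub>k\<^esub> \<one>\<^bsub>k\<^esub> \<noteq> \<zero>\<^bsub>k\<^esub>"
proof
  interpret k: field k by (rule k)
  assume z: "[ord x] \<cdot>\<^bsub>k\<^esub> \<one>\<^bsub>k\<^esub> = \<zero>\<^bsub>k\<^esub>"
  have xG: "x \<in> carrier G" using x A subgroup.subset by blast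
  have n: "0 < ord x" by (rule torsion_imp_finite_order[OF tor xG])
  let ?p = "ring_characteristic k"
  have p: "Factorial_Ring.prime ?p" "?p dvd ord x"
    using k.ring_characteristic_properties[OF n z] by auto
  then obtain m where m: "ord x = m * ?p" by (metis dvd_div_mult_self)
  have "0 < m" "m < ord x" using m n prime_gt_1_nat[OF p(1)] by auto
  then have "x [^] m \<noteq> \<one>" using pow_eq_id[OF xG] by (meson nat_dvd_not_less)
  moreover have "(x [^] m) [^] ?p = \<one>" using xG m by (simp add: nat_pow_pow flip: m)
  moreover have "x [^] m \<in> A"
    using subgroup_nat_pow_closed[OF A x, of "m"] by simp
  ultimately have "?p \<in> torsion_primes (G\<lparr>carrier := A\<rparr>)"
    using p(1) by (auto simp: torsion_primes_def nat_pow_def)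
  then show False using char by simp
qed

context group_representation
begin

lemma smult_eq_zero:
  assumes "c \<in> carrier k" "c \<noteq> \<zero>\<^bsub>k\<^esub>" "v \<in> carrier V" "c \<odot>\<^bsub>V\<^esub> v = \<zero>\<^bsub>V\<^esub>"
  shows "v = \<zero>\<^bsub>V\<^esub>"
proof -
  have c: "c \<in> Units k" using assms(1,2) field_Units by blast
  then have "v = (inv\<^bsub>k\<^esub> c \<otimes>\<^bsub>k\<^esub> c) \<odot>\<^bsub>V\<^esub> v" using assms(3) by (simp add: Units_l_inv)
  also have "\<dots> = inv\<^bsub>k\<^esub> c \<odot>\<^bsub>V\<^esub> (c \<odot>\<^bsub>V\<^esub> v)" by (rule smult_assoc1) (use c assms in auto)
  finally show ?thesis using c assms(4) by simp
qed

text \<open>The operator \<open>1 + g + \<dots> + g\<^sup>n\<^sup>-\<^sup>1\<close> of the group algebra, of interest when \<open>g\<^sup>n\<close> acts trivially.\<close>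

definition orbit_sum :: "'g \<Rightarrow> nat \<Rightarrow> 'v \<Rightarrow> 'v" where
  "orbit_sum g n v = finsum V (\<lambda>i. \<rho> (g [^]\<^bsub>G\<^esub> i) v) {..<n}"

lemma act_pow_closed: "g \<in> carrier G \<Longrightarrow> v \<in> carrier V \<Longrightarrow> \<rho> (g [^]\<^bsub>G\<^esub> (i::nat)) v \<in> carrier V"
  using act_closed monoid.nat_pow_closed[OF group.is_monoid[OF group_G]] by blast

lemma orbit_sum_closed: "g \<in> carrier G \<Longrightarrow> v \<in> carrier V \<Longrightarrow> orbit_sum g n v \<in> carrier V"
  unfolding orbit_sum_def using act_pow_closed by (intro M.finsum_closed) auto

lemma orbit_sum_0 [simp]: "orbit_sum g 0 v = \<zero>\<^bsub>V\<^esub>"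
  by (simp add: orbit_sum_def)

lemma orbit_sum_Suc:
  assumes "g \<in> carrier G" "v \<in> carrier V"
  shows "orbit_sum g (Suc n) v = \<rho> (g [^]\<^bsub>G\<^esub> n) v \<oplus>\<^bsub>V\<^esub> orbit_sum g n v"
  unfolding orbit_sum_def lessThan_Suc using assms act_pow_closed by (subst M.finsum_insert) auto

lemma orbit_sum_add:
  assumes "g \<in> carrier G" "v \<in> carrier V" "w \<in> carrier V"
  shows "orbit_sum g n (v \<oplus>\<^bsub>V\<^esub> w) = orbit_sum g n v \<oplus>\<^bsub>V\<^esub> orbit_sum g n w"
proof -
  interpret G: group G by (rule group_G)
  show ?thesis
    using assms by (induction n) (simp_all add: orbit_sum_Suc act_add act_closed orbit_sum_closed M.a_ac)
qed

lemma orbit_sum_smult: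
  assumes "g \<in> carrier G" "v \<in> carrier V" "c \<in> carrier k"
  shows "orbit_sum g n (c \<odot>\<^bsub>V\<^esub> v) = c \<odot>\<^bsub>V\<^esub> orbit_sum g n v"
proof -
  interpret G: group G by (rule group_G)
  show ?thesis
    using assms by (induction n) (simp_all add: orbit_sum_Suc act_smult act_closed orbit_sum_closed smult_r_distr)
qed

lemma orbit_sum_telescope:
  assumes "g \<in> carrier G" "v \<in> carrier V"
  shows "orbit_sum g n (\<rho> g v) \<oplus>\<^bsub>V\<^esub> v = \<rho> (g [^]\<^bsub>G\<^esub> n) v \<oplus>\<^bsub>V\<^esub> orbit_sum g n v"
proof -
  interpret G: group G by (rule group_G)
  show ?thesis
  proof (induction n)
    case 0
    then show ?case using assms by (simp add: act_one)
  next
    case (Suc n)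
    have "orbit_sum g (Suc n) (\<rho> g v) \<oplus>\<^bsub>V\<^esub> v =
        \<rho> (g [^]\<^bsub>G\<^esub> n) (\<rho> g v) \<oplus>\<^bsub>V\<^esub> (orbit_sum g n (\<rho> g v) \<oplus>\<^bsub>V\<^esub> v)"
      using assms by (simp add: orbit_sum_Suc act_closed orbit_sum_closed M.a_assoc)
    also have "\<dots> = \<rho> (g [^]\<^bsub>G\<^esub> Suc n) v \<oplus>\<^bsub>V\<^esub> orbit_sum g (Suc n) v"
      unfolding Suc using assms by (simp add: orbit_sum_Suc act_mult)
    finally show ?case .
  qed
qed

lemma orbit_sum_fixed:
  assumes "g \<in> carrier G" "v \<in> carrier V" "\<rho> g v = v"
  shows "orbit_sum g n v = ([n] \<cdot>\<^bsub>k\<^esub> \<one>\<^bsub>k\<^esub>) \<odot>\<^bsub>V\<^esub> v"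
  using assms
  by (induction n) (simp_all add: orbit_sum_Suc act_nat_pow_fixed smult_l_distr M.a_comm)

lemma orbit_sum_equivariant:
  assumes g: "g \<in> carrier G" and h: "h \<in> carrier G" and v: "v \<in> carrier V"
  shows "\<rho> h (orbit_sum g n v) = orbit_sum (h \<otimes>\<^bsub>G\<^esub> g \<otimes>\<^bsub>G\<^esub> inv\<^bsub>G\<^esub> h) n (\<rho> h v)"
proof -
  interpret G: group G by (rule group_G)
  have pow: "(h \<otimes>\<^bsub>G\<^esub> g \<otimes>\<^bsub>G\<^esub> inv\<^bsub>G\<^esub> h) [^]\<^bsub>G\<^esub> i \<otimes>\<^bsub>G\<^esub> h = h \<otimes>\<^bsub>G\<^esub> g [^]\<^bsub>G\<^esub> i" for i :: nat
    unfolding G.conj_pow[OF h g] using g h by (simp add: G.m_assoc)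
  have step: "\<rho> h (\<rho> (g [^]\<^bsub>G\<^esub> i) v) = \<rho> ((h \<otimes>\<^bsub>G\<^esub> g \<otimes>\<^bsub>G\<^esub> inv\<^bsub>G\<^esub> h) [^]\<^bsub>G\<^esub> i) (\<rho> h v)" for i :: nat
    using g h v pow[of i] by (simp flip: act_mult)
  have "\<rho> h (orbit_sum g n v) = finsum V (\<lambda>i. \<rho> h (\<rho> (g [^]\<^bsub>G\<^esub> i) v)) {..<n}"
    unfolding orbit_sum_def by (rule act_finsum) (use g h v act_closed in auto)
  then show ?thesis by (simp only: orbit_sum_def step)
qed

lemma orbit_sum_commute:
  assumes "g \<in> carrier G" "h \<in> carrier G" "g \<otimes>\<^bsub>G\<^esub> h = h \<otimes>\<^bsub>G\<^esub> g" "v \<in> carrier V"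
  shows "\<rho> h (orbit_sum g n v) = orbit_sum g n (\<rho> h v)"
proof -
  interpret G: group G by (rule group_G)
  have "h \<otimes>\<^bsub>G\<^esub> g \<otimes>\<^bsub>G\<^esub> inv\<^bsub>G\<^esub> h = g" using assms by (simp add: G.m_assoc flip: assms(3))
  then show ?thesis using orbit_sum_equivariant[OF assms(1,2,4)] by simp
qed

text \<open>Three forms of \<open>E (g - 1) = (g - 1) E = 0\<close> for \<open>E = 1 + g + \<dots> + g\<^sup>n\<^sup>-\<^sup>1\<close>, applied to a vector
that \<open>g\<^sup>n\<close> fixes.\<close>

lemma orbit_sum_annihilates:
  assumes g: "g \<in> carrier G" and v: "v \<in> carrier V" and triv: "\<rho> (g [^]\<^bsub>G\<^esub> n) v = v"
  shows "orbit_sum g n (\<rho> g v) = orbit_sum g n v" "\<rho> g (orbit_sum g n v) = orbit_sum g n v"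
    "orbit_sum g n (\<rho> g v \<ominus>\<^bsub>V\<^esub> v) = \<zero>\<^bsub>V\<^esub>"
proof -
  have "orbit_sum g n (\<rho> g v) \<oplus>\<^bsub>V\<^esub> v = v \<oplus>\<^bsub>V\<^esub> orbit_sum g n v"
    using orbit_sum_telescope[OF g v] triv by simp
  then show 1: "orbit_sum g n (\<rho> g v) = orbit_sum g n v"
    using g v act_closed orbit_sum_closed by (metis M.a_comm M.add.right_cancel)
  then show "\<rho> g (orbit_sum g n v) = orbit_sum g n v"
    using orbit_sum_commute[OF g g refl v] by simp
  have "orbit_sum g n (\<ominus>\<^bsub>V\<^esub> v) = \<ominus>\<^bsub>V\<^esub> orbit_sum g n v"
    using orbit_sum_smult[OF g v, of "\<ominus>\<^bsub>k\<^esub> \<one>\<^bsub>k\<^esub>"] g v by (simp add: minus_eq_smult orbit_sum_closed)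
  then show "orbit_sum g n (\<rho> g v \<ominus>\<^bsub>V\<^esub> v) = \<zero>\<^bsub>V\<^esub>"
    using 1 g v by (simp add: a_minus_def orbit_sum_add act_closed orbit_sum_closed M.r_neg)
qed

lemma orbit_sum_mem:
  assumes U: "subrepresentation U k G V \<rho>" and "g \<in> carrier G" "v \<in> U"
  shows "orbit_sum g n v \<in> U"
proof -
  interpret G: group G by (rule group_G)
  show ?thesis
    unfolding orbit_sum_def by (rule subrepresentation_finsum[OF U])
      (use assms subrepresentationE(6)[OF U] in auto)
qed

lemma fixed_by_normal_subrepresentation:
  assumes "N \<lhd> G"
  shows "subrepresentation {v \<in> carrier V. \<forall>n \<in> N. \<rho> n v = v} k G V \<rho>"
proof -
  interpret N: normal N G by fact
  show ?thesis
  proof (rule subrepresentationI)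
    fix g x assume g: "g \<in> carrier G" and x: "x \<in> {v \<in> carrier V. \<forall>n \<in> N. \<rho> n v = v}"
    have "\<rho> n (\<rho> g x) = \<rho> g x" if n: "n \<in> N" for n
    proof -
      have "inv\<^bsub>G\<^esub> g \<otimes>\<^bsub>G\<^esub> n \<otimes>\<^bsub>G\<^esub> g \<in> N" using g n N.inv_op_closed1 by simp
      moreover have "n \<otimes>\<^bsub>G\<^esub> g = g \<otimes>\<^bsub>G\<^esub> (inv\<^bsub>G\<^esub> g \<otimes>\<^bsub>G\<^esub> n \<otimes>\<^bsub>G\<^esub> g)"
        using g n by (simp add: N.m_assoc[symmetric])
      ultimately show ?thesis using g n x by (simp flip: act_mult) (simp add: act_mult)
    qed
    then show "\<rho> g x \<in> {v \<in> carrier V. \<forall>n \<in> N. \<rho> n v = v}" using g x act_closed by simp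
  qed (auto simp: act_add act_smult act_zero)
qed

end

context representation_subquotient
begin

lemma proj_orbit_sum:
  assumes g: "g \<in> carrier G" and x: "x \<in> U"
  shows "\<pi> (V.orbit_sum g n x) = X.orbit_sum g n (\<pi> x)"
proof -
  interpret G: group G by (rule V.group_G)
  have "\<pi> (V.orbit_sum g n x) = finsum X (\<lambda>i. \<pi> (\<rho> (g [^]\<^bsub>G\<^esub> i) x)) {..<n}"
    unfolding V.orbit_sum_def by (rule proj_finsum) (use g x subrepE(6) in auto)
  then show ?thesis using g x by (simp add: X.orbit_sum_def proj_act)
qed

end

section \<open>Normal p-subgroups in characteristic p\<close>

context group_representation
begin

abbreviation diff :: "'g \<Rightarrow> 'v \<Rightarrow> 'v" where
  "diff g v \<equiv> \<rho> g v \<ominus>\<^bsub>V\<^esub> v"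

lemma diff_pow_closed: "g \<in> carrier G \<Longrightarrow> v \<in> carrier V \<Longrightarrow> (diff g ^^ i) v \<in> carrier V"
  by (induction i) (simp_all add: act_closed)

lemma act_eq_add_diff:
  assumes "g \<in> carrier G" "v \<in> carrier V"
  shows "\<rho> g v = v \<oplus>\<^bsub>V\<^esub> diff g v"
  using assms act_closed[OF assms] M.a_comm[of v] by (simp add: M.minus_eq M.a_assoc M.l_neg)

text \<open>The binomial theorem for \<open>g\<^sup>n = (1 + (g - 1))\<^sup>n\<close>. In characteristic \<open>p\<close> it shows that \<open>(g - 1)\<^sup>p = g\<^sup>p - 1\<close>.\<close>

lemma act_pow_binomial:
  assumes g: "g \<in> carrier G" and v: "v \<in> carrier V"
  shows "\<rho> (g [^]\<^bsub>G\<^esub> n) v =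
    finsum V (\<lambda>i. ([(n choose i)] \<cdot>\<^bsub>k\<^esub> \<one>\<^bsub>k\<^esub>) \<odot>\<^bsub>V\<^esub> (diff g ^^ i) v) {..n}"
proof (induction n)
  case 0
  then show ?case using v by (simp add: act_one)
next
  case (Suc n)
  interpret G: group G by (rule group_G)
  define t where "t i = (diff g ^^ i) v" for i
  have t_Suc: "t (Suc i) = diff g (t i)" for i by (simp add: t_def)
  define c :: "nat \<Rightarrow> nat \<Rightarrow> 'k" where "c m i = [(m choose i)] \<cdot>\<^bsub>k\<^esub> \<one>\<^bsub>k\<^esub>" for m i
  have c: "c m i \<in> carrier k" for m i by (simp add: c_def)
  have t: "t i \<in> carrier V" for i unfolding t_def by (rule diff_pow_closed[OF g v])
  have ct: "c m i \<odot>\<^bsub>V\<^esub> t j \<in> carrier V" for m i j using c t by simp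
  have pascal: "c (Suc n) (Suc i) = c n i \<oplus>\<^bsub>k\<^esub> c n (Suc i)" for i
    by (simp add: c_def nat_one_add)
  let ?f = "\<lambda>i. c n i \<odot>\<^bsub>V\<^esub> t i" and ?h = "\<lambda>i. c n i \<odot>\<^bsub>V\<^esub> t (Suc i)"
  have f: "?f \<in> A \<rightarrow> carrier V" and h: "?h \<in> A \<rightarrow> carrier V" and f': "(\<lambda>i. ?f (Suc i)) \<in> A \<rightarrow> carrier V" for A
    using ct by auto
  \<comment> \<open>The coefficient of index \<open>n + 1\<close> is zero, so the sum can be extended before Pascal's rule is
    applied.\<close>
  have "finsum V ?f {..Suc n} = finsum V ?f {..n}"
    using t by (simp add: M.finsum_Suc f c_def binomial_eq_0 M.finsum_closed[OF f, unfolded c_def])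
  then have split: "finsum V ?f {..n} = finsum V (\<lambda>i. ?f (Suc i)) {..n} \<oplus>\<^bsub>V\<^esub> ?f 0"
    using M.finsum_Suc2[OF f, of n] by (simp only:)
  have "\<rho> (g [^]\<^bsub>G\<^esub> Suc n) v = \<rho> g (\<rho> (g [^]\<^bsub>G\<^esub> n) v)"
    using g v G.nat_pow_Suc2 act_mult by simp
  also have "\<dots> = \<rho> g (finsum V ?f {..n})" by (simp add: Suc c_def t_def)
  also have "\<dots> = finsum V (\<lambda>i. \<rho> g (?f i)) {..n}" by (rule act_finsum[OF _ f g]) simp
  also have "\<dots> = finsum V (\<lambda>i. ?f i \<oplus>\<^bsub>V\<^esub> ?h i) {..n}"
  proof (rule M.finsum_cong')
    fix i
    have "\<rho> g (?f i) = c n i \<odot>\<^bsub>V\<^esub> \<rho> g (t i)" by (rule act_smult[OF g c t])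
    also have "\<dots> = ?f i \<oplus>\<^bsub>V\<^esub> ?h i"
      using act_eq_add_diff[OF g t[of i]] smult_r_distr[OF c t t, of n i i "Suc i"] by (simp add: t_Suc)
    finally show "\<rho> g (?f i) = ?f i \<oplus>\<^bsub>V\<^esub> ?h i" .
  qed (use ct in auto)
  also have "\<dots> = finsum V ?f {..n} \<oplus>\<^bsub>V\<^esub> finsum V ?h {..n}" by (rule M.finsum_addf[OF f h])
  also have "\<dots> = finsum V (\<lambda>i. ?h i \<oplus>\<^bsub>V\<^esub> ?f (Suc i)) {..n} \<oplus>\<^bsub>V\<^esub> ?f 0"
    unfolding split M.finsum_addf[OF h f']
    using M.finsum_closed[OF h] M.finsum_closed[OF f'] ct by (simp add: M.a_ac)
  also have "finsum V (\<lambda>i. ?h i \<oplus>\<^bsub>V\<^esub> ?f (Suc i)) {..n} =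
      finsum V (\<lambda>i. c (Suc n) (Suc i) \<odot>\<^bsub>V\<^esub> t (Suc i)) {..n}"
    by (rule M.finsum_cong') (use c t ct in \<open>auto simp: pascal smult_l_distr\<close>)
  also have "?f 0 = c (Suc n) 0 \<odot>\<^bsub>V\<^esub> t 0" by (simp add: c_def)
  also have "finsum V (\<lambda>i. c (Suc n) (Suc i) \<odot>\<^bsub>V\<^esub> t (Suc i)) {..n} \<oplus>\<^bsub>V\<^esub> c (Suc n) 0 \<odot>\<^bsub>V\<^esub> t 0 =
      finsum V (\<lambda>i. c (Suc n) i \<odot>\<^bsub>V\<^esub> t i) {..Suc n}"
    by (rule M.finsum_Suc2[symmetric]) (use ct in auto)
  finally show ?case by (simp only: c_def t_def)
qed

lemma diff_pow_prime_eq_zero: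
  assumes g: "g \<in> carrier G" and v: "v \<in> carrier V"
    and p: "Factorial_Ring.prime (p::nat)" "[p] \<cdot>\<^bsub>k\<^esub> \<one>\<^bsub>k\<^esub> = \<zero>\<^bsub>k\<^esub>" and gp: "\<rho> (g [^]\<^bsub>G\<^esub> p) v = v"
  shows "(diff g ^^ p) v = \<zero>\<^bsub>V\<^esub>"
proof -
  let ?t = "\<lambda>i. (diff g ^^ i) v"
  have t: "?t i \<in> carrier V" for i by (rule diff_pow_closed[OF g v])
  obtain m where m: "p = Suc m" using p(1) by (metis not0_implies_Suc not_prime_0)
  have "[(p choose i)] \<cdot>\<^bsub>k\<^esub> \<one>\<^bsub>k\<^esub> = \<zero>\<^bsub>k\<^esub>" if "0 < i" "i < p" for i
  proof -
    have "p dvd (p choose i)" by (rule dvd_choose_prime) (use that p(1) in auto)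
    then obtain b where "p choose i = p * b" by (auto simp: dvd_def)
    then have "[(p choose i)] \<cdot>\<^bsub>k\<^esub> \<one>\<^bsub>k\<^esub> = ([p] \<cdot>\<^bsub>k\<^esub> \<one>\<^bsub>k\<^esub>) \<otimes>\<^bsub>k\<^esub> ([b] \<cdot>\<^bsub>k\<^esub> \<one>\<^bsub>k\<^esub>)"
      by (simp add: nat_one_mult)
    then show ?thesis using p(2) by simp
  qed
  then have "finsum V (\<lambda>i. ([(p choose i)] \<cdot>\<^bsub>k\<^esub> \<one>\<^bsub>k\<^esub>) \<odot>\<^bsub>V\<^esub> ?t i) {..m} =
      finsum V (\<lambda>i. if 0 = i then ?t i else \<zero>\<^bsub>V\<^esub>) {..m}"
    using t m v by (intro M.finsum_cong') auto
  also have "\<dots> = v" using M.finsum_singleton[of 0 "{..m}" ?t] t by simp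
  finally have "\<rho> (g [^]\<^bsub>G\<^esub> p) v = ?t p \<oplus>\<^bsub>V\<^esub> v"
    unfolding act_pow_binomial[OF g v] using m M.finsum_Suc[of "\<lambda>i. ([(p choose i)] \<cdot>\<^bsub>k\<^esub> \<one>\<^bsub>k\<^esub>) \<odot>\<^bsub>V\<^esub> ?t i" m] t
    by (auto simp del: funpow.simps)
  then show ?thesis using gp t[of p] v by (metis M.add.r_cancel_one)
qed

text \<open>By induction on \<open>Y\<close>: if \<open>u\<close> is fixed by the elements treated so far, the last nonzero vector among
\<open>u, (y - 1)u, (y - 1)\<^sup>2u, \<dots>\<close> is fixed by \<open>y\<close> too, because \<open>(y - 1)\<^sup>p\<close> kills \<open>u\<close> and \<open>y\<close> commutes with
the other elements.\<close>

lemma ex_common_fixed_vector: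
  assumes nz: "carrier V \<noteq> {\<zero>\<^bsub>V\<^esub>}"
    and p: "Factorial_Ring.prime (p::nat)" "[p] \<cdot>\<^bsub>k\<^esub> \<one>\<^bsub>k\<^esub> = \<zero>\<^bsub>k\<^esub>"
    and Y: "finite Y" "Y \<subseteq> carrier G" "\<And>y. y \<in> Y \<Longrightarrow> y [^]\<^bsub>G\<^esub> p = \<one>\<^bsub>G\<^esub>"
      "\<And>y z. y \<in> Y \<Longrightarrow> z \<in> Y \<Longrightarrow> y \<otimes>\<^bsub>G\<^esub> z = z \<otimes>\<^bsub>G\<^esub> y"
  shows "\<exists>u \<in> carrier V. u \<noteq> \<zero>\<^bsub>V\<^esub> \<and> (\<forall>y \<in> Y. \<rho> y u = u)"
  using Y
proof (induction Y)
  case empty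
  then show ?case using nz M.zero_closed by blast
next
  case (insert y Y)
  then obtain u where u: "u \<in> carrier V" "u \<noteq> \<zero>\<^bsub>V\<^esub>" "\<And>z. z \<in> Y \<Longrightarrow> \<rho> z u = u" by auto
  have y: "y \<in> carrier G" using insert.prems by simp
  let ?t = "\<lambda>i. (diff y ^^ i) u"
  have t: "?t i \<in> carrier V" for i by (rule diff_pow_closed[OF y u(1)])
  have "?t p = \<zero>\<^bsub>V\<^esub>"
    by (rule diff_pow_prime_eq_zero[OF y u(1) p]) (use insert.prems u(1) act_one in simp)
  then obtain j where j: "?t j = \<zero>\<^bsub>V\<^esub>" "\<And>i. i < j \<Longrightarrow> ?t i \<noteq> \<zero>\<^bsub>V\<^esub>"
    using exists_least_iff[of "\<lambda>i. ?t i = \<zero>\<^bsub>V\<^esub>"] by blast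
  then obtain l where l: "j = Suc l" using u(2) by (metis funpow_0 not0_implies_Suc)
  have "diff y (?t l) = \<zero>\<^bsub>V\<^esub>" using j(1) l by simp
  then have fix_y: "\<rho> y (?t l) = ?t l" using act_eq_add_diff[OF y t[of l]] t[of l] by simp
  have fix_Y: "\<rho> z (?t i) = ?t i" if z: "z \<in> Y" for z i
  proof (induction i)
    case 0
    then show ?case using u(3)[OF z] by simp
  next
    case (Suc i)
    have zG: "z \<in> carrier G" and zy: "z \<otimes>\<^bsub>G\<^esub> y = y \<otimes>\<^bsub>G\<^esub> z" using insert.prems z by auto
    have "\<rho> z (\<rho> y (?t i)) = \<rho> y (\<rho> z (?t i))"
      using zy act_mult[OF zG y t[of i]] act_mult[OF y zG t[of i]] by simp
    then show ?case using Suc act_minus[OF zG act_closed[OF y t[of i]] t[of i]] by simp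
  qed
  have "?t l \<noteq> \<zero>\<^bsub>V\<^esub>" using j(2) l by simp
  then show ?case using t fix_y fix_Y by blast
qed

end

text \<open>The vectors fixed by \<open>N\<close> form a submodule, since \<open>N\<close> is normal, and it is not zero.\<close>

lemma irreducible_normal_p_subgroup_trivial:
  assumes irr: "irreducible_representation k H X \<sigma>"
    and p: "Factorial_Ring.prime (p::nat)" "[p] \<cdot>\<^bsub>k\<^esub> \<one>\<^bsub>k\<^esub> = \<zero>\<^bsub>k\<^esub>"
    and N: "N \<lhd> H" "finite N" "\<And>y. y \<in> N \<Longrightarrow> y [^]\<^bsub>H\<^esub> p = \<one>\<^bsub>H\<^esub>"
      "\<And>y z. y \<in> N \<Longrightarrow> z \<in> N \<Longrightarrow> y \<otimes>\<^bsub>H\<^esub> z = z \<otimes>\<^bsub>H\<^esub> y"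
    and "y \<in> N" "v \<in> carrier X"
  shows "\<sigma> y v = v"
proof -
  interpret group_representation k H X \<sigma> using irr by (simp add: irreducible_representation_def)
  have NH: "N \<subseteq> carrier H" using N(1) normal_imp_subgroup subgroup.subset by blast
  have "carrier X \<noteq> {\<zero>\<^bsub>X\<^esub>}" using irr by (simp add: irreducible_representation_def)
  then obtain u where u: "u \<in> carrier X" "u \<noteq> \<zero>\<^bsub>X\<^esub>" "\<forall>y \<in> N. \<sigma> y u = u"
    using ex_common_fixed_vector[OF _ p N(2) NH N(3,4)] by blast
  let ?F = "{v \<in> carrier X. \<forall>y \<in> N. \<sigma> y v = v}"
  have "?F = {\<zero>\<^bsub>X\<^esub>} \<or> ?F = carrier X"
    using irr fixed_by_normal_subrepresentation[OF N(1)] by (simp add: irreducible_representation_def)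
  then have "?F = carrier X" using u by blast
  then have "v \<in> ?F" using \<open>v \<in> carrier X\<close> by simp
  then show ?thesis using \<open>y \<in> N\<close> by simp
qed

text \<open>Suppose \<open>x \<in> A\<close> has order \<open>p\<close>, the characteristic, and let \<open>w = x v - v \<noteq> 0\<close>. Irreducibility writes \<open>v\<close>
as a combination of finitely many \<open>g w\<close>; together with \<open>x\<close>, these \<open>g\<close> generate a finite subgroup \<open>H\<close>.
In an irreducible \<open>kH\<close>-subquotient in which \<open>v\<close> survives, \<open>x\<close> acts trivially, since it lies in a normal
elementary abelian \<open>p\<close>-subgroup of \<open>H\<close>. So \<open>w\<close> vanishes there, and with it \<open>v\<close>.\<close>

theorem characteristic_not_torsion_prime:
  fixes k :: "('k, 'm) ring_scheme" and G :: "('g, 'n) monoid_scheme"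
    and V :: "('k, 'v, 'l) module_scheme"
  assumes irr: "irreducible_representation k G V \<rho>" and faith: "faithful_representation k G V \<rho>"
    and lf: "locally_finite_on G (carrier G)" and A: "abelian_normal_subgroup G A"
  shows "ring_characteristic k \<notin> torsion_primes (G\<lparr>carrier := A\<rparr>)"
proof
  interpret V: group_representation k G V \<rho> using irr by (simp add: irreducible_representation_def)
  interpret G: group G by (rule V.group_G)
  define p where "p = ring_characteristic k"
  assume "ring_characteristic k \<in> torsion_primes (G\<lparr>carrier := A\<rparr>)"
  then obtain x where p: "Factorial_Ring.prime p"
    and x: "x \<in> A" "x \<noteq> \<one>\<^bsub>G\<^esub>" "x [^]\<^bsub>G\<^esub> p = \<one>\<^bsub>G\<^esub>"
    by (auto simp: torsion_primes_def p_def nat_pow_def)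
  have pk: "[p] \<cdot>\<^bsub>k\<^esub> \<one>\<^bsub>k\<^esub> = \<zero>\<^bsub>k\<^esub>"
  proof (cases "\<exists>n::nat. 0 < n \<and> [n] \<cdot>\<^bsub>k\<^esub> \<one>\<^bsub>k\<^esub> = \<zero>\<^bsub>k\<^esub>")
    case True
    then show ?thesis using V.ring_characteristic_properties(3) p_def by blast
  next
    case False
    have "p = 0" unfolding p_def ring_characteristic_def by (rule if_not_P[OF False])
    then show ?thesis using p by simp
  qed
  have An: "A \<lhd> G" and Ac: "comm_group (G\<lparr>carrier := A\<rparr>)"
    using A by (simp_all add: abelian_normal_subgroup_def)
  interpret A: normal A G by (rule An)
  have xG: "x \<in> carrier G" using x(1) by simp
  obtain v where v: "v \<in> carrier V" "\<rho> x v \<noteq> v"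
    using faith x(2) xG by (auto simp: faithful_representation_def)
  define w where "w = \<rho> x v \<ominus>\<^bsub>V\<^esub> v"
  have w: "w \<in> carrier V" "w \<noteq> \<zero>\<^bsub>V\<^esub>"
    using v V.act_closed[OF xG v(1)] V.act_eq_add_diff[OF xG v(1)] by (auto simp: w_def)
  have "V.comb w ` V.coeffs \<noteq> {\<zero>\<^bsub>V\<^esub>}" using V.mem_comb[OF w(1)] w(2) by blast
  then have "V.comb w ` V.coeffs = carrier V"
    using irr V.comb_subrep[OF w(1)] by (auto simp: irreducible_representation_def)
  then obtain f where f: "f \<in> V.coeffs" "v = V.comb w f" using v(1) by blast
  let ?S = "{g \<in> carrier G. f g \<noteq> \<zero>\<^bsub>k\<^esub>}"
  have S: "finite ?S" and fk: "f g \<in> carrier k" for g using f(1) by (auto simp: V.coeffs_def)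
  let ?K = "generate G (insert x ?S)"
  have gen: "insert x ?S \<subseteq> carrier G" using xG by auto
  have K: "subgroup ?K G" by (rule G.generate_is_subgroup[OF gen])
  have finK: "finite ?K" using lf gen S by (simp add: locally_finite_on_def)
  let ?H = "G\<lparr>carrier := ?K\<rparr>"
  have SK: "insert x ?S \<subseteq> ?K" by (auto intro: generate.incl)
  interpret R: group_representation k ?H V \<rho> by (rule V.restrict_to_subgroup[OF K])
  interpret H: group ?H by (rule R.group_G)
  have "v \<noteq> \<zero>\<^bsub>V\<^esub>" using v V.act_zero[OF xG] by auto
  then obtain X :: "('k, 'v set) module" and \<sigma> U \<pi> where
    sq: "representation_subquotient k ?H V \<rho> X \<sigma> U \<pi>" and Xirr: "irreducible_representation k ?H X \<sigma>"
    and vU: "v \<in> U" "\<pi> v \<noteq> \<zero>\<^bsub>X\<^esub>"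
    using R.ex_irreducible_subquotient[OF v(1)] by blast
  interpret Q: representation_subquotient k ?H V \<rho> X \<sigma> U \<pi> by (rule sq)
  define N where "N = {y \<in> ?K. y \<in> A \<and> y [^]\<^bsub>G\<^esub> p = \<one>\<^bsub>G\<^esub>}"
  have commA: "a \<otimes>\<^bsub>G\<^esub> b = b \<otimes>\<^bsub>G\<^esub> a" if "a \<in> A" "b \<in> A" for a b
    using comm_monoid.m_comm[OF comm_group.axioms(1)[OF Ac], of a b] that by simp
  have KG: "y \<in> carrier G" if "y \<in> ?K" for y using that K subgroup.mem_carrier by metis
  have N: "N \<lhd> ?H"
    unfolding H.normal_inv_iff
  proof (intro conjI ballI)
    have AK: "subgroup (A \<inter> ?K) G" using G.subgroups_Inter_pair A.is_subgroup K by blast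
    have "subgroup N G"
    proof (rule G.subgroupI)
      show "N \<subseteq> carrier G" using KG by (auto simp: N_def)
      have "\<one>\<^bsub>G\<^esub> \<in> N" using subgroup.one_closed[OF K] by (simp add: N_def)
      then show "N \<noteq> {}" by blast
      show "inv\<^bsub>G\<^esub> a \<in> N" if "a \<in> N" for a
        using that KG subgroup.m_inv_closed[OF K] by (auto simp: N_def G.nat_pow_inv)
      show "a \<otimes>\<^bsub>G\<^esub> b \<in> N" if "a \<in> N" "b \<in> N" for a b
        using that KG subgroup.m_closed[OF K] commA
        by (auto simp: N_def G.pow_mult_distrib)
    qed
    then show "subgroup N ?H" using G.subgroup_incl[OF _ K] by (auto simp: N_def)
    fix g y assume g: "g \<in> carrier ?H" and y: "y \<in> N"
    then have gK: "g \<in> ?K" "g \<in> carrier G" and yK: "y \<in> ?K" "y \<in> carrier G" "y \<in> A"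
      using KG by (auto simp: N_def)
    have "(g \<otimes>\<^bsub>G\<^esub> y \<otimes>\<^bsub>G\<^esub> inv\<^bsub>G\<^esub> g) [^]\<^bsub>G\<^esub> i = g \<otimes>\<^bsub>G\<^esub> y [^]\<^bsub>G\<^esub> i \<otimes>\<^bsub>G\<^esub> inv\<^bsub>G\<^esub> g" for i :: nat
      by (rule G.conj_pow[OF gK(2) yK(2)])
    then have "g \<otimes>\<^bsub>G\<^esub> y \<otimes>\<^bsub>G\<^esub> inv\<^bsub>G\<^esub> g \<in> N"
      using gK yK y subgroup.m_closed[OF K] subgroup.m_inv_closed[OF K] A.inv_op_closed2
      by (simp add: N_def)
    then show "g \<otimes>\<^bsub>?H\<^esub> y \<otimes>\<^bsub>?H\<^esub> inv\<^bsub>?H\<^esub> g \<in> N"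
      using G.m_inv_consistent[OF K gK(1)] by simp
  qed
  have "finite N" using finK by (rule rev_finite_subset) (auto simp: N_def)
  then have "\<sigma> x (\<pi> v) = \<pi> v"
    by (rule irreducible_normal_p_subgroup_trivial[OF Xirr p pk N])
       (use x SK vU Q.proj_closed commA in \<open>auto simp: N_def nat_pow_def\<close>)
  then have "\<pi> w = \<zero>\<^bsub>X\<^esub>"
    using vU Q.proj_minus[of "\<rho> x v" v] Q.proj_act[of x v] Q.subrepE(6)[of x v] SK Q.proj_closed
    by (simp add: w_def Q.X.M.minus_eq Q.X.M.r_neg)
  then have wker: "w \<in> {u \<in> U. \<pi> u = \<zero>\<^bsub>X\<^esub>}"
    using vU Q.subrepE(4)[of "\<rho> x v" v] Q.subrepE(6)[of x v] SK by (simp add: w_def)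
  have "finsum V (\<lambda>g. f g \<odot>\<^bsub>V\<^esub> \<rho> g w) ?S \<in> {u \<in> U. \<pi> u = \<zero>\<^bsub>X\<^esub>}"
  proof (rule R.subrepresentation_finsum[OF Q.kernel_subrepresentation S])
    fix g assume "g \<in> ?S"
    then have "g \<in> carrier ?H" using SK by auto
    then show "f g \<odot>\<^bsub>V\<^esub> \<rho> g w \<in> {u \<in> U. \<pi> u = \<zero>\<^bsub>X\<^esub>}"
      by (intro R.subrepresentationE(5,6)[OF Q.kernel_subrepresentation] fk wker)
  qed
  then show False using vU(2) f(2) by (simp add: V.comb_def)
qed

section \<open>Irreducible modules of abelian torsion groups\<close>

text \<open>The prime \<open>q\<close> divides the order of \<open>a\<close>, since otherwise \<open>a\<close> would be a power of \<open>a\<^sup>q\<close> and lie in \<open>C\<close>;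
and the order of \<open>a\<close> is invertible in \<open>k\<close>.\<close>

lemma (in group) layer_prime_nonzero_in_field:
  assumes k: "field k" and tor: "torsion_group G" and A: "subgroup A G" and C: "subgroup C G"
    and char: "ring_characteristic k \<notin> torsion_primes (G\<lparr>carrier := A\<rparr>)"
    and q: "Factorial_Ring.prime (q::nat)" and a: "a \<in> A" "a \<notin> C" "a [^] q \<in> C"
  shows "[q] \<cdot>\<^bsub>k\<^esub> \<one>\<^bsub>k\<^esub> \<noteq> \<zero>\<^bsub>k\<^esub>"
proof
  interpret k: field k by (rule k)
  assume z: "[q] \<cdot>\<^bsub>k\<^esub> \<one>\<^bsub>k\<^esub> = \<zero>\<^bsub>k\<^esub>"
  have aG: "a \<in> carrier G" using a A subgroup.subset by blast
  have "q dvd ord a"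
  proof (rule ccontr)
    assume "\<not> q dvd ord a"
    then have "coprime q (ord a)" using q by (simp add: prime_imp_coprime)
    moreover have "a [^] ord a \<in> C" using aG subgroup.one_closed[OF C] by simp
    ultimately show False using mem_of_coprime_powers[OF C aG a(3)] a(2) by blast
  qed
  then obtain m where "ord a = q * m" by (auto simp: dvd_def)
  then have "[ord a] \<cdot>\<^bsub>k\<^esub> \<one>\<^bsub>k\<^esub> = \<zero>\<^bsub>k\<^esub>" using z by (simp add: k.nat_one_mult)
  then show False using order_nonzero_in_field[OF k tor A char a(1)] by simp
qed

lemma (in group) cyclic_prime_layers_subgroup:
  assumes A: "subgroup A G"
  shows "cyclic_prime_layers (G\<lparr>carrier := A\<rparr>) A C \<longleftrightarrow> cyclic_prime_layers G A C"
proof -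
  have "a [^] (i::nat) \<in> A" if "a \<in> A" for a i
    using subgroup_nat_pow_closed[OF A that, of "i"] by simp
  then show ?thesis
    unfolding cyclic_prime_layers_def nat_pow_def
    by (simp add: nat_pow_def m_inv_consistent[OF A] cong: ball_cong)
qed

lemma (in abelian_monoid) finsum_swap:
  assumes "finite I" "finite J" "\<And>i j. i \<in> I \<Longrightarrow> j \<in> J \<Longrightarrow> f i j \<in> carrier G"
  shows "finsum G (\<lambda>i. finsum G (\<lambda>j. f i j) J) I = finsum G (\<lambda>j. finsum G (\<lambda>i. f i j) I) J"
  using assms(1,3)
proof (induction I)
  case empty
  then show ?case by (simp add: finsum_zero)
next
  case (insert x I)
  have "finsum G (\<lambda>i. finsum G (\<lambda>j. f i j) J) (insert x I) =
      finsum G (\<lambda>j. f x j) J \<oplus> finsum G (\<lambda>j. finsum G (\<lambda>i. f i j) I) J"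
    using insert by (subst finsum_insert) auto
  also have "\<dots> = finsum G (\<lambda>j. f x j \<oplus> finsum G (\<lambda>i. f i j) I) J"
    using insert.prems by (subst finsum_addf) auto
  also have "\<dots> = finsum G (\<lambda>j. finsum G (\<lambda>i. f i j) (insert x I)) J"
    using insert by (intro finsum_cong') auto
  finally show ?case .
qed

context group_representation
begin

definition action_kernel :: "'g set" where
  "action_kernel = {g \<in> carrier G. \<forall>v \<in> carrier V. \<rho> g v = v}"

lemma action_kernel_normal: "action_kernel \<lhd> G"
proof -
  interpret G: group G by (rule group_G)
  show ?thesis
    unfolding G.normal_inv_iff
  proof (intro conjI ballI)
    show "subgroup action_kernel G"
    proof (rule G.subgroupI)
      show "action_kernel \<subseteq> carrier G" by (auto simp: action_kernel_def)
      have "\<one>\<^bsub>G\<^esub> \<in> action_kernel" by (simp add: action_kernel_def act_one)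
      then show "action_kernel \<noteq> {}" by blast
      show "a \<otimes>\<^bsub>G\<^esub> b \<in> action_kernel" if "a \<in> action_kernel" "b \<in> action_kernel" for a b
        using that by (simp add: action_kernel_def act_mult)
      show "inv\<^bsub>G\<^esub> a \<in> action_kernel" if "a \<in> action_kernel" for a
        using that act_inv(1)[of a] by (simp add: action_kernel_def)
    qed
    show "x \<otimes>\<^bsub>G\<^esub> h \<otimes>\<^bsub>G\<^esub> inv\<^bsub>G\<^esub> x \<in> action_kernel" if "x \<in> carrier G" "h \<in> action_kernel" for x h
      using that by (simp add: action_kernel_def act_mult act_closed act_inv)
  qed
qed

text \<open>The vectors fixed by \<open>t\<close> form a submodule, because the group is abelian; as \<open>t\<close> acts nontrivially, it
is zero, while it contains every value of the operator \<open>1 + t + \<dots> + t\<^sup>n\<^sup>-\<^sup>1\<close>.\<close>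

lemma irreducible_abelian_orbit_sum_eq_zero:
  assumes irr: "irreducible_representation k G V \<rho>" and comm: "comm_group G"
    and t: "t \<in> carrier G" "t \<notin> action_kernel" "t [^]\<^bsub>G\<^esub> n \<in> action_kernel" and u: "u \<in> carrier V"
  shows "orbit_sum t n u = \<zero>\<^bsub>V\<^esub>"
proof -
  interpret G: comm_group G by (rule comm)
  let ?F = "{v \<in> carrier V. \<rho> t v = v}"
  have "subrepresentation ?F k G V \<rho>"
  proof (rule subrepresentationI)
    fix g x assume g: "g \<in> carrier G" and x: "x \<in> ?F"
    then have "\<rho> t (\<rho> g x) = \<rho> g x" using t(1) G.m_comm[of t g] by (simp flip: act_mult) (simp add: act_mult)
    then show "\<rho> g x \<in> ?F" using g x act_closed by simp
  qed (use t(1) in \<open>auto simp: act_add act_smult act_zero\<close>)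
  then have "?F = {\<zero>\<^bsub>V\<^esub>} \<or> ?F = carrier V" using irr by (simp add: irreducible_representation_def)
  moreover have "?F \<noteq> carrier V" using t(1,2) by (auto simp: action_kernel_def)
  ultimately have "?F = {\<zero>\<^bsub>V\<^esub>}" by blast
  moreover have "orbit_sum t n u \<in> ?F"
    using orbit_sum_annihilates(2)[OF t(1) u] t u orbit_sum_closed by (simp add: action_kernel_def)
  ultimately show ?thesis by blast
qed

text \<open>The group acts through the multiplicative group of a field, where the \<open>q\<close>-th roots of unity are the
powers of any nontrivial one. To see this without the field, suppose that no \<open>x\<^sub>j = b a\<^sup>-\<^sup>j\<close> acts
trivially. Then each \<open>1 + x\<^sub>j + \<dots> + x\<^sub>j\<^sup>q\<^sup>-\<^sup>1\<close> is zero on the module. Adding these up over \<open>j\<close> and collecting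
the powers of \<open>b\<close>, the coefficient of \<open>b\<^sup>i\<close> is the sum of all \<open>(a\<^sup>-\<^sup>i)\<^sup>j\<close>, which is zero for \<open>i \<noteq> 0\<close> for
the same reason; what remains is \<open>q = 0\<close>.\<close>

theorem irreducible_abelian_cyclic_prime_layers:
  assumes irr: "irreducible_representation k G V \<rho>" and comm: "comm_group G"
    and tor: "torsion_group G" and char: "ring_characteristic k \<notin> torsion_primes G"
  shows "cyclic_prime_layers G (carrier G) action_kernel"
  unfolding cyclic_prime_layers_def
proof (intro allI impI ballI, elim conjE)
  interpret G: comm_group G by (rule comm)
  let ?C = action_kernel
  have C: "subgroup ?C G" using action_kernel_normal normal_imp_subgroup by blast
  fix q :: nat and a b
  assume q: "Factorial_Ring.prime q" and a: "a \<in> carrier G" and b: "b \<in> carrier G"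
    and aC: "a \<notin> ?C" "a [^]\<^bsub>G\<^esub> q \<in> ?C" and bC: "b [^]\<^bsub>G\<^esub> q \<in> ?C"
  show "\<exists>i::nat. b \<otimes>\<^bsub>G\<^esub> inv\<^bsub>G\<^esub> (a [^]\<^bsub>G\<^esub> i) \<in> ?C"
  proof (rule ccontr)
    assume no: "\<not> (\<exists>i::nat. b \<otimes>\<^bsub>G\<^esub> inv\<^bsub>G\<^esub> (a [^]\<^bsub>G\<^esub> i) \<in> ?C)"
    have powC: "c [^]\<^bsub>G\<^esub> (i::nat) \<in> ?C" if "c \<in> ?C" for c i
      using G.subgroup_nat_pow_closed[OF C that, of "i"] by simp
    obtain u where u: "u \<in> carrier V" "u \<noteq> \<zero>\<^bsub>V\<^esub>"
      using irr M.zero_closed by (auto simp: irreducible_representation_def)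
    let ?x = "\<lambda>j. b \<otimes>\<^bsub>G\<^esub> inv\<^bsub>G\<^esub> (a [^]\<^bsub>G\<^esub> (j::nat))" and ?y = "\<lambda>i. inv\<^bsub>G\<^esub> (a [^]\<^bsub>G\<^esub> (i::nat))"
    have x0: "orbit_sum (?x j) q u = \<zero>\<^bsub>V\<^esub>" for j
    proof (rule irreducible_abelian_orbit_sum_eq_zero[OF irr comm _ _ _ u(1)])
      have "(a [^]\<^bsub>G\<^esub> j) [^]\<^bsub>G\<^esub> q = (a [^]\<^bsub>G\<^esub> q) [^]\<^bsub>G\<^esub> j"
        using a by (simp add: G.nat_pow_pow mult.commute)
      then have "?x j [^]\<^bsub>G\<^esub> q = b [^]\<^bsub>G\<^esub> q \<otimes>\<^bsub>G\<^esub> inv\<^bsub>G\<^esub> ((a [^]\<^bsub>G\<^esub> q) [^]\<^bsub>G\<^esub> j)"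
        using a b by (simp add: G.nat_pow_distrib G.nat_pow_inv)
      then show "?x j [^]\<^bsub>G\<^esub> q \<in> ?C"
        using bC powC[OF aC(2)] subgroup.m_closed[OF C] subgroup.m_inv_closed[OF C] by simp
    qed (use a b no in auto)
    have y0: "orbit_sum (?y i) q u = \<zero>\<^bsub>V\<^esub>" if i: "i \<noteq> 0" "i < q" for i
    proof (rule irreducible_abelian_orbit_sum_eq_zero[OF irr comm _ _ _ u(1)])
      show "?y i \<notin> ?C"
      proof
        assume "?y i \<in> ?C"
        then have "a [^]\<^bsub>G\<^esub> i \<in> ?C" using subgroup.m_inv_closed[OF C, of "?y i"] a by simp
        moreover have "coprime i q"
          using i q by (metis coprime_commute nat_dvd_not_less neq0_conv prime_imp_coprime)
        ultimately show False using G.mem_of_coprime_powers[OF C a _ aC(2)] aC(1) by blast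
      qed
      have "?y i [^]\<^bsub>G\<^esub> q = inv\<^bsub>G\<^esub> ((a [^]\<^bsub>G\<^esub> q) [^]\<^bsub>G\<^esub> i)"
        using a by (simp add: G.nat_pow_inv G.nat_pow_pow mult.commute)
      then show "?y i [^]\<^bsub>G\<^esub> q \<in> ?C" using powC[OF aC(2)] subgroup.m_inv_closed[OF C] by simp
    qed (use a in simp)
    have swap: "\<rho> (?x j [^]\<^bsub>G\<^esub> i) u = \<rho> (b [^]\<^bsub>G\<^esub> i) (\<rho> (?y i [^]\<^bsub>G\<^esub> j) u)" for i j :: nat
    proof -
      have "?x j [^]\<^bsub>G\<^esub> i = b [^]\<^bsub>G\<^esub> i \<otimes>\<^bsub>G\<^esub> ?y i [^]\<^bsub>G\<^esub> j"
        using a b by (simp add: G.nat_pow_distrib G.nat_pow_inv G.nat_pow_pow mult.commute)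
      then show ?thesis using a b u(1) by (simp add: act_mult)
    qed
    have q0: "0 < q" using q by (simp add: prime_gt_0_nat)
    have "\<zero>\<^bsub>V\<^esub> = finsum V (\<lambda>j. orbit_sum (?x j) q u) {..<q}" by (simp add: x0 M.finsum_zero)
    also have "\<dots> = finsum V (\<lambda>i. finsum V (\<lambda>j. \<rho> (?x j [^]\<^bsub>G\<^esub> i) u) {..<q}) {..<q}"
      unfolding orbit_sum_def by (rule M.finsum_swap) (use a b u(1) act_closed in auto)
    also have "\<dots> = finsum V (\<lambda>i. if 0 = i then ([q] \<cdot>\<^bsub>k\<^esub> \<one>\<^bsub>k\<^esub>) \<odot>\<^bsub>V\<^esub> u else \<zero>\<^bsub>V\<^esub>) {..<q}"
    proof (rule M.finsum_cong')
      fix i assume i: "i \<in> {..<q}"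
      have "finsum V (\<lambda>j. \<rho> (?x j [^]\<^bsub>G\<^esub> i) u) {..<q} = \<rho> (b [^]\<^bsub>G\<^esub> i) (orbit_sum (?y i) q u)"
        unfolding orbit_sum_def swap
        by (rule act_finsum[symmetric]) (use a b u(1) act_closed in auto)
      also have "\<dots> = (if 0 = i then ([q] \<cdot>\<^bsub>k\<^esub> \<one>\<^bsub>k\<^esub>) \<odot>\<^bsub>V\<^esub> u else \<zero>\<^bsub>V\<^esub>)"
        using y0[of i] i b u(1) orbit_sum_fixed[of "\<one>\<^bsub>G\<^esub>" u q] by (auto simp: act_zero act_one)
      finally show "finsum V (\<lambda>j. \<rho> (?x j [^]\<^bsub>G\<^esub> i) u) {..<q} =
        (if 0 = i then ([q] \<cdot>\<^bsub>k\<^esub> \<one>\<^bsub>k\<^esub>) \<odot>\<^bsub>V\<^esub> u else \<zero>\<^bsub>V\<^esub>)" .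
    qed (use u(1) in auto)
    also have "\<dots> = ([q] \<cdot>\<^bsub>k\<^esub> \<one>\<^bsub>k\<^esub>) \<odot>\<^bsub>V\<^esub> u"
      using M.finsum_singleton[of 0 "{..<q}" "\<lambda>i. ([q] \<cdot>\<^bsub>k\<^esub> \<one>\<^bsub>k\<^esub>) \<odot>\<^bsub>V\<^esub> u"] q0 u(1) by simp
    finally have "([q] \<cdot>\<^bsub>k\<^esub> \<one>\<^bsub>k\<^esub>) \<odot>\<^bsub>V\<^esub> u = \<zero>\<^bsub>V\<^esub>" by simp
    moreover have "[q] \<cdot>\<^bsub>k\<^esub> \<one>\<^bsub>k\<^esub> \<noteq> \<zero>\<^bsub>k\<^esub>"
      by (rule G.layer_prime_nonzero_in_field[OF field_axioms tor G.subgroup_self C _ q a aC])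
         (use char in simp)
    ultimately show False using smult_eq_zero[of "[q] \<cdot>\<^bsub>k\<^esub> \<one>\<^bsub>k\<^esub>" u] u by simp
  qed
qed

end

section \<open>From a faithful irreducible module to a core-free subgroup\<close>

context group_representation
begin

text \<open>A list of pairs \<open>(x, n)\<close> stands for the product of the operators \<open>1 + x + \<dots> + x\<^sup>n\<^sup>-\<^sup>1\<close>. Carrying the
exponent \<open>n\<close> along, instead of taking the order of \<open>x\<close>, makes conjugation act on such lists directly.\<close>

definition orbit_sums :: "('g \<times> nat) list \<Rightarrow> 'v \<Rightarrow> 'v" where
  "orbit_sums xs = foldr (\<lambda>(x, n). orbit_sum x n) xs"

lemma orbit_sums_simps [simp]:
  "orbit_sums [] v = v"
  "orbit_sums ((x, n) # xs) v = orbit_sum x n (orbit_sums xs v)"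
  "orbit_sums (xs @ ys) v = orbit_sums xs (orbit_sums ys v)"
  by (simp_all add: orbit_sums_def)

lemma orbit_sums_closed:
  "fst ` set xs \<subseteq> carrier G \<Longrightarrow> v \<in> carrier V \<Longrightarrow> orbit_sums xs v \<in> carrier V"
  by (induction xs) (auto simp: orbit_sum_closed)

lemma orbit_sums_add:
  "fst ` set xs \<subseteq> carrier G \<Longrightarrow> v \<in> carrier V \<Longrightarrow> w \<in> carrier V \<Longrightarrow>
    orbit_sums xs (v \<oplus>\<^bsub>V\<^esub> w) = orbit_sums xs v \<oplus>\<^bsub>V\<^esub> orbit_sums xs w"
  by (induction xs) (auto simp: orbit_sum_add orbit_sums_closed)

lemma orbit_sums_smult:
  "fst ` set xs \<subseteq> carrier G \<Longrightarrow> v \<in> carrier V \<Longrightarrow> c \<in> carrier k \<Longrightarrow>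
    orbit_sums xs (c \<odot>\<^bsub>V\<^esub> v) = c \<odot>\<^bsub>V\<^esub> orbit_sums xs v"
  by (induction xs) (auto simp: orbit_sum_smult orbit_sums_closed)

lemma orbit_sums_zero: "fst ` set xs \<subseteq> carrier G \<Longrightarrow> orbit_sums xs \<zero>\<^bsub>V\<^esub> = \<zero>\<^bsub>V\<^esub>"
  using orbit_sums_smult[of xs "\<zero>\<^bsub>V\<^esub>" "\<zero>\<^bsub>k\<^esub>"] orbit_sums_closed[of xs "\<zero>\<^bsub>V\<^esub>"] by simp

lemma orbit_sum_orbit_sum_commute:
  assumes "g \<in> carrier G" "h \<in> carrier G" "g \<otimes>\<^bsub>G\<^esub> h = h \<otimes>\<^bsub>G\<^esub> g" "v \<in> carrier V"
  shows "orbit_sum g m (orbit_sum h n v) = orbit_sum h n (orbit_sum g m v)"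
proof -
  interpret G: group G by (rule group_G)
  have pow: "h \<otimes>\<^bsub>G\<^esub> g [^]\<^bsub>G\<^esub> i = g [^]\<^bsub>G\<^esub> i \<otimes>\<^bsub>G\<^esub> h" for i :: nat
  proof (induction i)
    case (Suc i)
    have "h \<otimes>\<^bsub>G\<^esub> g [^]\<^bsub>G\<^esub> Suc i = (h \<otimes>\<^bsub>G\<^esub> g [^]\<^bsub>G\<^esub> i) \<otimes>\<^bsub>G\<^esub> g"
      using assms by (simp add: G.m_assoc)
    also have "\<dots> = g [^]\<^bsub>G\<^esub> i \<otimes>\<^bsub>G\<^esub> (g \<otimes>\<^bsub>G\<^esub> h)"
      unfolding Suc assms(3) using assms(1,2) by (simp add: G.m_assoc)
    finally show ?case using assms(1,2) by (simp add: G.m_assoc)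
  qed (use assms in simp)
  show ?thesis
  proof (induction m)
    case 0
    then show ?case
      using orbit_sum_smult[OF assms(2), of "\<zero>\<^bsub>V\<^esub>" "\<zero>\<^bsub>k\<^esub>"] orbit_sum_closed[OF assms(2), of "\<zero>\<^bsub>V\<^esub>"]
      by simp
  next
    case (Suc m)
    have "\<rho> (g [^]\<^bsub>G\<^esub> m) (orbit_sum h n v) = orbit_sum h n (\<rho> (g [^]\<^bsub>G\<^esub> m) v)"
      by (rule orbit_sum_commute) (use assms pow in auto)
    then show ?case
      using assms Suc
      by (simp add: orbit_sum_Suc orbit_sum_closed orbit_sum_add act_pow_closed)
  qed
qed

lemma orbit_sum_orbit_sums_commute:
  assumes "g \<in> carrier G" "fst ` set xs \<subseteq> carrier G"
    "\<And>x. x \<in> fst ` set xs \<Longrightarrow> g \<otimes>\<^bsub>G\<^esub> x = x \<otimes>\<^bsub>G\<^esub> g" "v \<in> carrier V"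
  shows "orbit_sum g n (orbit_sums xs v) = orbit_sums xs (orbit_sum g n v)"
  using assms(2,3)
proof (induction xs)
  case (Cons a xs)
  obtain x m where a: "a = (x, m)" by fastforce
  have x: "x \<in> carrier G" "g \<otimes>\<^bsub>G\<^esub> x = x \<otimes>\<^bsub>G\<^esub> g" and xs: "fst ` set xs \<subseteq> carrier G"
    using Cons.prems a by auto
  have "orbit_sum g n (orbit_sums (a # xs) v) = orbit_sum x m (orbit_sum g n (orbit_sums xs v))"
    using orbit_sum_orbit_sum_commute[OF assms(1) x orbit_sums_closed[OF xs assms(4)]] a by simp
  also have "orbit_sum g n (orbit_sums xs v) = orbit_sums xs (orbit_sum g n v)"
    using Cons by simp
  finally show ?case using a by simp
qed simp

lemma orbit_sums_commute:
  assumes "fst ` set xs \<subseteq> carrier G" "fst ` set ys \<subseteq> carrier G"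
    "\<And>x y. x \<in> fst ` set xs \<Longrightarrow> y \<in> fst ` set ys \<Longrightarrow> x \<otimes>\<^bsub>G\<^esub> y = y \<otimes>\<^bsub>G\<^esub> x" "v \<in> carrier V"
  shows "orbit_sums xs (orbit_sums ys v) = orbit_sums ys (orbit_sums xs v)"
  using assms(1,3)
proof (induction xs)
  case (Cons a xs)
  obtain x m where a: "a = (x, m)" by fastforce
  have x: "x \<in> carrier G" and xs: "fst ` set xs \<subseteq> carrier G" using Cons.prems a by auto
  have "orbit_sums (a # xs) (orbit_sums ys v) = orbit_sum x m (orbit_sums ys (orbit_sums xs v))"
  proof -
    have "orbit_sums xs (orbit_sums ys v) = orbit_sums ys (orbit_sums xs v)"
      by (rule Cons.IH[OF xs]) (use Cons.prems(2) in auto)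
    then show ?thesis using a by simp
  qed
  also have "\<dots> = orbit_sums ys (orbit_sum x m (orbit_sums xs v))"
    by (rule orbit_sum_orbit_sums_commute[OF x assms(2) _ orbit_sums_closed[OF xs assms(4)]])
       (use Cons.prems a in auto)
  finally show ?case using a by simp
qed simp

lemma orbit_sums_equivariant:
  assumes "fst ` set xs \<subseteq> carrier G" "h \<in> carrier G" "v \<in> carrier V"
  shows "\<rho> h (orbit_sums xs v) =
    orbit_sums (map (\<lambda>(x, n). (h \<otimes>\<^bsub>G\<^esub> x \<otimes>\<^bsub>G\<^esub> inv\<^bsub>G\<^esub> h, n)) xs) (\<rho> h v)"
  using assms(1)
proof (induction xs)
  case (Cons a xs)
  then show ?case
    using orbit_sum_equivariant[OF _ assms(2) orbit_sums_closed[of xs v]] assms(3) by (cases a) simp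
qed simp

lemma orbit_sum_restrict:
  assumes "subgroup H G"
  shows "group_representation.orbit_sum (G\<lparr>carrier := H\<rparr>) V \<rho> = orbit_sum"
  by (intro ext)
     (simp add: group_representation.orbit_sum_def[OF restrict_to_subgroup[OF assms]] orbit_sum_def nat_pow_def)

end

text \<open>On the image of \<open>v\<close>, which is fixed by \<open>N\<close>, each factor is multiplication by its exponent.\<close>

lemma (in representation_subquotient) proj_orbit_sums_nonzero:
  assumes xs: "\<And>x n. (x, n) \<in> set xs \<Longrightarrow> x \<in> N \<and> [(n::nat)] \<cdot>\<^bsub>k\<^esub> \<one>\<^bsub>k\<^esub> \<noteq> \<zero>\<^bsub>k\<^esub>"
    and N: "N \<subseteq> carrier G" and v: "v \<in> U" "\<pi> v \<noteq> \<zero>\<^bsub>X\<^esub>" "\<And>x. x \<in> N \<Longrightarrow> \<sigma> x (\<pi> v) = \<pi> v"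
  shows "\<pi> (V.orbit_sums xs v) \<noteq> \<zero>\<^bsub>X\<^esub>"
proof -
  have "V.orbit_sums xs v \<in> U \<and> \<pi> (V.orbit_sums xs v) \<noteq> \<zero>\<^bsub>X\<^esub> \<and>
      (\<forall>x \<in> N. \<sigma> x (\<pi> (V.orbit_sums xs v)) = \<pi> (V.orbit_sums xs v))"
    using xs
  proof (induction xs)
    case Nil
    then show ?case using v by simp
  next
    case (Cons a xs)
    obtain x n where a: "a = (x, n)" by fastforce
    let ?w = "V.orbit_sums xs v" and ?n = "[n] \<cdot>\<^bsub>k\<^esub> \<one>\<^bsub>k\<^esub>"
    have x: "x \<in> N" "x \<in> carrier G" "?n \<noteq> \<zero>\<^bsub>k\<^esub>" using Cons.prems a N by auto
    have w: "?w \<in> U" "\<pi> ?w \<noteq> \<zero>\<^bsub>X\<^esub>" "\<forall>x \<in> N. \<sigma> x (\<pi> ?w) = \<pi> ?w"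
      using Cons by auto
    have eq: "\<pi> (V.orbit_sums (a # xs) v) = ?n \<odot>\<^bsub>X\<^esub> \<pi> ?w"
      using a proj_orbit_sum[OF x(2) w(1)] X.orbit_sum_fixed[OF x(2) proj_closed[OF w(1)]] w(3) x(1)
      by simp
    have n: "?n \<in> carrier k" by simp
    have "?n \<odot>\<^bsub>X\<^esub> \<pi> ?w \<noteq> \<zero>\<^bsub>X\<^esub>"
      using X.smult_eq_zero[OF n x(3) proj_closed[OF w(1)]] w(2) by blast
    moreover have "V.orbit_sums (a # xs) v \<in> U" using V.orbit_sum_mem[OF subrep x(2) w(1)] a by simp
    moreover have "\<sigma> y (?n \<odot>\<^bsub>X\<^esub> \<pi> ?w) = ?n \<odot>\<^bsub>X\<^esub> \<pi> ?w" if "y \<in> N" for y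
    proof -
      have "y \<in> carrier G" using that N by blast
      then show ?thesis using X.act_smult[of y, OF _ n proj_closed[OF w(1)]] w(3) that by simp
    qed
    ultimately show ?case unfolding eq by blast
  qed
  then show ?thesis by blast
qed

text \<open>Let \<open>Z\<close> be the set of vectors killed by a product of operators \<open>1 + x + \<dots> + x\<^sup>n\<^sup>-\<^sup>1\<close> with \<open>x \<in> N\<close>,
\<open>x\<^sup>n = 1\<close> and \<open>n\<close> invertible in \<open>k\<close>. It is a submodule: the products commute, as \<open>N\<close> is abelian, and are
permuted by \<open>G\<close>, as \<open>N\<close> is normal. If some \<open>x \<in> N\<close> moves \<open>u\<close>, then \<open>x u - u\<close> is a nonzero element of
\<open>Z\<close>. So \<open>Z\<close> is everything and contains \<open>v\<close>, although no such product kills the image of \<open>v\<close>.\<close>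

theorem normal_subgroup_fixing_projection_trivial:
  assumes irr: "irreducible_representation k G V \<rho>" and faith: "faithful_representation k G V \<rho>"
    and tor: "torsion_group G" and A: "abelian_normal_subgroup G A"
    and char: "ring_characteristic k \<notin> torsion_primes (G\<lparr>carrier := A\<rparr>)"
    and sq: "representation_subquotient k (G\<lparr>carrier := A\<rparr>) V \<rho> X \<sigma> U \<pi>"
    and v: "v \<in> U" "\<pi> v \<noteq> \<zero>\<^bsub>X\<^esub>"
    and N: "N \<lhd> G" "N \<subseteq> A" "\<And>x. x \<in> N \<Longrightarrow> \<sigma> x (\<pi> v) = \<pi> v"
  shows "N = {\<one>\<^bsub>G\<^esub>}"
proof (rule ccontr)
  assume nontriv: "N \<noteq> {\<one>\<^bsub>G\<^esub>}"
  interpret V: group_representation k G V \<rho> using irr by (simp add: irreducible_representation_def)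
  interpret G: group G by (rule V.group_G)
  interpret Q: representation_subquotient k "G\<lparr>carrier := A\<rparr>" V \<rho> X \<sigma> U \<pi> by (rule sq)
  interpret N: normal N G by (rule N(1))
  have As: "subgroup A G" and Ac: "comm_group (G\<lparr>carrier := A\<rparr>)"
    using A normal_imp_subgroup by (auto simp: abelian_normal_subgroup_def)
  have comm: "x \<otimes>\<^bsub>G\<^esub> y = y \<otimes>\<^bsub>G\<^esub> x" if "x \<in> N" "y \<in> N" for x y
    using comm_monoid.m_comm[OF comm_group.axioms(1)[OF Ac], of x y] that N(2) by auto
  define L where "L = {(x, n). x \<in> N \<and> x [^]\<^bsub>G\<^esub> n = \<one>\<^bsub>G\<^esub> \<and> [(n::nat)] \<cdot>\<^bsub>k\<^esub> \<one>\<^bsub>k\<^esub> \<noteq> \<zero>\<^bsub>k\<^esub>}"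
  have fstL: "fst ` set xs \<subseteq> N" "fst ` set xs \<subseteq> carrier G" if "set xs \<subseteq> L" for xs
    using that by (auto simp: L_def)
  define Z where "Z = {u \<in> carrier V. \<exists>xs. set xs \<subseteq> L \<and> V.orbit_sums xs u = \<zero>\<^bsub>V\<^esub>}"
  have Z: "subrepresentation Z k G V \<rho>"
  proof (rule V.subrepresentationI)
    show "Z \<subseteq> carrier V" by (auto simp: Z_def)
    show "\<zero>\<^bsub>V\<^esub> \<in> Z" using V.orbit_sums_simps(1) by (auto simp: Z_def intro!: exI[of _ "[]"])
    fix u assume "u \<in> Z"
    then obtain xs where u: "u \<in> carrier V" and xs: "set xs \<subseteq> L" "V.orbit_sums xs u = \<zero>\<^bsub>V\<^esub>"
      by (auto simp: Z_def)
    show "c \<odot>\<^bsub>V\<^esub> u \<in> Z" if c: "c \<in> carrier k" for c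
      using V.orbit_sums_smult[OF fstL(2)[OF xs(1)] u c] u c xs by (auto simp: Z_def)
    show "\<rho> h u \<in> Z" if h: "h \<in> carrier G" for h
    proof -
      let ?ys = "map (\<lambda>(x, n). (h \<otimes>\<^bsub>G\<^esub> x \<otimes>\<^bsub>G\<^esub> inv\<^bsub>G\<^esub> h, n)) xs"
      have "set ?ys \<subseteq> L"
        using xs(1) h N.inv_op_closed2[OF h] by (auto simp: L_def G.conj_pow)
      moreover have "V.orbit_sums ?ys (\<rho> h u) = \<zero>\<^bsub>V\<^esub>"
        using V.orbit_sums_equivariant[OF fstL(2)[OF xs(1)] h u] xs(2) V.act_zero[OF h] by simp
      ultimately show ?thesis using V.act_closed[OF h u] unfolding Z_def by blast
    qed
    fix w assume "w \<in> Z"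
    then obtain ys where w: "w \<in> carrier V" and ys: "set ys \<subseteq> L" "V.orbit_sums ys w = \<zero>\<^bsub>V\<^esub>"
      by (auto simp: Z_def)
    note X = fstL[OF xs(1)] and Y = fstL[OF ys(1)]
    have "V.orbit_sums (xs @ ys) (u \<oplus>\<^bsub>V\<^esub> w) =
        V.orbit_sums xs (V.orbit_sums ys u) \<oplus>\<^bsub>V\<^esub> V.orbit_sums xs (V.orbit_sums ys w)"
      using u w X Y by (simp add: V.orbit_sums_add V.orbit_sums_closed)
    also have "V.orbit_sums xs (V.orbit_sums ys u) = V.orbit_sums ys (V.orbit_sums xs u)"
      by (rule V.orbit_sums_commute[OF X(2) Y(2) _ u]) (use X Y comm in blast)
    finally have "V.orbit_sums (xs @ ys) (u \<oplus>\<^bsub>V\<^esub> w) = \<zero>\<^bsub>V\<^esub>"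
      using xs ys X Y by (simp add: V.orbit_sums_zero)
    moreover have "set (xs @ ys) \<subseteq> L" using xs ys by simp
    ultimately show "u \<oplus>\<^bsub>V\<^esub> w \<in> Z" using u w unfolding Z_def by blast
  qed
  obtain x where x: "x \<in> N" "x \<noteq> \<one>\<^bsub>G\<^esub>" using nontriv N.one_closed by blast
  then obtain u where u: "u \<in> carrier V" "\<rho> x u \<noteq> u"
    using faith N.subset by (auto simp: faithful_representation_def)
  have xG: "x \<in> carrier G" using x(1) by simp
  have "(x, G.ord x) \<in> L"
    using x G.order_nonzero_in_field[OF V.field_axioms tor As char, of x] N(2) xG by (auto simp: L_def)
  moreover have "V.orbit_sums [(x, G.ord x)] (\<rho> x u \<ominus>\<^bsub>V\<^esub> u) = \<zero>\<^bsub>V\<^esub>"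
    using V.orbit_sum_annihilates(3)[OF xG u(1), of "G.ord x"] xG u(1) by (simp add: V.act_one)
  ultimately have "\<rho> x u \<ominus>\<^bsub>V\<^esub> u \<in> Z"
    using V.act_closed[OF xG u(1)] u(1) by (auto simp: Z_def intro!: exI[of _ "[(x, G.ord x)]"])
  moreover have "\<rho> x u \<ominus>\<^bsub>V\<^esub> u \<noteq> \<zero>\<^bsub>V\<^esub>" using u V.act_eq_add_diff[OF xG u(1)] by auto
  moreover have "Z = {\<zero>\<^bsub>V\<^esub>} \<or> Z = carrier V" using irr Z by (simp add: irreducible_representation_def)
  ultimately have "v \<in> Z" using v(1) Q.subrepE(1) by blast
  then obtain xs where xs: "set xs \<subseteq> L" "V.orbit_sums xs v = \<zero>\<^bsub>V\<^esub>" by (auto simp: Z_def)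
  have same: "Q.V.orbit_sums = V.orbit_sums"
    by (simp add: Q.V.orbit_sums_def V.orbit_sums_def V.orbit_sum_restrict[OF As] fun_eq_iff)
  have "\<pi> (Q.V.orbit_sums xs v) \<noteq> \<zero>\<^bsub>X\<^esub>"
    by (rule Q.proj_orbit_sums_nonzero[where N = N]) (use xs(1) N v in \<open>auto simp: L_def\<close>)
  then show False using xs(2) Q.proj_zero by (simp add: same)
qed

theorem faithful_irreducible_imp_core_free_subgroup:
  fixes k :: "('k, 'm) ring_scheme" and G :: "('g, 'n) monoid_scheme"
    and V :: "('k, 'v, 'l) module_scheme"
  assumes irr: "irreducible_representation k G V \<rho>" and faith: "faithful_representation k G V \<rho>"
    and tor: "torsion_group G" and A: "abelian_normal_subgroup G A"
    and char: "ring_characteristic k \<notin> torsion_primes (G\<lparr>carrier := A\<rparr>)"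
  shows "\<exists>C. subgroup C (G\<lparr>carrier := A\<rparr>) \<and> cyclic_prime_layers G A C \<and> normal_core G C = {\<one>\<^bsub>G\<^esub>}"
proof -
  interpret V: group_representation k G V \<rho> using irr by (simp add: irreducible_representation_def)
  interpret G: group G by (rule V.group_G)
  let ?A = "G\<lparr>carrier := A\<rparr>"
  have As: "subgroup A G" and Ac: "comm_group ?A"
    using A normal_imp_subgroup by (auto simp: abelian_normal_subgroup_def)
  interpret R: group_representation k ?A V \<rho> by (rule V.restrict_to_subgroup[OF As])
  obtain v where v: "v \<in> carrier V" "v \<noteq> \<zero>\<^bsub>V\<^esub>"
    using irr V.M.zero_closed by (auto simp: irreducible_representation_def)
  obtain X :: "('k, 'v set) module" and \<sigma> U \<pi> where
    sq: "representation_subquotient k ?A V \<rho> X \<sigma> U \<pi>" and Xirr: "irreducible_representation k ?A X \<sigma>"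
    and vU: "v \<in> U" "\<pi> v \<noteq> \<zero>\<^bsub>X\<^esub>"
    using R.ex_irreducible_subquotient[OF v] by blast
  interpret Q: representation_subquotient k ?A V \<rho> X \<sigma> U \<pi> by (rule sq)
  let ?C = "Q.X.action_kernel"
  have torA: "torsion_group ?A" by (rule torsion_group_subset[OF tor subgroup.subset[OF As]])
  have C: "subgroup ?C ?A" using Q.X.action_kernel_normal normal_imp_subgroup by blast
  then have CG: "subgroup ?C G" using G.incl_subgroup[OF As] by blast
  have "cyclic_prime_layers ?A A ?C"
    using Q.X.irreducible_abelian_cyclic_prime_layers[OF Xirr Ac torA char] by simp
  then have lay: "cyclic_prime_layers G A ?C" using G.cyclic_prime_layers_subgroup[OF As] by simp
  note core = G.normal_core_normal[OF CG]
  have "?C \<subseteq> A" by (auto simp: Q.X.action_kernel_def)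
  have "normal_core G ?C = {\<one>\<^bsub>G\<^esub>}"
  proof (rule normal_subgroup_fixing_projection_trivial[OF irr faith tor A char sq vU core(1)])
    show "normal_core G ?C \<subseteq> A" using core(2) \<open>?C \<subseteq> A\<close> by blast
    show "\<sigma> x (\<pi> v) = \<pi> v" if "x \<in> normal_core G ?C" for x
    proof -
      have "x \<in> ?C" using that core(2) by blast
      then show ?thesis using Q.proj_closed[OF vU(1)] by (simp add: Q.X.action_kernel_def)
    qed
  qed
  then show ?thesis using C lay by blast
qed

section \<open>A formal product over primes\<close>

lemma finsum_two:
  assumes "abelian_monoid M" "finite I" "i \<in> I" "j \<in> I" "i \<noteq> j"
    "\<And>l. l \<in> I \<Longrightarrow> f l \<in> carrier M" "\<And>l. l \<in> I \<Longrightarrow> l \<noteq> i \<Longrightarrow> l \<noteq> j \<Longrightarrow> f l = \<zero>\<^bsub>M\<^esub>"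
  shows "finsum M f I = f i \<oplus>\<^bsub>M\<^esub> f j"
proof -
  interpret abelian_monoid M by fact
  have "finsum M f {i, j} = finsum M f I"
    by (rule add.finprod_mono_neutral_cong_left) (use assms in auto)
  then show ?thesis using assms by simp
qed

locale prime_order_family = comm_group B for B (structure) +
  fixes P :: "nat set" and b :: "nat \<Rightarrow> 'a"
  assumes prime: "p \<in> P \<Longrightarrow> Factorial_Ring.prime p"
    and closed: "p \<in> P \<Longrightarrow> b p \<in> carrier B"
    and nontrivial: "p \<in> P \<Longrightarrow> b p \<noteq> \<one>"
    and pow_prime: "p \<in> P \<Longrightarrow> b p [^] p = \<one>"
begin

definition subproduct :: "nat set \<Rightarrow> 'a" where
  "subproduct S = finprod B b S"

definition finite_primes :: "nat set set" where
  "finite_primes = {S. finite S \<and> S \<subseteq> P}"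

lemma subproduct_closed: "S \<in> finite_primes \<Longrightarrow> subproduct S \<in> carrier B"
  unfolding subproduct_def finite_primes_def by (intro finprod_closed) (auto intro: closed)

lemma subproduct_insert:
  assumes "S \<in> finite_primes" "p \<in> P" "p \<notin> S"
  shows "subproduct (insert p S) = b p \<otimes> subproduct S"
  using assms unfolding subproduct_def finite_primes_def
  by (intro finprod_insert) (auto intro: closed)

lemma subproduct_pow_eq_one:
  assumes "S \<in> finite_primes" "\<And>p. p \<in> S \<Longrightarrow> b p [^] (m::nat) = \<one>"
  shows "subproduct S [^] m = \<one>"
proof -
  have "finite S" using assms(1) by (simp add: finite_primes_def)
  then show ?thesis
    using assms
  proof (induction S)
    case empty
    then show ?case by (simp add: subproduct_def)
  next
    case (insert p S)
    then have "S \<in> finite_primes" "p \<in> P" by (auto simp: finite_primes_def)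
    then show ?case
      using insert by (simp add: subproduct_insert nat_pow_distrib closed subproduct_closed)
  qed
qed

text \<open>Raising to the power of \<open>n\<close> times all primes of \<open>S \<union> T\<close> other than \<open>r\<close> kills everything but the factor
\<open>b\<^sub>r\<close> of the left-hand side, and that power is prime to the order \<open>r\<close> of \<open>b\<^sub>r\<close>.\<close>

lemma subproduct_separated:
  assumes S: "S \<in> finite_primes" and T: "T \<in> finite_primes" and r: "r \<in> S" "r \<notin> T"
    and y: "y \<in> carrier B" "y [^] (n::nat) = \<one>" "coprime r n"
  shows "subproduct S \<noteq> subproduct T \<otimes> y"
proof
  assume eq: "subproduct S = subproduct T \<otimes> y"
  have fin: "finite S" "finite T" and sub: "S \<subseteq> P" "T \<subseteq> P"
    using S T by (auto simp: finite_primes_def)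
  let ?M = "(S - {r}) \<union> T"
  define m where "m = \<Prod>?M * n"
  have rP: "r \<in> P" using r sub by blast
  have pow: "z [^] m = \<one>" if "z \<in> carrier B" "z [^] l = \<one>" "l dvd m" for z and l :: nat
    using that pow_eq_id by (meson dvd_trans)
  have dvd: "p dvd m" if "p \<in> ?M" for p
    using dvd_prodI[of ?M p "\<lambda>p. p"] fin that by (simp add: m_def dvd_mult2)
  have one: "subproduct W [^] m = \<one>" if "W \<in> finite_primes" "W \<subseteq> ?M" for W
    by (rule subproduct_pow_eq_one[OF that(1)])
       (use that sub in \<open>auto intro!: pow[OF closed pow_prime] dvd simp: finite_primes_def\<close>)
  have Sr: "S - {r} \<in> finite_primes" using S by (auto simp: finite_primes_def)
  have "subproduct S = b r \<otimes> subproduct (S - {r})"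
    using subproduct_insert[OF Sr rP] r(1) by (simp add: insert_absorb)
  then have "subproduct S [^] m = b r [^] m"
    using one[OF Sr] rP by (simp add: nat_pow_distrib closed subproduct_closed[OF Sr])
  moreover have "(subproduct T \<otimes> y) [^] m = \<one>"
    using one[OF T] y(1) pow[OF y(1,2)] subproduct_closed[OF T] by (simp add: nat_pow_distrib m_def)
  ultimately have br: "b r [^] m = \<one>" using eq by simp
  have "coprime r m"
  proof -
    have "coprime r p" if "p \<in> ?M" for p
      using that r sub prime[OF rP] prime primes_coprime by blast
    then have "coprime r (\<Prod>?M)" by (intro prod_coprime_right) auto
    then show ?thesis using y(3) by (simp add: m_def)
  qed
  moreover have "subgroup {\<one>} B" by (rule triv_subgroup)
  ultimately have "b r \<in> {\<one>}"
    using mem_of_coprime_powers[of "{\<one>}" "b r" r m] closed[OF rP] pow_prime[OF rP] br by simp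
  then show False using nontrivial[OF rP] by simp
qed

lemma subproduct_inj: "inj_on subproduct finite_primes"
proof (rule inj_onI)
  fix S T assume ST: "S \<in> finite_primes" "T \<in> finite_primes" "subproduct S = subproduct T"
  have "S' \<subseteq> T'" if "S' \<in> finite_primes" "T' \<in> finite_primes" "subproduct S' = subproduct T'" for S' T'
    using that subproduct_separated[of S' T' _ \<one> 1] subproduct_closed[of T'] by auto
  then show "S = T" using ST by (metis subset_antisym)
qed

lemma subproduct_eq_mod_prime:
  assumes S: "S \<in> finite_primes" and T: "T \<in> finite_primes" and q: "q \<in> P"
    and eq: "subproduct S = subproduct T \<otimes> b q [^] (i::nat)"
  shows "S - {q} = T - {q}"
proof -
  have sub: "S \<subseteq> P" "T \<subseteq> P" using S T by (auto simp: finite_primes_def)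
  have bq: "b q \<in> carrier B" by (rule closed[OF q])
  have pw: "(b q [^] (j::nat)) [^] q = \<one>" for j
  proof -
    have "(b q [^] j) [^] q = (b q [^] q) [^] j" using bq by (simp add: nat_pow_pow mult.commute)
    then show ?thesis using pow_prime[OF q] by simp
  qed
  have cop: "coprime r q" if "r \<in> P" "r \<noteq> q" for r
    using that prime q primes_coprime by blast
  have "b q [^] i \<otimes> b q [^] (i * (q - 1)) = (b q [^] q) [^] i"
    using bq prime_gt_0_nat[OF prime[OF q]] by (simp add: nat_pow_mult nat_pow_pow algebra_simps)
  then have "b q [^] i \<otimes> b q [^] (i * (q - 1)) = \<one>" using pow_prime[OF q] by simp
  then have eq': "subproduct T = subproduct S \<otimes> b q [^] (i * (q - 1))"
    using bq subproduct_closed[OF T] unfolding eq by (simp add: m_assoc)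
  have "r \<in> T" if "r \<in> S" "r \<noteq> q" for r
    using subproduct_separated[OF S T that(1) _ _ pw[of i]] cop[of r] that sub bq eq by auto
  moreover have "r \<in> S" if "r \<in> T" "r \<noteq> q" for r
    using subproduct_separated[OF T S that(1) _ _ pw[of "i * (q - 1)"]] cop[of r] that sub bq eq' by auto
  ultimately show ?thesis by blast
qed

text \<open>The infinite product of the factors \<open>1 - b\<^sub>p\<close>, as a function on \<open>B\<close>: expanding it formally, the
product of the \<open>b\<^sub>p\<close> with \<open>p \<in> S\<close> gets the coefficient \<open>(-1)\<^sup>|\<^sup>S\<^sup>|\<close> for every finite \<open>S \<subseteq> P\<close>, and all
other elements get 0.\<close>

definition alternating :: "('k, 'm) ring_scheme \<Rightarrow> 'a \<Rightarrow> 'k" where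
  "alternating k x = (if x \<in> subproduct ` finite_primes
     then (\<ominus>\<^bsub>k\<^esub> \<one>\<^bsub>k\<^esub>) [^]\<^bsub>k\<^esub> card (inv_into finite_primes subproduct x) else \<zero>\<^bsub>k\<^esub>)"

lemma alternating_subproduct:
  "S \<in> finite_primes \<Longrightarrow> alternating k (subproduct S) = (\<ominus>\<^bsub>k\<^esub> \<one>\<^bsub>k\<^esub>) [^]\<^bsub>k\<^esub> card S"
  by (simp add: alternating_def inv_into_f_f[OF subproduct_inj])

lemma alternating_one: "alternating k \<one> = \<one>\<^bsub>k\<^esub>"
proof -
  have e: "{} \<in> finite_primes" "subproduct {} = \<one>" by (simp_all add: finite_primes_def subproduct_def)
  then show ?thesis using alternating_subproduct[OF e(1)] by simp
qed

lemma alternating_closed: "cring k \<Longrightarrow> alternating k x \<in> carrier k"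
proof -
  assume "cring k"
  then interpret k: cring k .
  show ?thesis by (simp add: alternating_def)
qed

text \<open>This is \<open>(1 + b\<^sub>q + \<dots> + b\<^sub>q\<^sup>q\<^sup>-\<^sup>1)(1 - b\<^sub>q) = 0\<close>. A coset of the group generated by \<open>b\<^sub>q\<close> that meets the
support meets it in exactly two points, given by a finite set without \<open>q\<close> and the same set with \<open>q\<close>
added, whose values cancel.\<close>

lemma alternating_sum_over_prime_coset:
  assumes k: "cring k" and q: "q \<in> P" and x: "x \<in> carrier B"
  shows "finsum k (\<lambda>i. alternating k (b q [^] (i::nat) \<otimes> x)) {..<q} = \<zero>\<^bsub>k\<^esub>"
proof (cases "\<exists>i::nat. b q [^] i \<otimes> x \<in> subproduct ` finite_primes")
  case False
  interpret k: cring k by (rule k)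
  show ?thesis using False by (simp add: alternating_def)
next
  case True
  interpret k: cring k by (rule k)
  have bq: "b q \<in> carrier B" by (rule closed[OF q])
  have qp: "Factorial_Ring.prime q" by (rule prime[OF q])
  have q1: "1 < q" by (rule prime_gt_1_nat[OF qp])
  have per: "b q [^] (i mod q) = b q [^] i" for i :: nat
  proof -
    have "b q [^] i = (b q [^] q) [^] (i div q) \<otimes> b q [^] (i mod q)"
      using bq by (simp add: nat_pow_pow nat_pow_mult)
    then show ?thesis using pow_prime[OF q] bq by simp
  qed
  have ordq: "ord (b q) = q"
  proof -
    have "ord (b q) dvd q" using pow_eq_id[OF bq] pow_prime[OF q] by blast
    moreover have "ord (b q) \<noteq> 1" using ord_eq_1[OF bq] nontrivial[OF q] by blast
    ultimately show ?thesis using qp by (auto simp: prime_nat_iff)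
  qed
  obtain i0 S where S: "S \<in> finite_primes" and i0: "b q [^] (i0::nat) \<otimes> x = subproduct S"
    using True by blast
  let ?S0 = "S - {q}" and ?S1 = "insert q S"
  have S0: "?S0 \<in> finite_primes" and S1: "?S1 \<in> finite_primes"
    using S q by (auto simp: finite_primes_def)
  have S01: "subproduct ?S1 = b q \<otimes> subproduct ?S0"
    using subproduct_insert[OF S0 q] by simp
  have qpred: "b q [^] (q - 1) \<otimes> b q = \<one>"
    using pow_prime[OF q] q1 by (metis Suc_pred' less_trans nat_pow_Suc zero_less_one)
  have "\<exists>i::nat. b q [^] i \<otimes> x = subproduct ?S0"
  proof (cases "q \<in> S")
    case True
    then have "b q [^] i0 \<otimes> x = b q \<otimes> subproduct ?S0" using i0 S01 by (simp add: insert_absorb)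
    then have "b q [^] (q - 1) \<otimes> (b q [^] i0 \<otimes> x) = (b q [^] (q - 1) \<otimes> b q) \<otimes> subproduct ?S0"
      using bq subproduct_closed[OF S0] by (simp add: m_assoc)
    then have "b q [^] (q - 1 + i0) \<otimes> x = subproduct ?S0"
      using qpred bq x subproduct_closed[OF S0] by (simp add: m_assoc[symmetric] nat_pow_mult)
    then show ?thesis by blast
  next
    case False
    then show ?thesis using i0 by auto
  qed
  then obtain j where "b q [^] (j::nat) \<otimes> x = subproduct ?S0" by blast
  then have j: "b q [^] (j mod q) \<otimes> x = subproduct ?S0" by (simp add: per)
  have j1: "b q [^] (Suc j mod q) \<otimes> x = subproduct ?S1"
    using bq x \<open>b q [^] j \<otimes> x = subproduct ?S0\<close>
    unfolding S01 per nat_pow_Suc2[OF bq] by (simp add: m_assoc)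
  have uniq: "i = i'" if "i < q" "i' < q" "b q [^] i = b q [^] i'" for i i' :: nat
    using ord_inj[OF bq] that q1 unfolding ordq by (auto simp: inj_on_def)
  have ne: "j mod q \<noteq> Suc j mod q"
  proof
    assume "j mod q = Suc j mod q"
    then have "b q [^] j = b q [^] Suc j" using per by metis
    then have "b q = \<one>" using bq by (metis l_cancel_one' nat_pow_Suc nat_pow_closed)
    then show False using nontrivial[OF q] by blast
  qed
  have other: "alternating k (b q [^] i \<otimes> x) = \<zero>\<^bsub>k\<^esub>"
    if i: "i < q" "i \<noteq> j mod q" "i \<noteq> Suc j mod q" for i
  proof (rule ccontr)
    assume "alternating k (b q [^] i \<otimes> x) \<noteq> \<zero>\<^bsub>k\<^esub>"
    then obtain T where T: "T \<in> finite_primes" "b q [^] i \<otimes> x = subproduct T"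
      by (auto simp: alternating_def split: if_splits)
    define d where "d = q - j mod q + i"
    have "j mod q < q" using q1 by simp
    then have "d + j mod q = q + i" by (simp add: d_def)
    then have "b q [^] d \<otimes> b q [^] (j mod q) = b q [^] q \<otimes> b q [^] i"
      using bq by (simp add: nat_pow_mult del: per)
    then have "b q [^] d \<otimes> (b q [^] (j mod q) \<otimes> x) = b q [^] i \<otimes> x"
      using bq x pow_prime[OF q] by (simp add: m_assoc[symmetric])
    then have "subproduct T = subproduct ?S0 \<otimes> b q [^] d"
      using T(2) j bq subproduct_closed[OF S0] by (simp add: m_comm)
    then have "T - {q} = ?S0" using subproduct_eq_mod_prime[OF T(1) S0 q] by simp
    then have "T = ?S0 \<or> T = ?S1" by blast
    then have "b q [^] i \<otimes> x = b q [^] (j mod q) \<otimes> x \<or> b q [^] i \<otimes> x = b q [^] (Suc j mod q) \<otimes> x"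
      using T(2) j j1 by auto
    then have "b q [^] i = b q [^] (j mod q) \<or> b q [^] i = b q [^] (Suc j mod q)"
      using bq x by (simp del: per)
    then show False using uniq i q1 by (meson mod_less_divisor less_trans zero_less_one)
  qed
  have "finsum k (\<lambda>i. alternating k (b q [^] i \<otimes> x)) {..<q} =
      alternating k (b q [^] (j mod q) \<otimes> x) \<oplus>\<^bsub>k\<^esub> alternating k (b q [^] (Suc j mod q) \<otimes> x)"
    by (rule finsum_two) (use q1 ne other alternating_closed[OF k] k.abelian_monoid_axioms in auto)
  also have "\<dots> = (\<ominus>\<^bsub>k\<^esub> \<one>\<^bsub>k\<^esub>) [^]\<^bsub>k\<^esub> card ?S0 \<oplus>\<^bsub>k\<^esub> (\<ominus>\<^bsub>k\<^esub> \<one>\<^bsub>k\<^esub>) [^]\<^bsub>k\<^esub> card ?S1"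
    unfolding j j1 alternating_subproduct[OF S0] alternating_subproduct[OF S1] ..
  also have "card ?S1 = Suc (card ?S0)"
    using S by (simp add: finite_primes_def card.insert_remove)
  finally show ?thesis by (simp add: k.r_minus k.r_neg)
qed

end

section \<open>From a core-free subgroup to a faithful irreducible module\<close>

definition function_module :: "('k, 'm) ring_scheme \<Rightarrow> ('k, 'g \<Rightarrow> 'k) module" where
  "function_module k = \<lparr>carrier = {f. range f \<subseteq> carrier k}, monoid.mult = undefined, one = undefined,
     zero = (\<lambda>_. \<zero>\<^bsub>k\<^esub>), add = (\<lambda>f h x. f x \<oplus>\<^bsub>k\<^esub> h x), smult = (\<lambda>c f x. c \<otimes>\<^bsub>k\<^esub> f x)\<rparr>"

text \<open>The functions are defined on the whole type; outside the carrier, where no translation makes sense,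
they are left alone.\<close>

definition left_translation ::
  "('k, 'm) ring_scheme \<Rightarrow> ('g, 'n) monoid_scheme \<Rightarrow> 'g \<Rightarrow> ('g \<Rightarrow> 'k) \<Rightarrow> 'g \<Rightarrow> 'k" where
  "left_translation k G g = (\<lambda>f \<in> carrier (function_module k).
     \<lambda>x. f (if x \<in> carrier G then inv\<^bsub>G\<^esub> g \<otimes>\<^bsub>G\<^esub> x else x))"

lemma function_module_simps [simp]:
  "f \<in> carrier (function_module k) \<longleftrightarrow> (\<forall>x. f x \<in> carrier k)"
  "\<zero>\<^bsub>function_module k\<^esub> = (\<lambda>_. \<zero>\<^bsub>k\<^esub>)"
  "f \<oplus>\<^bsub>function_module k\<^esub> h = (\<lambda>x. f x \<oplus>\<^bsub>k\<^esub> h x)"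
  "c \<odot>\<^bsub>function_module k\<^esub> f = (\<lambda>x. c \<otimes>\<^bsub>k\<^esub> f x)"
  by (auto simp: function_module_def)

lemma left_translation_apply:
  "\<forall>x. f x \<in> carrier k \<Longrightarrow>
    left_translation k G g f x = f (if x \<in> carrier G then inv\<^bsub>G\<^esub> g \<otimes>\<^bsub>G\<^esub> x else x)"
  by (simp add: left_translation_def)

lemma function_module_module:
  assumes "cring k" shows "Module.module k (function_module k)"
proof -
  interpret k: cring k by fact
  have "abelian_group (function_module k)"
  proof (rule abelian_groupI)
    show "\<exists>h \<in> carrier (function_module k). h \<oplus>\<^bsub>function_module k\<^esub> f = \<zero>\<^bsub>function_module k\<^esub>"
      if "f \<in> carrier (function_module k)" for f
      by (rule bexI[of _ "\<lambda>x. \<ominus>\<^bsub>k\<^esub> f x"]) (use that in \<open>auto simp: k.l_neg\<close>)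
  qed (auto simp: k.a_ac)
  then show ?thesis
    by (rule moduleI[OF assms]) (auto simp: k.l_distr k.r_distr k.m_assoc)
qed

lemma left_translation_representation:
  fixes k :: "('k, 'm) ring_scheme" and G :: "('g, 'n) monoid_scheme"
  assumes "field k" "group G"
  shows "group_representation k G (function_module k) (left_translation k G)"
proof -
  interpret k: field k by fact
  interpret G: group G by fact
  show ?thesis
  proof (rule group_representationI[OF assms(1) function_module_module[OF k.is_cring] assms(2)])
    show "left_translation k G g \<in> extensional (carrier (function_module k))" for g
      by (simp add: left_translation_def)
  qed (auto simp: left_translation_apply fun_eq_iff G.inv_mult_group G.m_assoc)
qed

lemma finsum_function_module:
  assumes "cring k" "finite I" "\<And>i x. i \<in> I \<Longrightarrow> F i x \<in> carrier k"
  shows "finsum (function_module k) F I x = finsum k (\<lambda>i. F i x) I"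
proof -
  interpret k: cring k by fact
  interpret Module.module k "function_module k" by (rule function_module_module[OF assms(1)])
  show ?thesis
    using assms(2,3)
  proof (induction I)
    case (insert i I)
    then have "F \<in> I \<rightarrow> carrier (function_module k)" "F i \<in> carrier (function_module k)" by auto
    then have "finsum (function_module k) F (insert i I) = F i \<oplus>\<^bsub>function_module k\<^esub> finsum (function_module k) F I"
      using insert.hyps by (simp add: M.finsum_insert del: function_module_simps)
    moreover have "(\<lambda>i. F i x) \<in> I \<rightarrow> carrier k" "F i x \<in> carrier k" using insert.prems by auto
    ultimately show ?case using insert by simp
  qed simp
qed

text \<open>The function \<open>\<phi>\<close> on \<open>A\<close>, extended by zero to \<open>G\<close>, is the formal product of the \<open>1 - b\<^sub>q\<close> over the primes
\<open>q\<close> for which \<open>A/C\<close> has an element \<open>b\<^sub>q C\<close> of order \<open>q\<close>. It survives in an irreducible module on which an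
element of \<open>A\<close> can act trivially only if it belongs to \<open>C\<close>.\<close>

theorem core_free_subgroup_imp_faithful_irreducible:
  fixes k :: "('k, 'm) ring_scheme" and G :: "('g, 'n) monoid_scheme"
  assumes k: "field k" and G: "group G" and tor: "torsion_group G" and sol: "solvable G"
    and max: "maximal_abelian_normal_subgroup G A"
    and char: "ring_characteristic k \<notin> torsion_primes (G\<lparr>carrier := A\<rparr>)"
    and C: "subgroup C (G\<lparr>carrier := A\<rparr>)" and lay: "cyclic_prime_layers G A C"
    and core: "normal_core G C = {\<one>\<^bsub>G\<^esub>}"
  shows "has_faithful_irreducible_representation k G"
proof -
  interpret k: field k by (rule k)
  interpret G: group G by (rule G)
  let ?A = "G\<lparr>carrier := A\<rparr>"
  have An: "A \<lhd> G" and Ac: "comm_group ?A"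
    using max by (simp_all add: maximal_abelian_normal_subgroup_def abelian_normal_subgroup_def)
  have As: "subgroup A G" by (rule normal_imp_subgroup[OF An])
  interpret A: comm_group ?A by (rule Ac)
  interpret C: normal C ?A using A.subgroup_imp_normal[OF C] .
  interpret Q: comm_group "?A Mod C" by (rule A.abelian_FactGroup[OF C])
  have AG: "x \<in> carrier G" if "x \<in> A" for x using As that subgroup.mem_carrier by metis
  have CA: "x \<in> A" if "x \<in> C" for x using C.subset that by auto
  have CG: "subgroup C G" using G.incl_subgroup[OF As C] .
  have commA: "x \<otimes>\<^bsub>G\<^esub> y = y \<otimes>\<^bsub>G\<^esub> x" if "x \<in> A" "y \<in> A" for x y
    using A.m_comm[of x y] that by simp
  have invA: "inv\<^bsub>G\<^esub> x \<in> A" if "x \<in> A" for x by (rule subgroup.m_inv_closed[OF As that])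
  have multA: "x \<otimes>\<^bsub>G\<^esub> y \<in> A" if "x \<in> A" "y \<in> A" for x y by (rule subgroup.m_closed[OF As that])
  have powA: "x [^]\<^bsub>G\<^esub> (n::nat) \<in> A" if "x \<in> A" for x n
    using G.subgroup_nat_pow_closed[OF As that, of "n"] by simp
  define P where "P = {q::nat. Factorial_Ring.prime q \<and> (\<exists>a \<in> A. a \<notin> C \<and> a [^]\<^bsub>G\<^esub> q \<in> C)}"
  have "\<forall>q \<in> P. \<exists>a \<in> A. a \<notin> C \<and> a [^]\<^bsub>G\<^esub> q \<in> C" by (simp add: P_def)
  then obtain b where b: "\<And>q. q \<in> P \<Longrightarrow> b q \<in> A" "\<And>q. q \<in> P \<Longrightarrow> b q \<notin> C"
    "\<And>q. q \<in> P \<Longrightarrow> b q [^]\<^bsub>G\<^esub> q \<in> C"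
    by metis
  define cs where "cs x = C #>\<^bsub>?A\<^esub> x" for x
  have cs_C: "cs x = C \<longleftrightarrow> x \<in> C" if "x \<in> A" for x
    unfolding cs_def using that C.rcos_const[OF A.is_group, of x] A.rcos_self[of x C] C.is_subgroup by auto
  have cs_closed: "cs x \<in> carrier (?A Mod C)" if "x \<in> A" for x
    using that by (simp add: cs_def carrier_FactGroup)
  have cs_mult: "cs x \<otimes>\<^bsub>?A Mod C\<^esub> cs y = cs (x \<otimes>\<^bsub>G\<^esub> y)" if "x \<in> A" "y \<in> A" for x y
    using C.rcos_sum[of x y] that by (simp add: cs_def)
  have cs_pow: "cs x [^]\<^bsub>?A Mod C\<^esub> n = cs (x [^]\<^bsub>G\<^esub> n)" if "x \<in> A" for x and n :: nat
    using C.FactGroup_pow[of x n] that by (simp add: cs_def nat_pow_def)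
  interpret F: prime_order_family "?A Mod C" P "\<lambda>q. cs (b q)"
    by unfold_locales (use b cs_closed cs_C cs_pow powA in \<open>auto simp: P_def\<close>)
  define \<phi> where "\<phi> x = (if x \<in> A then F.alternating k (cs x) else \<zero>\<^bsub>k\<^esub>)" for x
  have \<phi>: "\<phi> x \<in> carrier k" for x using F.alternating_closed[OF k.is_cring] by (simp add: \<phi>_def)
  let ?V = "function_module k :: ('k, 'g \<Rightarrow> 'k) module" and ?\<rho> = "left_translation k G"
  interpret V: group_representation k G ?V ?\<rho> by (rule left_translation_representation[OF k G])
  have \<phi>V: "\<phi> \<in> carrier ?V" using \<phi> by simp
  have "\<phi> \<one>\<^bsub>G\<^esub> = \<one>\<^bsub>k\<^esub>"
    using F.alternating_one[of k] cs_C[of "\<one>\<^bsub>G\<^esub>"] subgroup.one_closed[OF As] subgroup.one_closed[OF CG]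
    by (simp add: \<phi>_def)
  then have "\<phi> \<noteq> \<zero>\<^bsub>?V\<^esub>" by auto
  have fix_C: "?\<rho> c \<phi> = \<phi>" if c: "c \<in> C" for c
  proof
    fix x
    have cA: "inv\<^bsub>G\<^esub> c \<in> A" "inv\<^bsub>G\<^esub> c \<in> C" "c \<in> carrier G"
      using c CA AG invA subgroup.m_inv_closed[OF CG] by auto
    have mem: "inv\<^bsub>G\<^esub> c \<otimes>\<^bsub>G\<^esub> x \<in> A \<longleftrightarrow> x \<in> A" if "x \<in> carrier G"
    proof
      assume "inv\<^bsub>G\<^esub> c \<otimes>\<^bsub>G\<^esub> x \<in> A"
      then have "c \<otimes>\<^bsub>G\<^esub> (inv\<^bsub>G\<^esub> c \<otimes>\<^bsub>G\<^esub> x) \<in> A" using multA c CA by blast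
      then show "x \<in> A" using that cA by (simp add: G.m_assoc[symmetric])
    qed (use multA cA in blast)
    have "cs (inv\<^bsub>G\<^esub> c \<otimes>\<^bsub>G\<^esub> x) = cs x" if "x \<in> A"
    proof -
      have "cs (inv\<^bsub>G\<^esub> c) = \<one>\<^bsub>?A Mod C\<^esub>" using cs_C cA by simp
      then show ?thesis using cs_mult[OF cA(1) that] cs_closed[OF that] by (metis Q.l_one)
    qed
    then show "?\<rho> c \<phi> x = \<phi> x" using mem AG \<phi> by (auto simp: left_translation_apply \<phi>_def)
  qed
  \<comment> \<open>Translation by \<open>g\<close> evaluates at \<open>g\<^sup>-\<^sup>1 x\<close>, so the inverse of \<open>b\<^sub>q\<close> turns up here.\<close>
  have sum_zero: "V.orbit_sum (inv\<^bsub>G\<^esub> (b q)) q \<phi> = \<zero>\<^bsub>?V\<^esub>" if q: "q \<in> P" for q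
  proof
    fix x
    have bq: "b q \<in> A" "b q \<in> carrier G" using b(1)[OF q] AG by auto
    have inv_inv: "inv\<^bsub>G\<^esub> (inv\<^bsub>G\<^esub> (b q) [^]\<^bsub>G\<^esub> i) = b q [^]\<^bsub>G\<^esub> i" for i :: nat
      using bq(2) by (simp add: G.nat_pow_inv)
    have summand: "?\<rho> (inv\<^bsub>G\<^esub> (b q) [^]\<^bsub>G\<^esub> i) \<phi> x =
        (if x \<in> A then F.alternating k (cs (b q) [^]\<^bsub>?A Mod C\<^esub> i \<otimes>\<^bsub>?A Mod C\<^esub> cs x) else \<zero>\<^bsub>k\<^esub>)" for i :: nat
    proof (cases "x \<in> A")
      case True
      then show ?thesis
        using AG[OF True] multA[OF powA[OF bq(1)] True] \<phi> cs_pow[OF bq(1)] cs_mult[OF powA[OF bq(1)] True]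
        by (simp add: left_translation_apply \<phi>_def inv_inv)
    next
      case False
      have "b q [^]\<^bsub>G\<^esub> i \<otimes>\<^bsub>G\<^esub> x \<notin> A" if x: "x \<in> carrier G"
      proof
        assume "b q [^]\<^bsub>G\<^esub> i \<otimes>\<^bsub>G\<^esub> x \<in> A"
        then have "inv\<^bsub>G\<^esub> (b q [^]\<^bsub>G\<^esub> i) \<otimes>\<^bsub>G\<^esub> (b q [^]\<^bsub>G\<^esub> i \<otimes>\<^bsub>G\<^esub> x) \<in> A"
          using multA invA powA[OF bq(1)] by blast
        then show False using False x bq(2) by (simp add: G.m_assoc[symmetric])
      qed
      then show ?thesis using False \<phi> by (simp add: left_translation_apply \<phi>_def inv_inv)
    qed
    have "V.orbit_sum (inv\<^bsub>G\<^esub> (b q)) q \<phi> x =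
        finsum k (\<lambda>i. ?\<rho> (inv\<^bsub>G\<^esub> (b q) [^]\<^bsub>G\<^esub> i) \<phi> x) {..<q}"
      unfolding V.orbit_sum_def
      by (rule finsum_function_module[OF k.is_cring]) (use \<phi> in \<open>auto simp: left_translation_apply\<close>)
    also have "\<dots> = \<zero>\<^bsub>k\<^esub>"
    proof (cases "x \<in> A")
      case True
      then show ?thesis
        using F.alternating_sum_over_prime_coset[OF k.is_cring q cs_closed[OF True]] by (simp only: summand if_True)
    qed (simp add: summand)
    finally show "V.orbit_sum (inv\<^bsub>G\<^esub> (b q)) q \<phi> x = \<zero>\<^bsub>?V\<^esub> x" by simp
  qed
  obtain X :: "('k, ('g \<Rightarrow> 'k) set) module" and \<sigma> U \<pi> where
    sq: "representation_subquotient k G ?V ?\<rho> X \<sigma> U \<pi>" and Xirr: "irreducible_representation k G X \<sigma>"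
    and vU: "\<phi> \<in> U" "\<pi> \<phi> \<noteq> \<zero>\<^bsub>X\<^esub>"
    using V.ex_irreducible_subquotient[OF \<phi>V \<open>\<phi> \<noteq> \<zero>\<^bsub>?V\<^esub>\<close>] by blast
  interpret S: representation_subquotient k G ?V ?\<rho> X \<sigma> U \<pi> by (rule sq)
  let ?N = "S.X.action_kernel"
  have N: "?N \<lhd> G" by (rule S.X.action_kernel_normal)
  have Ns: "subgroup ?N G" by (rule normal_imp_subgroup[OF N])
  have \<pi>X: "\<pi> \<phi> \<in> carrier X" by (rule S.proj_closed[OF vU(1)])
  have AN_C: "x \<in> C" if x: "x \<in> A" "x \<in> ?N" for x
  proof (rule ccontr)
    assume xC: "x \<notin> C"
    have xG: "x \<in> carrier G" by (rule AG[OF x(1)])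
    have ord: "0 < G.ord x" "x [^]\<^bsub>G\<^esub> G.ord x \<in> C"
      using G.torsion_imp_finite_order[OF tor xG] xG subgroup.one_closed[OF CG] by auto
    obtain q m where q: "Factorial_Ring.prime q" and m: "x [^]\<^bsub>G\<^esub> (m::nat) \<notin> C"
      "(x [^]\<^bsub>G\<^esub> m) [^]\<^bsub>G\<^esub> (q::nat) \<in> C"
      using G.ex_power_of_prime_order_mod[OF CG xG xC ord] by metis
    let ?w = "x [^]\<^bsub>G\<^esub> m"
    have w: "?w \<in> A" by (rule powA[OF x(1)])
    have qP: "q \<in> P" using q m w by (auto simp: P_def)
    note bq = b(1)[OF qP] b(2)[OF qP] b(3)[OF qP]
    obtain i :: nat where i: "b q \<otimes>\<^bsub>G\<^esub> inv\<^bsub>G\<^esub> (?w [^]\<^bsub>G\<^esub> i) \<in> C"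
      using lay q w bq(1,3) m unfolding cyclic_prime_layers_def by blast
    define c where "c = b q \<otimes>\<^bsub>G\<^esub> inv\<^bsub>G\<^esub> (?w [^]\<^bsub>G\<^esub> i)"
    have c: "c \<in> C" "c \<in> carrier G" using i CA AG by (auto simp: c_def)
    let ?z = "?w [^]\<^bsub>G\<^esub> i"
    have z: "?z \<in> A" "?z \<in> carrier G" using powA[OF w] AG by auto
    have zN: "?z \<in> ?N"
      by (rule G.subgroup_nat_pow_closed[OF Ns G.subgroup_nat_pow_closed[OF Ns x(2)]])
    \<comment> \<open>A power of \<open>x\<close>, acting trivially, agrees with \<open>b\<^sub>q\<close> up to an element of \<open>C\<close>, which fixes \<open>\<phi>\<close>.\<close>
    have "b q = c \<otimes>\<^bsub>G\<^esub> ?z" using z(2) AG[OF bq(1)] by (simp add: c_def G.m_assoc)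
    then have "b q = ?z \<otimes>\<^bsub>G\<^esub> c" using commA[OF CA[OF c(1)] z(1)] by simp
    then have "?\<rho> (b q) \<phi> = ?\<rho> ?z \<phi>" using V.act_mult[OF z(2) c(2) \<phi>V] fix_C[OF c(1)] by simp
    then have "\<sigma> (b q) (\<pi> \<phi>) = \<sigma> ?z (\<pi> \<phi>)"
      using S.proj_act[OF _ vU(1)] AG[OF bq(1)] z(2) by metis
    then have bfix: "\<sigma> (b q) (\<pi> \<phi>) = \<pi> \<phi>" using zN \<pi>X by (simp add: S.X.action_kernel_def)
    have bG: "b q \<in> carrier G" by (rule AG[OF bq(1)])
    have "\<sigma> (inv\<^bsub>G\<^esub> (b q)) (\<pi> \<phi>) = \<pi> \<phi>" using S.X.act_inv(1)[OF bG \<pi>X] bfix by simp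
    then have "([q] \<cdot>\<^bsub>k\<^esub> \<one>\<^bsub>k\<^esub>) \<odot>\<^bsub>X\<^esub> \<pi> \<phi> = S.X.orbit_sum (inv\<^bsub>G\<^esub> (b q)) q (\<pi> \<phi>)"
      using S.X.orbit_sum_fixed[of "inv\<^bsub>G\<^esub> (b q)" "\<pi> \<phi>" q] bG \<pi>X by simp
    also have "\<dots> = \<pi> (V.orbit_sum (inv\<^bsub>G\<^esub> (b q)) q \<phi>)"
      using S.proj_orbit_sum[OF _ vU(1)] bG by simp
    also have "\<dots> = \<zero>\<^bsub>X\<^esub>" unfolding sum_zero[OF qP] by (rule S.proj_zero)
    finally have "([q] \<cdot>\<^bsub>k\<^esub> \<one>\<^bsub>k\<^esub>) \<odot>\<^bsub>X\<^esub> \<pi> \<phi> = \<zero>\<^bsub>X\<^esub>" .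
    moreover have "[q] \<cdot>\<^bsub>k\<^esub> \<one>\<^bsub>k\<^esub> \<noteq> \<zero>\<^bsub>k\<^esub>"
      by (rule G.layer_prime_nonzero_in_field[OF k tor As CG char q w m])
    ultimately show False using S.X.smult_eq_zero[of "[q] \<cdot>\<^bsub>k\<^esub> \<one>\<^bsub>k\<^esub>" "\<pi> \<phi>"] \<pi>X vU(2) by simp
  qed
  have "A \<inter> ?N \<subseteq> {\<one>\<^bsub>G\<^esub>}"
  proof
    fix x assume x: "x \<in> A \<inter> ?N"
    have "inv\<^bsub>G\<^esub> g \<otimes>\<^bsub>G\<^esub> x \<otimes>\<^bsub>G\<^esub> g \<in> C" if g: "g \<in> carrier G" for g
      using x normal.inv_op_closed1[OF An g] normal.inv_op_closed1[OF N g] by (intro AN_C) auto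
    then have "x \<in> normal_core G C"
      using G.mem_normal_core[of C x] subgroup.subset[OF CG] AG x by blast
    then show "x \<in> {\<one>\<^bsub>G\<^esub>}" by (simp add: core)
  qed
  then have "?N = {\<one>\<^bsub>G\<^esub>}" by (rule G.normal_meets_maximal_abelian_normal[OF sol max N])
  then have "faithful_representation k G X \<sigma>"
    unfolding faithful_representation_def
    using S.X.group_representation_axioms by (auto simp: S.X.action_kernel_def)
  with Xirr show ?thesis by (rule has_faithful_irreducible_representationI)
qed

theorem faithful_irreducible_imp_abelian_normal_conditions:
  fixes k :: "('k, 'm) ring_scheme" and G :: "('g, 'n) monoid_scheme"
  assumes G: "group G" and tor: "torsion_group G" and sol: "solvable G"
    and has: "has_faithful_irreducible_representation k G"
    and A: "abelian_normal_subgroup G A"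
  shows "ring_characteristic k \<notin> torsion_primes (G\<lparr>carrier := A\<rparr>)"
    "\<exists>C. subgroup C (G\<lparr>carrier := A\<rparr>) \<and> cyclic_prime_layers G A C \<and> normal_core G C = {\<one>\<^bsub>G\<^esub>}"
proof -
  obtain V :: "('k, 'g \<Rightarrow> 'k) module" and \<rho> where
    irr: "irreducible_representation k G V \<rho>" and faith: "faithful_representation k G V \<rho>"
    using has unfolding has_faithful_irreducible_representation_def by blast
  have lf: "locally_finite_on G (carrier G)"
    by (rule group.torsion_solvable_imp_locally_finite[OF G tor sol])
  show char: "ring_characteristic k \<notin> torsion_primes (G\<lparr>carrier := A\<rparr>)"
    by (rule characteristic_not_torsion_prime[OF irr faith lf A])
  show "\<exists>C. subgroup C (G\<lparr>carrier := A\<rparr>) \<and> cyclic_prime_layers G A C \<and> normal_core G C = {\<one>\<^bsub>G\<^esub>}"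
    by (rule faithful_irreducible_imp_core_free_subgroup[OF irr faith tor A char])
qed

lemma (in comm_group) carrier_maximal_abelian_normal:
  "maximal_abelian_normal_subgroup G (carrier G)"
proof -
  have "abelian_normal_subgroup G (carrier G)"
    using normal_self comm_group_axioms by (simp add: abelian_normal_subgroup_def)
  moreover have "B \<subseteq> carrier G" if "abelian_normal_subgroup G B" for B
    using that normal_imp_subgroup subgroup.subset unfolding abelian_normal_subgroup_def by blast
  ultimately show ?thesis unfolding maximal_abelian_normal_subgroup_def by blast
qed

lemma (in comm_group) normal_core_eq:
  assumes "subgroup C G" shows "normal_core G C = C"
proof -
  have C: "C \<subseteq> carrier G" using assms subgroup.subset by blast
  have "x \<in> normal_core G C" if "x \<in> C" for x
  proof -
    have "inv g \<otimes> x \<otimes> g = x" if "g \<in> carrier G" for g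
      using that \<open>x \<in> C\<close> C by (simp add: m_comm[of "inv g" x] m_assoc subsetD)
    then show ?thesis using mem_normal_core[OF C, of x] that C by auto
  qed
  then show ?thesis using normal_core_normal(2)[OF assms] by blast
qed

theorem corollary1p6:
  fixes k :: "('k, 'm) ring_scheme" and G :: "('g, 'n) monoid_scheme"
  assumes "field k" and "group G" and "torsion_group G" and "solvable G"
  shows "(comm_group G \<longrightarrow>
            (has_faithful_irreducible_representation k G \<longleftrightarrow>
             ring_characteristic k \<notin> torsion_primes G \<and> locally_cyclic G)) \<and>
         (\<not> comm_group G \<longrightarrow>
            (has_faithful_irreducible_representation k G \<longleftrightarrow>
             (\<exists>A. maximal_abelian_normal_subgroup G A \<and>
                  ring_characteristic k \<notin> torsion_primes (G\<lparr>carrier := A\<rparr>) \<and>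
                  (\<exists>C. subgroup C (G\<lparr>carrier := A\<rparr>) \<and>
                       locally_cyclic ((G\<lparr>carrier := A\<rparr>) Mod C) \<and>
                       normal_core G C = {\<one>\<^bsub>G\<^esub>}))))"
proof (intro conjI impI)
  interpret G: group G by fact
  note fwd = faithful_irreducible_imp_abelian_normal_conditions[OF assms(2-4)]
  note bwd = core_free_subgroup_imp_faithful_irreducible[OF assms]
  {
    assume "comm_group G"
    then interpret C: comm_group G .
    note max = C.carrier_maximal_abelian_normal
    have ab: "abelian_normal_subgroup G (carrier G)"
      using max by (simp add: maximal_abelian_normal_subgroup_def)
    have lc: "locally_cyclic G \<longleftrightarrow> cyclic_prime_layers G (carrier G) {\<one>\<^bsub>G\<^esub>}"
      by (rule C.locally_cyclic_iff_layers[OF assms(3)])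
    show "has_faithful_irreducible_representation k G \<longleftrightarrow>
        ring_characteristic k \<notin> torsion_primes G \<and> locally_cyclic G"
    proof
      assume has: "has_faithful_irreducible_representation k G"
      obtain C where C: "subgroup C G" "cyclic_prime_layers G (carrier G) C" "normal_core G C = {\<one>\<^bsub>G\<^esub>}"
        using fwd(2)[OF has ab] by auto
      then have "C = {\<one>\<^bsub>G\<^esub>}" using C.normal_core_eq by simp
      then show "ring_characteristic k \<notin> torsion_primes G \<and> locally_cyclic G"
        using fwd(1)[OF has ab] C(2) lc by simp
    next
      assume *: "ring_characteristic k \<notin> torsion_primes G \<and> locally_cyclic G"
      show "has_faithful_irreducible_representation k G"
        by (rule bwd[OF max, of "{\<one>\<^bsub>G\<^esub>}"])
           (use * lc G.triv_subgroup C.normal_core_eq[OF G.triv_subgroup] in simp_all)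
    qed
  next
    have lc: "locally_cyclic ((G\<lparr>carrier := A\<rparr>) Mod C) \<longleftrightarrow> cyclic_prime_layers G A C"
      if "abelian_normal_subgroup G A" "subgroup C (G\<lparr>carrier := A\<rparr>)" for A C
      by (rule G.locally_cyclic_quotient_iff_layers[OF assms(3) _ _ that(2)])
         (use that(1) normal_imp_subgroup in \<open>auto simp: abelian_normal_subgroup_def\<close>)
    have ab: "abelian_normal_subgroup G A" if "maximal_abelian_normal_subgroup G A" for A
      using that by (simp add: maximal_abelian_normal_subgroup_def)
    show "has_faithful_irreducible_representation k G \<longleftrightarrow>
        (\<exists>A. maximal_abelian_normal_subgroup G A \<and>
          ring_characteristic k \<notin> torsion_primes (G\<lparr>carrier := A\<rparr>) \<and>
          (\<exists>C. subgroup C (G\<lparr>carrier := A\<rparr>) \<and> locally_cyclic ((G\<lparr>carrier := A\<rparr>) Mod C) \<and>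
            normal_core G C = {\<one>\<^bsub>G\<^esub>}))"
    proof
      assume has: "has_faithful_irreducible_representation k G"
      obtain A where A: "maximal_abelian_normal_subgroup G A"
        using G.ex_maximal_abelian_normal_subgroup by blast
      obtain C where "subgroup C (G\<lparr>carrier := A\<rparr>)" "cyclic_prime_layers G A C" "normal_core G C = {\<one>\<^bsub>G\<^esub>}"
        using fwd(2)[OF has ab[OF A]] by blast
      then show "\<exists>A. maximal_abelian_normal_subgroup G A \<and>
          ring_characteristic k \<notin> torsion_primes (G\<lparr>carrier := A\<rparr>) \<and>
          (\<exists>C. subgroup C (G\<lparr>carrier := A\<rparr>) \<and> locally_cyclic ((G\<lparr>carrier := A\<rparr>) Mod C) \<and>
            normal_core G C = {\<one>\<^bsub>G\<^esub>})"
        using A fwd(1)[OF has ab[OF A]] lc[OF ab[OF A]] by blast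
    next
      assume "\<exists>A. maximal_abelian_normal_subgroup G A \<and>
          ring_characteristic k \<notin> torsion_primes (G\<lparr>carrier := A\<rparr>) \<and>
          (\<exists>C. subgroup C (G\<lparr>carrier := A\<rparr>) \<and> locally_cyclic ((G\<lparr>carrier := A\<rparr>) Mod C) \<and>
            normal_core G C = {\<one>\<^bsub>G\<^esub>})"
      then obtain A C where A: "maximal_abelian_normal_subgroup G A"
        "ring_characteristic k \<notin> torsion_primes (G\<lparr>carrier := A\<rparr>)"
        and C: "subgroup C (G\<lparr>carrier := A\<rparr>)" "locally_cyclic ((G\<lparr>carrier := A\<rparr>) Mod C)"
        "normal_core G C = {\<one>\<^bsub>G\<^esub>}"
        by blast
      show "has_faithful_irreducible_representation k G"
        by (rule bwd[OF A C(1) _ C(3)]) (use lc[OF ab[OF A(1)] C(1)] C(2) in simp)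
    qed
  }
qed

end
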